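(* Let $a>1$. For every $\theta\in\mathbb R$ the limit $\Lambda_a(\theta):=\lim_{L\to\infty}\Lambda_{a,L}(\theta)$ exists, and the convergence is locally uniform in $\theta\in\mathbb R$. Moreover, $$\Lambda_a(\theta)=\frac{1}{2\pi}\int_0^\infty \log\left(1+(e^\theta-1)(e^{-2\xi}-e^{-2a\xi})\right)\,\mathrm d\xi .$$ The function $\Lambda_a$ is real analytic on $\mathbb R$ and extends holomorphically to $S_\pi:=\{\theta\in\mathbb C:|\operatorname{Im}\theta|<\pi\}$, where the extension is given by the same integral formula with the logarithm being the branch obtained by analytic continuation from $\theta=0$. Furthermore, $$\Lambda_a'(0)=\frac{1}{4\pi}\left(1-\frac1a\right),\qquad \Lambda_a''(0)=\frac{(a-1)(a+3)}{8\pi a(a+1)}.$$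
   Context: Let $\mathbb H=\{z\in\mathbb C:\operatorname{Im}z>0\}$ with planar Lebesgue measure $\mathrm dA$. Let $\mathcal Z$ be the determinantal point process on $(\mathbb H,\mathrm dA)$ with Hermitian correlation kernel $K_{\mathbb H}(z,w)=-\frac{1}{\pi(z-\overline w)^2}$. (Equivalently, $\mathcal Z$ is the zero set of the Gaussian analytic function $f(z)=(\varphi'(z))^{1/2}\sum_{n\ge0}\xi_n\varphi(z)^n$, with $\varphi(z)=\frac{z-i}{z+i}$ and $\xi_n$ i.i.d. standard complex Gaussians.) For $a>1$ and $L>0$ set $$N_a(L):=\#\{z\in\mathcal Z:0\le\operatorname{Re}z\le L,\ 1\le\operatorname{Im}z\le a\},\qquad \Lambda_{a,L}(\theta):=\frac1L\log\mathbb E\exp(\theta N_a(L)).$$ *)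

theory Defs
  imports "HOL-Probability.Probability" "Jordan_Normal_Form.Determinant"
begin

text \<open>
  Point processes are random locally finite subsets of \<open>space \<mu>\<close>, where \<open>\<mu>\<close> is the
  reference measure; in particular they are simple. Counts are \<open>\<infinity>\<close> on infinite sets, since
  \<open>card\<close> would be \<open>0\<close> there.
\<close>

definition point_process ::
  "'w measure \<Rightarrow> 'b::topological_space measure \<Rightarrow> ('w \<Rightarrow> 'b set) \<Rightarrow> bool" where
  "point_process M \<mu> Z \<longleftrightarrow>
     prob_space M \<and>
     (\<forall>\<omega>\<in>space M. Z \<omega> \<subseteq> space \<mu> \<and> (\<forall>C. compact C \<and> C \<subseteq> space \<mu> \<longrightarrow> finite (Z \<omega> \<inter> C))) \<and>
     (\<forall>B\<in>sets \<mu>. (\<lambda>\<omega>. emeasure (count_space UNIV) (Z \<omega> \<inter> B)) \<in> borel_measurable M)"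

text \<open>
  \<open>\<rho>\<close> is the \<open>k\<close>-point correlation function (joint intensity) of \<open>Z\<close> with respect to \<open>\<mu>\<close>:
  it is the density of the \<open>k\<close>-th factorial moment measure, which assigns to \<open>B\<close> the expected
  number of \<open>k\<close>-tuples of distinct points of \<open>Z\<close> lying in \<open>B\<close>. Tuples are the (extensional)
  functions on \<open>{..<k}\<close> that form the space of the product measure.
\<close>

definition correlation_function ::
  "'w measure \<Rightarrow> 'b measure \<Rightarrow> ('w \<Rightarrow> 'b set) \<Rightarrow> nat \<Rightarrow> ((nat \<Rightarrow> 'b) \<Rightarrow> real) \<Rightarrow> bool" where
  "correlation_function M \<mu> Z k \<rho> \<longleftrightarrow>
     (\<forall>z\<in>{..<k} \<rightarrow>\<^sub>E space \<mu>. 0 \<le> \<rho> z) \<and>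
     \<rho> \<in> borel_measurable (Pi\<^sub>M {..<k} (\<lambda>_. \<mu>)) \<and>
     (\<forall>B\<in>sets (Pi\<^sub>M {..<k} (\<lambda>_. \<mu>)).
        (\<integral>\<^sup>+\<omega>. emeasure (count_space UNIV) {z\<in>B. inj_on z {..<k} \<and> (\<forall>i<k. z i \<in> Z \<omega>)} \<partial>M) =
        (\<integral>\<^sup>+z\<in>B. ennreal (\<rho> z) \<partial>(Pi\<^sub>M {..<k} (\<lambda>_. \<mu>))))"

definition determinantal_process ::
  "'w measure \<Rightarrow> 'b::topological_space measure \<Rightarrow> ('b \<Rightarrow> 'b \<Rightarrow> complex) \<Rightarrow> ('w \<Rightarrow> 'b set) \<Rightarrow> bool" where
  "determinantal_process M \<mu> K Z \<longleftrightarrow>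
     point_process M \<mu> Z \<and>
     (\<forall>k. \<exists>\<rho>. correlation_function M \<mu> Z k \<rho> \<and>
        (\<forall>z\<in>{..<k} \<rightarrow>\<^sub>E space \<mu>.
           complex_of_real (\<rho> z) = Determinant.det (mat k k (\<lambda>(i, j). K (z i) (z j)))))"

definition upper_half_plane :: "complex set" where
  "upper_half_plane = {z. 0 < Im z}"

abbreviation area_H :: "complex measure" where
  "area_H \<equiv> restrict_space lborel upper_half_plane"

definition K_H :: "complex \<Rightarrow> complex \<Rightarrow> complex" where
  "K_H z w = - 1 / (of_real pi * (z - cnj w)\<^sup>2)"

definition box_count :: "('w \<Rightarrow> complex set) \<Rightarrow> real \<Rightarrow> real \<Rightarrow> 'w \<Rightarrow> nat" where
  "box_count Z a L \<omega> = card {z \<in> Z \<omega>. 0 \<le> Re z \<and> Re z \<le> L \<and> 1 \<le> Im z \<and> Im z \<le> a}"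

definition scaled_log_mgf ::
  "'w measure \<Rightarrow> ('w \<Rightarrow> complex set) \<Rightarrow> real \<Rightarrow> real \<Rightarrow> real \<Rightarrow> real" where
  "scaled_log_mgf M Z a L \<theta> =
     1 / L * ln (\<integral>\<omega>. exp (\<theta> * real (box_count Z a L \<omega>)) \<partial>M)"

definition real_analytic_on :: "(real \<Rightarrow> real) \<Rightarrow> real set \<Rightarrow> bool" where
  "real_analytic_on f S \<longleftrightarrow>
     (\<forall>x\<in>S. \<exists>r>0. \<exists>c. \<forall>y\<in>ball x r. (\<lambda>n. c n * (y - x) ^ n) sums f y)"

definition strip_pi :: "complex set" where
  "strip_pi = {\<theta>. \<bar>Im \<theta>\<bar> < pi}"

text \<open>
  The branch of \<open>log h\<close> on a connected open set \<open>S\<close> containing \<open>0\<close> that is obtained by analytic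
  continuation from the principal value at \<open>0\<close>; these conditions determine \<open>l\<close> on \<open>S\<close>.
\<close>

definition log_branch_from_0 ::
  "complex set \<Rightarrow> (complex \<Rightarrow> complex) \<Rightarrow> (complex \<Rightarrow> complex) \<Rightarrow> bool" where
  "log_branch_from_0 S h l \<longleftrightarrow>
     l holomorphic_on S \<and> l 0 = Ln (h 0) \<and> (\<forall>\<theta>\<in>S. exp (l \<theta>) = h \<theta>)"

end

theory Submission
  imports Defs "HOL-Complex_Analysis.Complex_Analysis" "HOL-Real_Asymp.Real_Asymp"
    "Jordan_Normal_Form.Schur_Decomposition"
begin

text \<open>
  Let \<open>D = [0, L] \<times> [1, a]\<close>, let \<open>N\<close> be the number of points in \<open>D\<close> and let \<open>K\<^sub>D\<close> be the integral operator
  with kernel \<open>K_H\<close> on \<open>D\<close>. The factorial moments of \<open>N\<close> are the integrals over \<open>D\<^sup>k\<close> of the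
  determinants of \<open>K_H\<close>, so \<open>E (1 + u)\<^sup>N\<close> is the Fredholm determinant of \<open>1 + u K\<^sub>D\<close> and its logarithm is
  the trace of \<open>ln (1 + u K\<^sub>D)\<close>. Since
  \<open>K_H z w = 1/\<pi> \<integral>\<^sub>0\<^sup>\<infinity> \<xi> exp (\<i> \<xi> (z - cnj w)) d\<xi>\<close> depends only on the difference of the real parts, \<open>K\<^sub>D\<close> is a
  truncated convolution whose Fourier symbol at frequency \<open>\<xi>\<close> is an operator of rank one on \<open>[1, a]\<close>
  with the eigenvalue \<open>\<sigma>(\<xi>) = exp (- 2 \<xi>) - exp (- 2 a \<xi>)\<close>. As in the first Szego limit theorem,
  truncation is harmless to first order and \<open>tr f(K\<^sub>D) / L\<close> tends to \<open>1/(2\<pi>) \<integral>\<^sub>0\<^sup>\<infinity> f(\<sigma>(\<xi>)) d\<xi>\<close> whenever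
  \<open>f(0) = 0\<close>. With \<open>f(y) = ln (1 + u y)\<close> and \<open>u = exp \<theta> - 1\<close> this is the formula for the limit.

  To make this rigorous by elementary means, \<open>K_H\<close> is expanded in the Bergman basis of the disc,
  pulled back to the half-plane. The truncations of the expansion have finite rank, and Schur
  triangularisation of their Gram matrices (\<open>hermitian_kernel_spectrum\<close>) gives nonnegative
  eigenvalues whose power sums are the traces of powers and whose elementary symmetric polynomials
  are the integrated minors. Both pass to the limit (\<open>approximate_spectrum\<close>). The generating function
  \<open>E (1 + u)\<^sup>N\<close> is positive for \<open>u > -1\<close>, hence the approximating products eventually have no zero in an interval
  \<open>[-1/b, 0]\<close> with \<open>b > 1\<close>, which means that the eigenvalues are at most \<open>b\<close>. On \<open>[0, b]\<close> the function
  \<open>ln (1 + u y)\<close> is \<open>y\<close> times a uniform limit of polynomials, so everything reduces to traces of powers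
  (\<open>ln_generating_function_approx\<close>).

  These traces are computed for the \<open>L\<close>-periodisation of \<open>K_H\<close>, which the plane waves
  \<open>exp (2 \<pi> \<i> j z / L)\<close>, \<open>j \<ge> 1\<close>, diagonalise on \<open>D\<close> with the eigenvalues \<open>\<sigma>(2 \<pi> j / L)\<close>; their power sums,
  divided by \<open>L\<close>, are Riemann sums. The two kernels differ only by the periodic images, which are of
  size \<open>1/L\<^sup>2\<close> except where one point is near the left end of \<open>D\<close> and the other near the right end. Their
  \<open>L\<^sup>1\<close> distance is therefore at most of order \<open>(ln L)\<^sup>2\<close> (\<open>dist_L1_le\<close>), whereas the row sums of both kernels are
  bounded uniformly in \<open>L\<close>, so the traces differ by \<open>o(L)\<close> (\<open>trace_limit\<close>).

  For \<open>|Im \<theta>| < \<pi>\<close> the number \<open>1 + (exp \<theta> - 1) \<sigma>\<close> is a convex combination of \<open>1\<close> and \<open>exp \<theta>\<close> and avoids the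
  negative half-line, so the branch of the logarithm is the principal one. Integrating Taylor series
  under the integral sign (\<open>parameter_integral_power_series\<close>) gives the holomorphic extension and the
  derivatives at \<open>0\<close>. Convergence is locally uniform because the functions are increasing in \<open>\<theta>\<close> and the limit
  is continuous (\<open>mono_pointwise_limit_uniform\<close>).
\<close>


section \<open>Injective tuples and principal minors\<close>

lemma card_injective_tuples:
  assumes "finite S"
  shows "card {f \<in> {..<k} \<rightarrow>\<^sub>E S. inj_on f {..<k}} = fact k * (card S choose k)"
proof -
  have "real (card {f \<in> {..<k} \<rightarrow>\<^sub>E S. inj_on f {..<k}}) = real (\<Prod>i<k. card S - i)"
    using card_inj_on_subset_funcset[of "{..<k}" S "{..<k}"] assms
    by (simp add: atLeast0LessThan)
  also have "\<dots> = real (fact k * (card S choose k))"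
  proof (cases "k \<le> card S")
    case True
    have "real (\<Prod>i<k. card S - i) = (\<Prod>i<k. real (card S) - real i)"
      using True by (auto intro!: prod.cong simp: of_nat_diff)
    also have "\<dots> = fact k * real (card S choose k)"
      by (simp add: binomial_gbinomial gbinomial_prod_rev atLeast0LessThan)
    finally show ?thesis by simp
  next
    case False
    then have "card S \<in> {..<k}" by simp
    then have "(\<Prod>i<k. card S - i) = 0" by (intro prod_zero) auto
    with False show ?thesis by (simp add: binomial_eq_0)
  qed
  finally show ?thesis by (simp only: of_nat_eq_iff)
qed

definition elem_sym :: "nat \<Rightarrow> (nat \<Rightarrow> real) \<Rightarrow> nat \<Rightarrow> real" where
  "elem_sym n x k = (\<Sum>S | S \<subseteq> {..<n} \<and> card S = k. \<Prod>j\<in>S. x j)"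

text \<open>
  A set with \<open>k\<close> elements is the range of exactly \<open>k!\<close> injective tuples of length \<open>k\<close>.
\<close>

lemma sum_injective_tuples:
  fixes x :: "nat \<Rightarrow> real"
  shows "(\<Sum>m\<in>{..<k} \<rightarrow>\<^sub>E {..<n}. if inj_on m {..<k} then \<Prod>i<k. x (m i) else 0)
           = fact k * elem_sym n x k"
proof -
  let ?A = "{m \<in> {..<k} \<rightarrow>\<^sub>E {..<n}. inj_on m {..<k}}"
  let ?B = "{S. S \<subseteq> {..<n} \<and> card S = k}"
  have finA: "finite ?A" by (intro finite_subset[OF _ finite_PiE[of "{..<k}" "\<lambda>_. {..<n}"]]) auto
  have finB: "finite ?B" by (rule finite_subset[of _ "Pow {..<n}"]) auto
  have img: "(\<lambda>m. m ` {..<k}) ` ?A \<subseteq> ?B"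
    by (force simp: card_image PiE_iff)
  have "(\<Sum>m\<in>{..<k} \<rightarrow>\<^sub>E {..<n}. if inj_on m {..<k} then \<Prod>i<k. x (m i) else 0)
      = (\<Sum>m\<in>?A. \<Prod>i<k. x (m i))"
    by (simp add: sum.inter_filter finite_PiE)
  also have "\<dots> = (\<Sum>S\<in>?B. \<Sum>m | m \<in> ?A \<and> m ` {..<k} = S. \<Prod>i<k. x (m i))"
    by (rule sum.group[OF finA finB img, symmetric])
  also have "\<dots> = (\<Sum>S\<in>?B. fact k * (\<Prod>j\<in>S. x j))"
  proof (rule sum.cong[OF refl])
    fix S assume S: "S \<in> ?B"
    then have fS: "finite S" using finite_subset by auto
    have eq: "{m. m \<in> ?A \<and> m ` {..<k} = S} = {f \<in> {..<k} \<rightarrow>\<^sub>E S. inj_on f {..<k}}"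
    proof (intro equalityI subsetI)
      fix f assume f: "f \<in> {f \<in> {..<k} \<rightarrow>\<^sub>E S. inj_on f {..<k}}"
      then have "f ` {..<k} \<subseteq> S" by auto
      moreover have "card (f ` {..<k}) = card S" using f S by (simp add: card_image)
      ultimately have "f ` {..<k} = S" using fS by (simp add: card_subset_eq)
      then show "f \<in> {m. m \<in> ?A \<and> m ` {..<k} = S}" using f S by (auto simp: PiE_iff)
    qed (auto simp: PiE_iff)
    have "(\<Sum>m | m \<in> ?A \<and> m ` {..<k} = S. \<Prod>i<k. x (m i)) 
        = (\<Sum>m | m \<in> ?A \<and> m ` {..<k} = S. \<Prod>j\<in>S. x j)"
    proof (rule sum.cong[OF refl])
      fix m assume "m \<in> {m. m \<in> ?A \<and> m ` {..<k} = S}"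
      then have "inj_on m {..<k}" "m ` {..<k} = S" by auto
      then show "(\<Prod>i<k. x (m i)) = (\<Prod>j\<in>S. x j)"
        by (metis (no_types, lifting) prod.reindex_cong)
    qed
    also have "\<dots> = fact k * (\<Prod>j\<in>S. x j)"
      unfolding eq using card_injective_tuples[OF fS, of k] S by simp
    finally show "(\<Sum>m | m \<in> ?A \<and> m ` {..<k} = S. \<Prod>i<k. x (m i)) = fact k * (\<Prod>j\<in>S. x j)" .
  qed
  finally show ?thesis by (simp add: elem_sym_def sum_distrib_left)
qed

lemma elem_sym_nonneg: "(\<And>j. j < n \<Longrightarrow> 0 \<le> x j) \<Longrightarrow> 0 \<le> elem_sym n x k"
  by (auto simp: elem_sym_def intro!: sum_nonneg prod_nonneg)

text \<open>
  Omitting the injectivity of the tuples leaves the expansion of the \<open>k\<close>-th power of the sum.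
\<close>

lemma elem_sym_le:
  assumes "\<And>j. j < n \<Longrightarrow> 0 \<le> x j"
  shows "fact k * elem_sym n x k \<le> (\<Sum>j<n. x j) ^ k"
proof -
  have "fact k * elem_sym n x k \<le> (\<Sum>m\<in>{..<k} \<rightarrow>\<^sub>E {..<n}. \<Prod>i<k. x (m i))"
    unfolding sum_injective_tuples[symmetric]
    by (intro sum_mono) (use assms in \<open>auto intro!: prod_nonneg simp: PiE_iff\<close>)
  also have "\<dots> = (\<Prod>i<k. \<Sum>j<n. x j)"
    by (subst prod_sum_PiE) auto
  finally show ?thesis by simp
qed

lemma elem_sym_eq_0: "n < k \<Longrightarrow> elem_sym n x k = 0"
proof -
  assume "n < k"
  then have "{S. S \<subseteq> {..<n} \<and> card S = k} = {}"
    using card_mono[of "{..<n}"] by (auto simp: not_le[symmetric])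
  then show ?thesis by (simp only: elem_sym_def) simp
qed

lemma prod_one_plus_elem_sym:
  "(\<lambda>k. elem_sym n x k * u ^ k) sums (\<Prod>j<n. 1 + u * x j)"
proof -
  have "(\<Prod>j<n. 1 + u * x j) = (\<Sum>S\<in>Pow {..<n}. (\<Prod>j\<in>S. u * x j))"
    by (simp add: prod_add add.commute[of 1])
  also have "\<dots> = (\<Sum>k\<le>n. \<Sum>S | S \<in> Pow {..<n} \<and> card S = k. \<Prod>j\<in>S. u * x j)"
    by (rule sum.group[symmetric]) (auto dest: card_mono[rotated])
  also have "\<dots> = (\<Sum>k\<le>n. elem_sym n x k * u ^ k)"
    by (auto simp: elem_sym_def sum_distrib_left prod.distrib mult.commute intro!: sum.cong)
  finally show ?thesis
    using sums_finite[of "{..n}" "\<lambda>k. elem_sym n x k * u ^ k"] by (simp add: elem_sym_eq_0)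
qed

lemma det_permutation_sum:
  "Determinant.det (Matrix.mat k k (\<lambda>(i, j). K (z i) (z j)))
     = (\<Sum>p | p permutes {0..<k}. signof p * (\<Prod>i<k. K (z i) (z (p i))))"
  for K :: "'b \<Rightarrow> 'b \<Rightarrow> complex"
  unfolding det_def'[OF mat_carrier]
  by (intro sum.cong refl arg_cong2[where f="(*)"])
     (auto simp: atLeast0LessThan permutes_in_image intro!: prod.cong)

text \<open>
  A permutation \<open>p\<close> contributes only if \<open>m i \<le> m (p i)\<close> for all \<open>i\<close>. Both sides have the same sum over \<open>i\<close>, so
  equality holds throughout, and \<open>p\<close> is the identity if \<open>m\<close> is injective. If \<open>m\<close> takes a value twice, the
  minor has two equal rows.
\<close>

lemma triangular_minor:
  fixes T :: "nat \<Rightarrow> nat \<Rightarrow> complex"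
  assumes T: "\<And>i j. i < n \<Longrightarrow> j < i \<Longrightarrow> T i j = 0"
    and m: "m \<in> {..<k} \<rightarrow>\<^sub>E {..<n}"
  shows "(\<Sum>p | p permutes {0..<k}. signof p * (\<Prod>i<k. T (m i) (m (p i))))
           = (if inj_on m {..<k} then \<Prod>i<k. T (m i) (m i) else 0)"
proof (cases "inj_on m {..<k}")
  case True
  have *: "signof p * (\<Prod>i<k. T (m i) (m (p i))) = 0" if p: "p permutes {0..<k}" and "p \<noteq> id" for p
  proof (rule ccontr)
    assume "signof p * (\<Prod>i<k. T (m i) (m (p i))) \<noteq> 0"
    then have nz: "T (m i) (m (p i)) \<noteq> 0" if "i < k" for i using that by auto
    have pk: "p i < k" if "i < k" for i using permutes_in_image[OF p, of i] that by auto
    have le: "m i \<le> m (p i)" if "i < k" for i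
      using nz[OF that] T[of "m i" "m (p i)"] m that by (force simp: PiE_iff)
    have sm: "(\<Sum>i<k. m (p i)) = (\<Sum>i<k. m i)"
      using sum.permute[OF p, of m] by (simp add: atLeast0LessThan o_def)
    have eq: "m i = m (p i)" if "i < k" for i
    proof (rule ccontr)
      assume "m i \<noteq> m (p i)"
      then have "m i < m (p i)" using le[OF that] by simp
      then have "(\<Sum>i<k. m i) < (\<Sum>i<k. m (p i))"
        by (intro sum_strict_mono_ex1) (use le that in auto)
      then show False using sm by simp
    qed
    have "p i = i" for i
    proof (cases "i < k")
      case i: True
      show ?thesis using eq[OF i] inj_onD[OF True, of i "p i"] pk[OF i] i by auto
    next
      case False
      then show ?thesis using permutes_not_in[OF p, of i] by simp
    qed
    then show False using \<open>p \<noteq> id\<close> by auto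
  qed
  have "(\<Sum>p | p permutes {0..<k}. signof p * (\<Prod>i<k. T (m i) (m (p i))))
      = (\<Sum>p\<in>{id}. signof p * (\<Prod>i<k. T (m i) (m (p i))))"
    by (rule sum.mono_neutral_right) (use * in \<open>auto simp: finite_permutations permutes_id\<close>)
  then show ?thesis using True by (simp add: sign_id)
next
  case False
  then obtain i j where ij: "i < k" "j < k" "i \<noteq> j" "m i = m j" by (auto simp: inj_on_def)
  let ?A = "Matrix.mat k k (\<lambda>(i, j). T (m i) (m j))"
  have "Determinant.det ?A = 0"
    by (rule det_identical_rows[of _ k i j]) (use ij in auto)
  moreover have "Determinant.det ?A
      = (\<Sum>p | p permutes {0..<k}. signof p * (\<Prod>i<k. T (m i) (m (p i))))"
    by (rule det_permutation_sum)
  ultimately show ?thesis using False by simp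
qed


section \<open>Finite-rank kernels\<close>

text \<open>
  Indices are shifted by one, because the zeroth power of an integral operator has no kernel:
  \<open>iter_kernel \<nu> K k\<close> is the kernel of the power \<open>k + 1\<close> of the operator with kernel \<open>K\<close>, and \<open>kernel_trace \<nu> K k\<close>
  is the trace of that power.
\<close>

primrec iter_kernel :: "'b measure \<Rightarrow> ('b \<Rightarrow> 'b \<Rightarrow> complex) \<Rightarrow> nat \<Rightarrow> 'b \<Rightarrow> 'b \<Rightarrow> complex" where
  "iter_kernel \<nu> K 0 = K"
| "iter_kernel \<nu> K (Suc k) = (\<lambda>z w. \<integral>\<zeta>. iter_kernel \<nu> K k z \<zeta> * K \<zeta> w \<partial>\<nu>)"

definition kernel_trace :: "'b measure \<Rightarrow> ('b \<Rightarrow> 'b \<Rightarrow> complex) \<Rightarrow> nat \<Rightarrow> complex" where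
  "kernel_trace \<nu> K k = (\<integral>z. iter_kernel \<nu> K k z z \<partial>\<nu>)"

text \<open>
  This is \<open>k!\<close> times the coefficient of \<open>u\<^sup>k\<close> in the Fredholm determinant of \<open>1 + u K\<close>.
\<close>

definition minor_integral :: "'b measure \<Rightarrow> ('b \<Rightarrow> 'b \<Rightarrow> complex) \<Rightarrow> nat \<Rightarrow> complex" where
  "minor_integral \<nu> K k =
     (\<integral>z. Determinant.det (Matrix.mat k k (\<lambda>(i, j). K (z i) (z j))) \<partial>(Pi\<^sub>M {..<k} (\<lambda>_. \<nu>)))"

text \<open>
  Only the entries with indices below \<open>n\<close> matter; matrices as functions on all indices keep dimension
  conditions out of the statements about kernels.
\<close>

primrec mpow :: "nat \<Rightarrow> (nat \<Rightarrow> nat \<Rightarrow> complex) \<Rightarrow> nat \<Rightarrow> nat \<Rightarrow> nat \<Rightarrow> complex" where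
  "mpow n T 0 = (\<lambda>i j. if i = j then 1 else 0)"
| "mpow n T (Suc k) = (\<lambda>i j. \<Sum>p<n. mpow n T k i p * T p j)"

lemma mpow_triangular:
  assumes "\<And>i j. i < n \<Longrightarrow> j < i \<Longrightarrow> T i j = 0" and "i < n" "j \<le> i"
  shows "mpow n T k i j = (if i = j then T i i ^ k else 0)"
  using assms(3)
proof (induction k arbitrary: j)
  case (Suc k)
  have *: "mpow n T k i p * T p j = (if p = i then T i i ^ k * T i j else 0)" if "p < n" for p
    using Suc.IH[of p] assms(1)[of p j] Suc.prems that by (cases "p \<le> i") auto
  have "mpow n T (Suc k) i j = (\<Sum>p<n. if p = i then T i i ^ k * T i j else 0)"
    using * by simp
  also have "\<dots> = T i i ^ k * T i j" using assms(2) by simp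
  finally show ?case using assms(1)[of i j] assms(2) Suc.prems by auto
qed auto

text \<open>
  The two families are independent of each other: even if the kernel is Hermitian, the change of basis
  that makes its Gram matrix triangular need not be unitary.
\<close>

locale finite_rank_kernel =
  fixes \<nu> :: "'b measure" and n :: nat and \<psi> \<eta> :: "nat \<Rightarrow> 'b \<Rightarrow> complex"
    and T :: "nat \<Rightarrow> nat \<Rightarrow> complex" and K :: "'b \<Rightarrow> 'b \<Rightarrow> complex"
  assumes integrable_gram: "i < n \<Longrightarrow> j < n \<Longrightarrow> integrable \<nu> (\<lambda>x. \<eta> i x * \<psi> j x)"
    and gram: "i < n \<Longrightarrow> j < n \<Longrightarrow> (\<integral>x. \<eta> i x * \<psi> j x \<partial>\<nu>) = T i j"
    and kernel: "K z w = (\<Sum>i<n. \<psi> i z * \<eta> i w)"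
begin

lemma has_gram: "i < n \<Longrightarrow> j < n \<Longrightarrow> has_bochner_integral \<nu> (\<lambda>x. \<eta> i x * \<psi> j x) (T i j)"
  by (simp add: has_bochner_integral_iff integrable_gram gram)

text \<open>
  Composing two kernels pairs the second family of the one with the first family of the other, which
  inserts a factor \<open>T\<close> between the coefficient matrices.
\<close>

lemma iter_kernel_eq:
  "iter_kernel \<nu> K k z w = (\<Sum>i<n. \<Sum>j<n. \<psi> i z * mpow n T k i j * \<eta> j w)"
proof (induction k arbitrary: z w)
  case 0
  have "(\<Sum>i<n. \<Sum>j<n. \<psi> i z * (if i = j then 1 else 0) * \<eta> j w) = (\<Sum>i<n. \<psi> i z * \<eta> i w)"
    by (intro sum.cong refl) (simp add: if_distrib[of "\<lambda>x. _ * x"] if_distrib[of "\<lambda>x. x * _"] cong: if_cong)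
  then show ?case by (simp add: kernel)
next
  case (Suc k)
  have "iter_kernel \<nu> K (Suc k) z w =
      (\<integral>\<zeta>. (\<Sum>i<n. \<Sum>j<n. \<Sum>p<n. \<psi> i z * mpow n T k i j * \<eta> p w * (\<eta> j \<zeta> * \<psi> p \<zeta>)) \<partial>\<nu>)"
    by (simp add: Suc.IH kernel sum_product sum_distrib_left sum_distrib_right mult_ac)
  also have "\<dots> = (\<Sum>i<n. \<Sum>j<n. \<Sum>p<n. \<psi> i z * mpow n T k i j * \<eta> p w * T j p)"
    by (intro has_bochner_integral_integral_eq has_bochner_integral_sum
        has_bochner_integral_mult_right has_gram) auto
  also have "\<dots> = (\<Sum>i<n. \<Sum>p<n. \<Sum>j<n. \<psi> i z * mpow n T k i j * \<eta> p w * T j p)"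
    by (intro sum.cong[OF refl] sum.swap)
  also have "\<dots> = (\<Sum>i<n. \<Sum>p<n. \<psi> i z * mpow n T (Suc k) i p * \<eta> p w)"
    by (simp add: sum_distrib_left sum_distrib_right mult_ac)
  finally show ?case .
qed

lemma kernel_trace_eq: "kernel_trace \<nu> K k = (\<Sum>i<n. mpow n T (Suc k) i i)"
proof -
  have "kernel_trace \<nu> K k = (\<integral>z. (\<Sum>i<n. \<Sum>j<n. mpow n T k i j * (\<eta> j z * \<psi> i z)) \<partial>\<nu>)"
    by (simp add: kernel_trace_def iter_kernel_eq mult_ac)
  also have "\<dots> = (\<Sum>i<n. \<Sum>j<n. mpow n T k i j * T j i)"
    by (intro has_bochner_integral_integral_eq has_bochner_integral_sum
        has_bochner_integral_mult_right has_gram) auto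
  finally show ?thesis by simp
qed

lemma kernel_trace_triangular:
  assumes "\<And>i j. i < n \<Longrightarrow> j < i \<Longrightarrow> T i j = 0"
  shows "kernel_trace \<nu> K k = (\<Sum>i<n. T i i ^ Suc k)"
  unfolding kernel_trace_eq
  by (intro sum.cong refl) (simp only: mpow_triangular[OF assms] lessThan_iff, simp)

text \<open>
  This is the Andreief identity. Expanded by multilinearity, the determinant is a sum of products of
  functions of one point each. Regrouping the factors by the point on which they depend makes
  every integral a product of entries of \<open>T\<close>.
\<close>

lemma minor_integral_eq:
  assumes "sigma_finite_measure \<nu>"
  shows "minor_integral \<nu> K k = (\<Sum>m\<in>{..<k} \<rightarrow>\<^sub>E {..<n}.
           \<Sum>p | p permutes {0..<k}. signof p * (\<Prod>i<k. T (m i) (m (p i))))"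
proof -
  interpret sigma_finite_measure \<nu> by fact
  interpret product_sigma_finite "\<lambda>_ :: nat. \<nu>" by standard
  let ?P = "{p. p permutes {0..<k}}" and ?E = "{..<k} \<rightarrow>\<^sub>E {..<n}"
  let ?t = "\<lambda>m p (z :: nat \<Rightarrow> 'b). signof p * (\<Prod>j<k. \<eta> (m (inv_into UNIV p j)) (z j) * \<psi> (m j) (z j))"
  have det: "Determinant.det (Matrix.mat k k (\<lambda>(i, j). K (z i) (z j))) = (\<Sum>m\<in>?E. \<Sum>p\<in>?P. ?t m p z)" for z
  proof -
    have "Determinant.det (Matrix.mat k k (\<lambda>(i, j). K (z i) (z j)))
        = (\<Sum>p\<in>?P. signof p * (\<Prod>i<k. \<Sum>l<n. \<psi> l (z i) * \<eta> l (z (p i))))"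
      unfolding det_permutation_sum by (simp only: kernel)
    also have "\<dots> = (\<Sum>p\<in>?P. \<Sum>m\<in>?E. signof p * (\<Prod>i<k. \<psi> (m i) (z i) * \<eta> (m i) (z (p i))))"
      by (subst prod_sum_PiE) (auto simp: sum_distrib_left)
    also have "\<dots> = (\<Sum>p\<in>?P. \<Sum>m\<in>?E. ?t m p z)"
    proof (intro sum.cong refl arg_cong2[where f="(*)"])
      fix p m assume "p \<in> ?P"
      then have p: "p permutes {..<k}" by (simp add: atLeast0LessThan)
      have "(\<Prod>j<k. \<eta> (m (inv_into UNIV p j)) (z j)) = (\<Prod>i<k. \<eta> (m (inv_into UNIV p (p i))) (z (p i)))"
        using prod.permute[OF p, of "\<lambda>j. \<eta> (m (inv_into UNIV p j)) (z j)"] by (simp add: o_def)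
      also have "\<dots> = (\<Prod>i<k. \<eta> (m i) (z (p i)))"
        by (simp add: permutes_inverses[OF p])
      finally show "(\<Prod>i<k. \<psi> (m i) (z i) * \<eta> (m i) (z (p i)))
           = (\<Prod>j<k. \<eta> (m (inv_into UNIV p j)) (z j) * \<psi> (m j) (z j))"
        by (simp add: prod.distrib mult.commute)
    qed
    also have "\<dots> = (\<Sum>m\<in>?E. \<Sum>p\<in>?P. ?t m p z)" by (rule sum.swap)
    finally show ?thesis .
  qed
  have ix: "m (inv_into UNIV p j) < n" "m j < n" if "m \<in> ?E" "p \<in> ?P" "j < k" for m p j
  proof -
    have "inv_into UNIV p permutes {0..<k}" using that permutes_inv by blast
    then have "inv_into UNIV p j < k" using permutes_in_image[of "inv_into UNIV p" "{0..<k}" j] that by auto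
    then show "m (inv_into UNIV p j) < n" "m j < n" using that by (auto simp: PiE_iff)
  qed
  have int: "integrable (Pi\<^sub>M {..<k} (\<lambda>_. \<nu>)) (?t m p)" if "m \<in> ?E" "p \<in> ?P" for m p
    by (intro integrable_mult_right product_integrable_prod integrable_gram) (use ix[OF that] in auto)
  have "minor_integral \<nu> K k = (\<Sum>m\<in>?E. \<Sum>p\<in>?P. \<integral>z. ?t m p z \<partial>(Pi\<^sub>M {..<k} (\<lambda>_. \<nu>)))"
    unfolding minor_integral_def det
    by (intro has_bochner_integral_integral_eq has_bochner_integral_sum has_bochner_integral_integrable int)
  also have "\<dots> = (\<Sum>m\<in>?E. \<Sum>p\<in>?P. signof p * (\<Prod>i<k. T (m i) (m (p i))))"
  proof (intro sum.cong refl)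
    fix m p assume mp: "m \<in> ?E" "p \<in> ?P"
    then have p: "p permutes {..<k}" by (simp add: atLeast0LessThan)
    have "(\<integral>z. ?t m p z \<partial>(Pi\<^sub>M {..<k} (\<lambda>_. \<nu>)))
        = signof p * (\<Prod>j<k. \<integral>x. \<eta> (m (inv_into UNIV p j)) x * \<psi> (m j) x \<partial>\<nu>)"
      by (subst integral_mult_right_zero, subst product_integral_prod)
         (use ix[OF mp] in \<open>auto intro: integrable_gram\<close>)
    also have "(\<Prod>j<k. \<integral>x. \<eta> (m (inv_into UNIV p j)) x * \<psi> (m j) x \<partial>\<nu>) = (\<Prod>j<k. T (m (inv_into UNIV p j)) (m j))"
      using ix[OF mp] by (intro prod.cong refl gram) auto
    also have "\<dots> = (\<Prod>i<k. T (m (inv_into UNIV p (p i))) (m (p i)))"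
      using prod.permute[OF p, of "\<lambda>j. T (m (inv_into UNIV p j)) (m j)"] by (simp add: o_def)
    also have "\<dots> = (\<Prod>i<k. T (m i) (m (p i)))"
      by (simp add: permutes_inverses[OF p])
    finally show "(\<integral>z. ?t m p z \<partial>(Pi\<^sub>M {..<k} (\<lambda>_. \<nu>))) = signof p * (\<Prod>i<k. T (m i) (m (p i)))" .
  qed
  finally show ?thesis .
qed

lemma minor_integral_triangular:
  assumes "sigma_finite_measure \<nu>" and T: "\<And>i j. i < n \<Longrightarrow> j < i \<Longrightarrow> T i j = 0"
    and x: "\<And>i. i < n \<Longrightarrow> T i i = of_real (x i)"
  shows "minor_integral \<nu> K k = of_real (fact k * elem_sym n x k)"
proof -
  have "minor_integral \<nu> K k = (\<Sum>m\<in>{..<k} \<rightarrow>\<^sub>E {..<n}.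
      of_real (if inj_on m {..<k} then \<Prod>i<k. x (m i) else 0))"
    unfolding minor_integral_eq[OF assms(1)]
  proof (intro sum.cong refl)
    fix m assume m: "m \<in> {..<k} \<rightarrow>\<^sub>E {..<n}"
    have "(\<Prod>i<k. T (m i) (m i)) = (\<Prod>i<k. of_real (x (m i)))"
      using m by (intro prod.cong refl x) (auto simp: PiE_iff)
    then show "(\<Sum>p | p permutes {0..<k}. signof p * (\<Prod>i<k. T (m i) (m (p i))))
        = of_real (if inj_on m {..<k} then \<Prod>i<k. x (m i) else 0)"
      using triangular_minor[of n T m k, OF T m] by simp
  qed
  also have "\<dots> = of_real (fact k * elem_sym n x k)"
    unfolding sum_injective_tuples[symmetric] by simp
  finally show ?thesis .
qed

end


text \<open>
  An eigenvector \<open>v\<close> satisfies \<open>e * (\<Sum>i. |v\<^sub>i|\<^sup>2) = v\<^sup>* G v = \<integral> |\<Sum>j. v\<^sub>j \<phi>\<^sub>j|\<^sup>2\<close>, and the first sum is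
  positive.
\<close>

lemma gram_eigenvalue_nonneg:
  fixes \<phi> :: "nat \<Rightarrow> 'b \<Rightarrow> complex"
  assumes int: "\<And>i j. i < n \<Longrightarrow> j < n \<Longrightarrow> integrable \<nu> (\<lambda>x. cnj (\<phi> i x) * \<phi> j x)"
    and ev: "eigenvalue (Matrix.mat n n (\<lambda>(i, j). \<integral>x. cnj (\<phi> i x) * \<phi> j x \<partial>\<nu>)) e"
  shows "\<exists>r\<ge>0. e = of_real r"
proof -
  let ?G = "\<lambda>i j. \<integral>x. cnj (\<phi> i x) * \<phi> j x \<partial>\<nu>"
  obtain v where v: "v \<in> carrier_vec n" "v \<noteq> 0\<^sub>v n"
    "Matrix.mat n n (\<lambda>(i, j). ?G i j) *\<^sub>v v = e \<cdot>\<^sub>v v"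
    using ev by (auto simp: eigenvalue_def eigenvector_def)
  have row: "(\<Sum>j<n. ?G i j * (v $ j)) = e * (v $ i)" if "i < n" for i
  proof -
    have "(Matrix.mat n n (\<lambda>(i, j). ?G i j) *\<^sub>v v) $ i = (\<Sum>j<n. ?G i j * (v $ j))"
      using that v(1) by (auto simp: scalar_prod_def atLeast0LessThan intro!: sum.cong)
    then show ?thesis using v that by simp
  qed
  let ?s = "\<Sum>i<n. (cmod (v $ i))\<^sup>2"
  let ?q = "\<integral>x. (cmod (\<Sum>j<n. (v $ j) * \<phi> j x))\<^sup>2 \<partial>\<nu>"
  have "?s > 0"
  proof -
    obtain i where "i < n" "v $ i \<noteq> 0" using v(1,2) by (auto simp: vec_eq_iff)
    then show ?thesis by (intro sum_pos2[of _ i]) auto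
  qed
  have "e * of_real ?s = (\<Sum>i<n. cnj (v $ i) * (e * (v $ i)))"
    by (simp add: sum_distrib_left complex_norm_square mult_ac del: of_real_power)
  also have "\<dots> = (\<Sum>i<n. \<Sum>j<n. cnj (v $ i) * (v $ j) * ?G i j)"
    by (simp add: row[symmetric] sum_distrib_left mult_ac)
  also have "\<dots> = (\<integral>x. (\<Sum>i<n. \<Sum>j<n. cnj (v $ i) * (v $ j) * (cnj (\<phi> i x) * \<phi> j x)) \<partial>\<nu>)"
    by (rule sym, intro has_bochner_integral_integral_eq has_bochner_integral_sum
        has_bochner_integral_mult_right has_bochner_integral_integrable int) auto
  also have "(\<lambda>x. \<Sum>i<n. \<Sum>j<n. cnj (v $ i) * (v $ j) * (cnj (\<phi> i x) * \<phi> j x))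
      = (\<lambda>x. of_real ((cmod (\<Sum>j<n. (v $ j) * \<phi> j x))\<^sup>2))"
    by (simp only: complex_norm_square cnj_sum complex_cnj_mult sum_product)
       (subst sum.swap, simp add: mult_ac)
  also have "(\<integral>x. complex_of_real ((cmod (\<Sum>j<n. (v $ j) * \<phi> j x))\<^sup>2) \<partial>\<nu>) = of_real ?q"
    by (rule integral_complex_of_real)
  finally have *: "e * of_real ?s = of_real ?q" .
  have "e = of_real (q / s)" if "e * of_real s = of_real q" "s > 0" for s q :: real
    using that by (simp add: nonzero_eq_divide_eq)
  from this[OF * \<open>?s > 0\<close>] show ?thesis
    using \<open>?s > 0\<close> by (intro exI[of _ "?q / ?s"]) (auto intro!: divide_nonneg_pos)
qed

text \<open>
  Write the Gram matrix as \<open>G = P B Q\<close> with \<open>B\<close> triangular and \<open>P Q = 1\<close>. Replacing the families \<open>\<phi>\<close> and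
  \<open>cnj \<phi>\<close> by \<open>\<phi> P\<close> and \<open>Q (cnj \<phi>)\<close> does not change the kernel and turns the Gram matrix into \<open>Q G P = B\<close>. For a
  triangular Gram matrix traces and minors depend only on the diagonal, which consists of the
  eigenvalues of \<open>G\<close>.
\<close>

theorem hermitian_kernel_spectrum:
  fixes \<phi> :: "nat \<Rightarrow> 'b \<Rightarrow> complex"
  assumes sf: "sigma_finite_measure \<nu>"
    and int: "\<And>i j. i < n \<Longrightarrow> j < n \<Longrightarrow> integrable \<nu> (\<lambda>x. cnj (\<phi> i x) * \<phi> j x)"
    and K: "\<And>z w. K z w = (\<Sum>i<n. \<phi> i z * cnj (\<phi> i w))"
  obtains x :: "nat \<Rightarrow> real" where "\<And>j. j < n \<Longrightarrow> 0 \<le> x j"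
    "\<And>k. kernel_trace \<nu> K k = of_real (\<Sum>j<n. x j ^ Suc k)"
    "\<And>k. minor_integral \<nu> K k = of_real (fact k * elem_sym n x k)"
proof -
  let ?g = "\<lambda>i j. \<integral>x. cnj (\<phi> i x) * \<phi> j x \<partial>\<nu>"
  define G where "G = Matrix.mat n n (\<lambda>(i, j). ?g i j)"
  have G: "G \<in> carrier_mat n n" by (simp add: G_def)
  obtain es where es: "char_poly G = (\<Prod>a\<leftarrow>es. [:- a, 1:])" "length es = n"
    using char_poly_factorized[OF G] by auto
  obtain B P Q where "schur_decomposition G es = (B, P, Q)" by (metis prod_cases3)
  from schur_decomposition[OF G es(1) this]
  have wit: "similar_mat_wit G B P Q" and tri: "upper_triangular B" and diag: "diag_mat B = es" by auto
  note w = similar_mat_witD2[OF G wit]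
  define T where "T i j = B $$ (i, j)" for i j
  define \<psi> where "\<psi> l z = (\<Sum>m<n. \<phi> m z * P $$ (m, l))" for l z
  define \<eta> where "\<eta> l z = (\<Sum>m<n. Q $$ (l, m) * cnj (\<phi> m z))" for l z
  have T0: "T i j = 0" if "i < n" "j < i" for i j
    using tri w(5) that by (auto simp: T_def)
  have "\<exists>r\<ge>0. T i i = of_real r" if "i < n" for i
  proof -
    have "T i i = es ! i" using that w(5) by (auto simp: T_def diag[symmetric] diag_mat_def)
    then have "poly (char_poly G) (T i i) = 0"
      using that es by (simp add: poly_prod_list prod_list_zero_iff)
    then have "eigenvalue G (T i i)" using eigenvalue_root_char_poly[OF G] by simp
    then show ?thesis using gram_eigenvalue_nonneg[of n \<nu> \<phi>, OF int] by (simp add: G_def)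
  qed
  then obtain x where x: "x i \<ge> 0" "T i i = of_real (x i)" if "i < n" for i by metis
  have BQ: "Q * G * P = B"
  proof -
    note c [simp] = w(4-7)
    have "Q * G * P = Q * (P * (B * Q)) * P" using w(3) by (simp add: assoc_mult_mat[OF c(3) c(2) c(4)])
    also have "\<dots> = (Q * P) * (B * Q) * P"
      by (simp add: assoc_mult_mat[OF c(4) c(3) mult_carrier_mat[OF c(2) c(4)]])
    also have "\<dots> = B * (Q * P)"
      by (simp add: w(2) assoc_mult_mat[OF c(2) c(4) c(3)]
          left_mult_one_mat[OF mult_carrier_mat[OF c(2) c(4)]])
    finally show ?thesis by (simp add: w(2) right_mult_one_mat[OF c(2)])
  qed
  have PQ: "(\<Sum>l<n. P $$ (i, l) * Q $$ (l, j)) = (if i = j then 1 else 0)" if "i < n" "j < n" for i j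
  proof -
    have "(P * Q) $$ (i, j) = (\<Sum>l<n. P $$ (i, l) * Q $$ (l, j))"
      using w(6,7) that by (simp add: scalar_prod_def atLeast0LessThan)
    then show ?thesis using w(1) that by simp
  qed
  have T_eq: "T i j = (\<Sum>m<n. \<Sum>m'<n. Q $$ (i, m) * P $$ (m', j) * ?g m m')" if "i < n" "j < n" for i j
  proof -
    have "T i j = (Q * G * P) $$ (i, j)" by (simp add: T_def BQ)
    also have "\<dots> = (\<Sum>m'<n. (\<Sum>m<n. Q $$ (i, m) * ?g m m') * P $$ (m', j))"
      using w(6,7) that by (simp add: scalar_prod_def atLeast0LessThan G_def)
    also have "\<dots> = (\<Sum>m<n. \<Sum>m'<n. Q $$ (i, m) * P $$ (m', j) * ?g m m')"
      by (subst sum.swap) (simp add: sum_distrib_left sum_distrib_right mult_ac)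
    finally show ?thesis .
  qed
  have gr: "has_bochner_integral \<nu> (\<lambda>z. \<eta> i z * \<psi> j z) (T i j)" if "i < n" "j < n" for i j
  proof -
    have "(\<lambda>z. \<eta> i z * \<psi> j z) = (\<lambda>z. \<Sum>m<n. \<Sum>m'<n. Q $$ (i, m) * P $$ (m', j) * (cnj (\<phi> m z) * \<phi> m' z))"
      unfolding \<eta>_def \<psi>_def sum_product by (simp add: mult_ac)
    then show ?thesis unfolding T_eq[OF that]
      by (simp only:) (intro has_bochner_integral_sum has_bochner_integral_mult_right
          has_bochner_integral_integrable int; simp)
  qed
  have "K z w = (\<Sum>l<n. \<psi> l z * \<eta> l w)" for z w
  proof -
    have "(\<Sum>l<n. \<psi> l z * \<eta> l w) = (\<Sum>l<n. \<Sum>m<n. \<Sum>m'<n. \<phi> m z * cnj (\<phi> m' w) * (P $$ (m, l) * Q $$ (l, m')))"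
      by (simp add: \<eta>_def \<psi>_def sum_product mult_ac)
    also have "\<dots> = (\<Sum>m<n. \<Sum>m'<n. \<Sum>l<n. \<phi> m z * cnj (\<phi> m' w) * (P $$ (m, l) * Q $$ (l, m')))"
      by (subst sum.swap) (intro sum.cong refl sum.swap)
    also have "\<dots> = (\<Sum>m<n. \<Sum>m'<n. if m = m' then \<phi> m z * cnj (\<phi> m' w) else 0)"
      by (intro sum.cong refl) (simp add: sum_distrib_left[symmetric] PQ)
    finally show ?thesis by (simp add: K)
  qed
  then interpret finite_rank_kernel \<nu> n \<psi> \<eta> T K
    by unfold_locales (use gr in \<open>auto simp: has_bochner_integral_iff\<close>)
  show ?thesis
  proof (rule that[of x])
    show "kernel_trace \<nu> K k = of_real (\<Sum>j<n. x j ^ Suc k)" for k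
      by (subst kernel_trace_triangular[OF T0]) (auto simp: x)
    show "minor_integral \<nu> K k = of_real (fact k * elem_sym n x k)" for k
      by (rule minor_integral_triangular[OF sf T0 x(2)])
  qed (use x in auto)
qed


section \<open>Kernels that are bounded limits of finite-rank kernels\<close>

lemma borel_measurable_cnj' [measurable]:
  "f \<in> borel_measurable M \<Longrightarrow> (\<lambda>x. cnj (f x)) \<in> borel_measurable M"
  by (rule measurable_compose[of f]) (auto intro!: borel_measurable_continuous_onI continuous_intros)

text \<open>
  On the diagonal the expansion has nonnegative terms with sum at most \<open>C\<close>, so all its truncations are
  bounded by \<open>C\<close> at all pairs of points. Together with the finite measure of \<open>D\<close> this dominates every
  integrand below, and limits of truncations can be taken under the integral sign.
\<close>

locale mercer_kernel = sigma_finite_measure \<nu> for \<nu> :: "'b measure" +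
  fixes D :: "'b set" and C :: real and \<phi> :: "nat \<Rightarrow> 'b \<Rightarrow> complex" and K :: "'b \<Rightarrow> 'b \<Rightarrow> complex"
  assumes D: "D \<in> sets \<nu>" "emeasure \<nu> D \<noteq> \<infinity>"
    and \<phi> [measurable]: "\<phi> m \<in> borel_measurable \<nu>"
    and \<phi>_outside: "z \<notin> D \<Longrightarrow> \<phi> m z = 0"
    and expansion: "(\<lambda>m. \<phi> m z * cnj (\<phi> m w)) sums K z w"
    and diagonal: "cmod (K z z) \<le> C"
begin

definition trunc :: "nat \<Rightarrow> 'b \<Rightarrow> 'b \<Rightarrow> complex" where
  "trunc n z w = (\<Sum>m<n. \<phi> m z * cnj (\<phi> m w))"

abbreviation ind :: "'b \<Rightarrow> real" where "ind \<equiv> indicator D"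

lemma D_meas [measurable]: "D \<in> sets \<nu>" by (rule D)

lemma C_nonneg: "0 \<le> C"
  using diagonal[of undefined] norm_ge_zero order_trans by blast

lemma sum_norm_\<phi>: "(\<Sum>m<n. (cmod (\<phi> m z))\<^sup>2) \<le> C * ind z"
proof (cases "z \<in> D")
  case True
  have "(\<lambda>m. (cmod (\<phi> m z))\<^sup>2) sums Re (K z z)"
    using sums_Re[OF expansion[of z z]] by (simp add: complex_norm_square[symmetric] del: of_real_power)
  then have "(\<Sum>m<n. (cmod (\<phi> m z))\<^sup>2) \<le> Re (K z z)"
    by (intro sum_le_suminf[of _ "{..<n}", THEN order_trans]) (auto simp: sums_iff)
  also have "\<dots> \<le> C" using diagonal[of z] complex_Re_le_cmod order_trans by blast
  finally show ?thesis using True by simp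
qed (simp add: \<phi>_outside)

text \<open>
  The terms are bounded by \<open>2 |x y| \<le> |x|\<^sup>2 + |y|\<^sup>2\<close> and the sums on the diagonal.
\<close>

lemma trunc_bound: "cmod (trunc n z w) \<le> C * (ind z * ind w)"
proof (cases "z \<in> D \<and> w \<in> D")
  case True
  have "cmod (trunc n z w) \<le> (\<Sum>m<n. cmod (\<phi> m z) * cmod (\<phi> m w))"
    unfolding trunc_def by (rule order_trans[OF norm_sum]) (simp add: norm_mult)
  also have "\<dots> \<le> (\<Sum>m<n. ((cmod (\<phi> m z))\<^sup>2 + (cmod (\<phi> m w))\<^sup>2) / 2)"
  proof (rule sum_mono)
    fix m show "cmod (\<phi> m z) * cmod (\<phi> m w) \<le> ((cmod (\<phi> m z))\<^sup>2 + (cmod (\<phi> m w))\<^sup>2) / 2"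
      using sum_squares_bound[of "cmod (\<phi> m z)" "cmod (\<phi> m w)"] by simp
  qed
  also have "\<dots> = ((\<Sum>m<n. (cmod (\<phi> m z))\<^sup>2) + (\<Sum>m<n. (cmod (\<phi> m w))\<^sup>2)) / 2"
    by (simp add: sum.distrib sum_divide_distrib[symmetric])
  also have "\<dots> \<le> C" using sum_norm_\<phi>[of z n] sum_norm_\<phi>[of w n] True by simp
  finally show ?thesis using True by simp
qed (auto simp: trunc_def \<phi>_outside)

lemma trunc_lim: "(\<lambda>n. trunc n z w) \<longlonglongrightarrow> K z w"
  using expansion[of z w] by (simp add: sums_def trunc_def)

lemma kernel_bound: "cmod (K z w) \<le> C * (ind z * ind w)"
  by (rule Lim_bounded[OF tendsto_norm[OF trunc_lim]]) (use trunc_bound in auto)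

lemma ind_integrable: "integrable \<nu> ind"
  using D by (simp add: less_top[symmetric])

lemma gram_integrable: "integrable \<nu> (\<lambda>x. cnj (\<phi> i x) * \<phi> j x)"
proof (rule Bochner_Integration.integrable_bound)
  show "integrable \<nu> (\<lambda>x. C * ind x)" using ind_integrable by simp
  have "cmod (\<phi> i x) * cmod (\<phi> j x) \<le> C * ind x" for x
  proof -
    have b: "(cmod (\<phi> l x))\<^sup>2 \<le> C * ind x" for l
      using sum_norm_\<phi>[of x "Suc l"] sum_nonneg[of "{..<l}" "\<lambda>m. (cmod (\<phi> m x))\<^sup>2"] by simp
    have "cmod (\<phi> i x) * cmod (\<phi> j x) \<le> ((cmod (\<phi> i x))\<^sup>2 + (cmod (\<phi> j x))\<^sup>2) / 2"
      using sum_squares_bound[of "cmod (\<phi> i x)" "cmod (\<phi> j x)"] by simp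
    then show ?thesis using b[of i] b[of j] by simp
  qed
  then show "AE x in \<nu>. norm (cnj (\<phi> i x) * \<phi> j x) \<le> norm (C * ind x)"
    using C_nonneg by (simp add: norm_mult)
qed simp

lemma trunc_finite_rank:
  "finite_rank_kernel \<nu> n \<phi> (\<lambda>m w. cnj (\<phi> m w)) (\<lambda>i j. \<integral>x. cnj (\<phi> i x) * \<phi> j x \<partial>\<nu>) (trunc n)"
  by unfold_locales (auto simp: gram_integrable trunc_def)

lemma iter_trunc_measurable2:
  "(\<lambda>p. iter_kernel \<nu> (trunc n) k (fst p) (snd p)) \<in> borel_measurable (\<nu> \<Otimes>\<^sub>M \<nu>)"
  unfolding finite_rank_kernel.iter_kernel_eq[OF trunc_finite_rank] by measurable

abbreviation mass :: real where "mass \<equiv> measure \<nu> D"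

lemma iter_bound_step:
  assumes f: "\<And>v. cmod (f v) \<le> A * ind v" and g: "\<And>v. cmod (g v) \<le> C * (ind v * ind w)"
    and A: "0 \<le> A"
  shows "cmod (f v * g v) \<le> A * C * ind w * ind v"
    and "cmod (\<integral>v. f v * g v \<partial>\<nu>) \<le> A * (C * mass) * ind w"
proof -
  show *: "cmod (f v * g v) \<le> A * C * ind w * ind v" for v
  proof (cases "v \<in> D")
    case True
    then have "norm (f v * g v) \<le> A * (C * ind w)"
      unfolding norm_mult using f[of v] g[of v] A by (intro mult_mono) auto
    then show ?thesis using True by simp
  qed (use f[of v] in simp)
  show "cmod (\<integral>v. f v * g v \<partial>\<nu>) \<le> A * (C * mass) * ind w"
  proof -
    have "cmod (\<integral>v. f v * g v \<partial>\<nu>) \<le> (\<integral>v. A * C * ind w * ind v \<partial>\<nu>)"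
      by (rule order_trans[OF integral_norm_bound integral_mono'])
         (use * ind_integrable A C_nonneg in auto)
    then show ?thesis using sets.sets_into_space[OF D_meas] by (simp add: mult_ac Int_absorb2)
  qed
qed

lemma iter_bound:
  assumes "\<And>z w. cmod (L z w) \<le> C * (ind z * ind w)"
  shows "cmod (iter_kernel \<nu> L k z w) \<le> C * (C * mass) ^ k * ind z * ind w"
proof (induction k arbitrary: w)
  case 0
  then show ?case using assms[of z w] by (simp add: mult.assoc)
next
  case (Suc k)
  have "cmod (\<integral>v. iter_kernel \<nu> L k z v * L v w \<partial>\<nu>) \<le> (C * (C * mass) ^ k * ind z) * (C * mass) * ind w"
    by (rule iter_bound_step(2)) (use Suc assms C_nonneg in auto)
  then show ?case by (simp add: mult_ac)
qed

lemma iter_trunc_bound: "cmod (iter_kernel \<nu> (trunc n) k z w) \<le> C * (C * mass) ^ k * ind z * ind w"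
  by (rule iter_bound[OF trunc_bound])

lemmas iter_kernel_bound = iter_bound[OF kernel_bound]

lemma iter_trunc_measurable:
  "(\<lambda>w. iter_kernel \<nu> (trunc n) k z w) \<in> borel_measurable \<nu>"
  "(\<lambda>z. iter_kernel \<nu> (trunc n) k z w) \<in> borel_measurable \<nu>"
  "(\<lambda>z. iter_kernel \<nu> (trunc n) k z z) \<in> borel_measurable \<nu>"
  unfolding finite_rank_kernel.iter_kernel_eq[OF trunc_finite_rank] by measurable

lemma trunc_measurable:
  "(\<lambda>w. trunc n z w) \<in> borel_measurable \<nu>" "(\<lambda>z. trunc n z w) \<in> borel_measurable \<nu>"
  unfolding trunc_def by measurable

lemma kernel_measurable:
  "(\<lambda>w. K z w) \<in> borel_measurable \<nu>" "(\<lambda>z. K z w) \<in> borel_measurable \<nu>"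
  by (rule borel_measurable_LIMSEQ_metric[OF _ trunc_lim], rule trunc_measurable)+

lemma iter_trunc_lim: "(\<lambda>n. iter_kernel \<nu> (trunc n) k z w) \<longlonglongrightarrow> iter_kernel \<nu> K k z w"
proof (induction k arbitrary: w)
  case 0
  then show ?case by (simp add: trunc_lim)
next
  case (Suc k)
  have meas: "(\<lambda>v. iter_kernel \<nu> K k z v) \<in> borel_measurable \<nu>"
    by (rule borel_measurable_LIMSEQ_metric[OF _ Suc], rule iter_trunc_measurable)
  show ?case unfolding iter_kernel.simps
  proof (rule integral_dominated_convergence)
    show "integrable \<nu> (\<lambda>v. C * (C * mass) ^ k * ind z * C * ind w * ind v)"
      using ind_integrable by simp
    show "AE v in \<nu>. norm (iter_kernel \<nu> (trunc n) k z v * trunc n v w)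
        \<le> C * (C * mass) ^ k * ind z * C * ind w * ind v" for n
      by (intro AE_I2 iter_bound_step iter_trunc_bound trunc_bound) (use C_nonneg in simp)
  qed (use Suc trunc_lim meas kernel_measurable iter_trunc_measurable trunc_measurable in
      \<open>auto intro!: tendsto_mult borel_measurable_times\<close>)
qed

lemma iter_kernel_measurable2:
  "(\<lambda>p. iter_kernel \<nu> K k (fst p) (snd p)) \<in> borel_measurable (\<nu> \<Otimes>\<^sub>M \<nu>)"
  by (rule borel_measurable_LIMSEQ_metric[OF _ iter_trunc_lim], rule iter_trunc_measurable2)

lemma iter_kernel_measurable:
  "(\<lambda>w. iter_kernel \<nu> K k z w) \<in> borel_measurable \<nu>"
  "(\<lambda>z. iter_kernel \<nu> K k z w) \<in> borel_measurable \<nu>"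
  "(\<lambda>z. iter_kernel \<nu> K k z z) \<in> borel_measurable \<nu>"
  by (rule borel_measurable_LIMSEQ_metric[OF _ iter_trunc_lim], rule iter_trunc_measurable)+

lemma kernel_trace_lim: "(\<lambda>n. kernel_trace \<nu> (trunc n) k) \<longlonglongrightarrow> kernel_trace \<nu> K k"
  unfolding kernel_trace_def
proof (rule integral_dominated_convergence)
  show "integrable \<nu> (\<lambda>z. C * (C * mass) ^ k * ind z)"
    using ind_integrable by simp
  show "AE z in \<nu>. norm (iter_kernel \<nu> (trunc n) k z z) \<le> C * (C * mass) ^ k * ind z" for n
  proof (rule AE_I2)
    fix z
    show "norm (iter_kernel \<nu> (trunc n) k z z) \<le> C * (C * mass) ^ k * ind z"
      using iter_trunc_bound[of n k z z] by (cases "z \<in> D") auto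
  qed
qed (use iter_trunc_lim iter_kernel_measurable iter_trunc_measurable in auto)

lemma
  shows minor_integrable: "integrable (Pi\<^sub>M {..<k} (\<lambda>_. \<nu>)) (\<lambda>z. Determinant.det (Matrix.mat k k (\<lambda>(i, j). K (z i) (z j))))"
    and minor_integral_lim: "(\<lambda>n. minor_integral \<nu> (trunc n) k) \<longlonglongrightarrow> minor_integral \<nu> K k"
proof -
  interpret product_sigma_finite "\<lambda>_ :: nat. \<nu>" by standard
  let ?M = "Pi\<^sub>M {..<k} (\<lambda>_. \<nu>)" and ?P = "{p. p permutes {0..<k}}"
  have \<phi>m: "(\<lambda>z. \<phi> m (z i)) \<in> borel_measurable ?M" if "i < k" for i m
    using measurable_compose[OF measurable_component_singleton[of i "{..<k}" "\<lambda>_. \<nu>"] \<phi>[of m]] that by simp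
  have tm: "(\<lambda>z. trunc n (z i) (z j)) \<in> borel_measurable ?M" if "i < k" "j < k" for i j n
    unfolding trunc_def using that
    by (intro borel_measurable_sum borel_measurable_times borel_measurable_cnj' \<phi>m)
  have km: "(\<lambda>z. K (z i) (z j)) \<in> borel_measurable ?M" if "i < k" "j < k" for i j
    by (rule borel_measurable_LIMSEQ_metric[OF _ trunc_lim], rule tm[OF that])
  have pk: "p i < k" if "p \<in> ?P" "i < k" for p i
    using that permutes_in_image[of p "{0..<k}" i] by auto
  have dom: "integrable ?M (\<lambda>z. fact k * C ^ k * (\<Prod>i<k. ind (z i)))"
    by (intro integrable_mult_right product_integrable_prod ind_integrable) auto
  have bnd: "AE z in ?M. norm (\<Sum>p\<in>?P. signof p * (\<Prod>i<k. trunc n (z i) (z (p i))))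
        \<le> fact k * C ^ k * (\<Prod>i<k. ind (z i))" for n
    proof (rule AE_I2)
      fix z :: "nat \<Rightarrow> 'b"
      have "norm (\<Sum>p\<in>?P. signof p * (\<Prod>i<k. trunc n (z i) (z (p i))))
          \<le> (\<Sum>p\<in>?P. C ^ k * (\<Prod>i<k. ind (z i)))"
      proof (rule order_trans[OF norm_sum sum_mono])
        fix p assume p: "p \<in> ?P"
        have "norm (complex_of_int (sign p) * (\<Prod>i<k. trunc n (z i) (z (p i))))
            = (\<Prod>i<k. cmod (trunc n (z i) (z (p i))))"
          by (simp add: norm_mult sign_def prod_norm)
        also have "\<dots> \<le> (\<Prod>i<k. C * ind (z i))"
        proof (rule prod_mono, intro conjI)
          fix i
          show "cmod (trunc n (z i) (z (p i))) \<le> C * ind (z i)"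
            using trunc_bound[of n "z i" "z (p i)"] C_nonneg
            by (cases "z i \<in> D"; cases "z (p i) \<in> D") auto
        qed simp
        finally show "norm (complex_of_int (sign p) * (\<Prod>i<k. trunc n (z i) (z (p i))))
            \<le> C ^ k * (\<Prod>i<k. ind (z i))" by (simp add: prod.distrib)
      qed
      also have "\<dots> = fact k * C ^ k * (\<Prod>i<k. ind (z i))"
        using card_permutations[of "{0..<k}" k] by simp
      finally show "norm (\<Sum>p\<in>?P. signof p * (\<Prod>i<k. trunc n (z i) (z (p i))))
        \<le> fact k * C ^ k * (\<Prod>i<k. ind (z i))" .
    qed
  have meas: "(\<lambda>z. \<Sum>p\<in>?P. signof p * (\<Prod>i<k. K (z i) (z (p i)))) \<in> borel_measurable ?M"
    "(\<lambda>z. \<Sum>p\<in>?P. signof p * (\<Prod>i<k. trunc n (z i) (z (p i)))) \<in> borel_measurable ?M" for n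
    by (use pk in \<open>auto intro!: borel_measurable_sum borel_measurable_times borel_measurable_prod tm km\<close>)
  have lim: "AE z in ?M. (\<lambda>n. \<Sum>p\<in>?P. signof p * (\<Prod>i<k. trunc n (z i) (z (p i))))
      \<longlonglongrightarrow> (\<Sum>p\<in>?P. signof p * (\<Prod>i<k. K (z i) (z (p i))))"
    by (auto intro!: tendsto_sum tendsto_mult tendsto_prod trunc_lim)
  show "integrable ?M (\<lambda>z. Determinant.det (Matrix.mat k k (\<lambda>(i, j). K (z i) (z j))))"
    unfolding det_permutation_sum by (rule integrable_dominated_convergence[OF meas dom lim bnd])
  show "(\<lambda>n. minor_integral \<nu> (trunc n) k) \<longlonglongrightarrow> minor_integral \<nu> K k"
    unfolding minor_integral_def det_permutation_sum
    by (rule integral_dominated_convergence[OF meas dom lim bnd])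
qed

text \<open>
  The eigenvalues \<open>x n j\<close> are those of the truncations. They need not converge individually; only their
  power sums and elementary symmetric polynomials do.
\<close>

theorem approximate_spectrum:
  obtains x :: "nat \<Rightarrow> nat \<Rightarrow> real" where "\<And>n j. j < n \<Longrightarrow> 0 \<le> x n j"
    "\<And>k. (\<lambda>n. \<Sum>j<n. x n j ^ Suc k) \<longlonglongrightarrow> Re (kernel_trace \<nu> K k)"
    "\<And>k. (\<lambda>n. fact k * elem_sym n (x n) k) \<longlonglongrightarrow> Re (minor_integral \<nu> K k)"
proof -
  have "\<exists>x. (\<forall>j<n. 0 \<le> x j) \<and> (\<forall>k. kernel_trace \<nu> (trunc n) k = of_real (\<Sum>j<n. x j ^ Suc k)) \<and>
      (\<forall>k. minor_integral \<nu> (trunc n) k = of_real (fact k * elem_sym n x k))" for n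
    by (rule hermitian_kernel_spectrum[of \<nu> n \<phi> "trunc n"])
       (use gram_integrable sigma_finite_measure_axioms in \<open>auto simp: trunc_def\<close>)
  then obtain x where x: "\<And>n j. j < n \<Longrightarrow> 0 \<le> x n j"
    "\<And>n k. kernel_trace \<nu> (trunc n) k = of_real (\<Sum>j<n. x n j ^ Suc k)"
    "\<And>n k. minor_integral \<nu> (trunc n) k = of_real (fact k * elem_sym n (x n) k)"
    by metis
  show ?thesis
  proof (rule that[of x])
    show "(\<lambda>n. \<Sum>j<n. x n j ^ Suc k) \<longlonglongrightarrow> Re (kernel_trace \<nu> K k)" for k
      using tendsto_Re[OF kernel_trace_lim[of k]] by (simp only: x Re_complex_of_real)
    show "(\<lambda>n. fact k * elem_sym n (x n) k) \<longlonglongrightarrow> Re (minor_integral \<nu> K k)" for k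
      using tendsto_Re[OF minor_integral_lim[of k]] by (simp only: x Re_complex_of_real)
  qed (rule x)
qed

lemma minor_integral_bounds:
  "0 \<le> Re (minor_integral \<nu> K k)" "Re (minor_integral \<nu> K k) \<le> Re (kernel_trace \<nu> K 0) ^ k"
proof -
  obtain x where x: "\<And>n j. j < n \<Longrightarrow> 0 \<le> x n j"
    "\<And>k. (\<lambda>n. \<Sum>j<n. x n j ^ Suc k) \<longlonglongrightarrow> Re (kernel_trace \<nu> K k)"
    "\<And>k. (\<lambda>n. fact k * elem_sym n (x n) k) \<longlonglongrightarrow> Re (minor_integral \<nu> K k)"
    by (rule approximate_spectrum) blast
  show "0 \<le> Re (minor_integral \<nu> K k)"
  proof (rule LIMSEQ_le_const[OF x(3)])
    have "0 \<le> fact k * elem_sym n (x n) k" for n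
      by (intro mult_nonneg_nonneg elem_sym_nonneg x(1)) auto
    then show "\<exists>N. \<forall>n\<ge>N. 0 \<le> fact k * elem_sym n (x n) k" by blast
  qed
  have "(\<lambda>n. (\<Sum>j<n. x n j) ^ k) \<longlonglongrightarrow> Re (kernel_trace \<nu> K 0) ^ k"
    using tendsto_power[OF x(2)[of 0]] by simp
  then show "Re (minor_integral \<nu> K k) \<le> Re (kernel_trace \<nu> K 0) ^ k"
  proof (rule LIMSEQ_le[OF x(3)])
    have "fact k * elem_sym n (x n) k \<le> (\<Sum>j<n. x n j) ^ k" for n
      by (intro elem_sym_le x(1))
    then show "\<exists>N. \<forall>n\<ge>N. fact k * elem_sym n (x n) k \<le> (\<Sum>j<n. x n j) ^ k" by blast
  qed
qed

end


section \<open>The logarithm of the generating function\<close>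

text \<open>
  The power sums bound the coefficients by \<open>\<tau>\<^sup>k / k!\<close> uniformly in \<open>n\<close>, so coefficientwise convergence
  implies convergence of the series (Tannery's theorem).
\<close>

lemma elem_sym_series_uniform:
  fixes x :: "nat \<Rightarrow> nat \<Rightarrow> real"
  assumes x: "\<And>n j. j < n \<Longrightarrow> 0 \<le> x n j"
    and conv: "(\<lambda>n. \<Sum>j<n. x n j) \<longlonglongrightarrow> T"
    and e: "\<And>k. (\<lambda>n. elem_sym n (x n) k) \<longlonglongrightarrow> e k"
    and r: "0 \<le> r"
    and D: "\<And>v. v \<in> V \<Longrightarrow> (\<lambda>k. e k * v ^ k) sums D v" and V: "\<And>v. v \<in> V \<Longrightarrow> \<bar>v\<bar> \<le> r"
  shows "uniform_limit V (\<lambda>n v. \<Prod>j<n. 1 + v * x n j) D sequentially"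
proof -
  obtain \<tau> where \<tau>: "\<And>n. (\<Sum>j<n. x n j) \<le> \<tau>"
    using convergent_imp_Bseq[of "\<lambda>n. \<Sum>j<n. x n j"] conv unfolding Bseq_def convergent_def
    by (metis abs_le_D1 real_norm_def)
  have es_le: "elem_sym n (x n) k \<le> \<tau> ^ k / fact k" for n k
  proof -
    have "fact k * elem_sym n (x n) k \<le> (\<Sum>j<n. x n j) ^ k" using elem_sym_le[of n "x n" k] x by simp
    also have "\<dots> \<le> \<tau> ^ k" by (intro power_mono \<tau> sum_nonneg x) auto
    finally show ?thesis by (simp add: field_simps)
  qed
  have es_nn: "0 \<le> elem_sym n (x n) k" for n k by (intro elem_sym_nonneg x)
  have e_bd: "0 \<le> e k" "e k \<le> \<tau> ^ k / fact k" for k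
    by (rule LIMSEQ_le_const[OF e], use es_nn in blast, rule LIMSEQ_le_const2[OF e], use es_le in blast)
  let ?a = "\<lambda>k n. \<bar>elem_sym n (x n) k - e k\<bar> * r ^ k"
  let ?M = "\<lambda>k. (\<tau> * r) ^ k /\<^sub>R fact k"
  have bd: "norm (?a k n) \<le> ?M k" for k n
  proof -
    have "\<bar>elem_sym n (x n) k - e k\<bar> \<le> \<tau> ^ k / fact k"
      using es_le[of n k] es_nn[of n k] e_bd[of k] by (auto simp: abs_le_iff)
    then have "\<bar>elem_sym n (x n) k - e k\<bar> * r ^ k \<le> (\<tau> ^ k / fact k) * r ^ k"
      using r by (intro mult_right_mono) auto
    then show ?thesis using r by (simp add: power_mult_distrib abs_mult divide_inverse mult_ac)
  qed
  have lim: "(?a k \<longlongrightarrow> 0) sequentially" for k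
    using tendsto_mult_right[OF tendsto_rabs[OF tendsto_diff[OF e[of k] tendsto_const[of "e k"]]], of "r ^ k"] by simp
  have sM: "summable ?M" by (rule summable_exp_generic)
  have "((\<lambda>n. suminf (\<lambda>k. ?a k n)) \<longlongrightarrow> suminf (\<lambda>k. 0 :: real)) sequentially"
    by (rule tannerys_theorem[where M = ?M, THEN conjunct2, THEN conjunct2])
       (use lim bd sM in \<open>auto intro!: always_eventually\<close>)
  then have a0: "(\<lambda>n. \<Sum>k. ?a k n) \<longlonglongrightarrow> 0" by simp
  have sa: "summable (\<lambda>k. ?a k n)" for n
    by (rule summable_comparison_test'[OF sM]) (use bd in auto)
  have diff: "\<bar>(\<Prod>j<n. 1 + v * x n j) - D v\<bar> \<le> (\<Sum>k. ?a k n)" if v: "v \<in> V" for n v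
  proof -
    have s: "(\<lambda>k. (elem_sym n (x n) k - e k) * v ^ k) sums ((\<Prod>j<n. 1 + v * x n j) - D v)"
      using sums_diff[OF prod_one_plus_elem_sym[of n "x n" v] D[OF v]] by (simp add: left_diff_distrib)
    have c: "norm ((elem_sym n (x n) k - e k) * v ^ k) \<le> ?a k n" for k
      using V[OF v] by (simp add: abs_mult power_abs mult_left_mono power_mono)
    show ?thesis using norm_suminf_le[OF c sa] s by (simp add: sums_iff)
  qed
  show ?thesis unfolding uniform_limit_iff
  proof (intro allI impI)
    fix \<epsilon> :: real assume "\<epsilon> > 0"
    then have "\<forall>\<^sub>F n in sequentially. (\<Sum>k. ?a k n) < \<epsilon>" using a0 order_tendstoD(2) by blast
    then show "\<forall>\<^sub>F n in sequentially. \<forall>v\<in>V. dist (\<Prod>j<n. 1 + v * x n j) (D v) < \<epsilon>"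
    proof eventually_elim
      case (elim n)
      show ?case unfolding dist_real_def using le_less_trans[OF diff elim] by blast
    qed
  qed
qed

text \<open>
  An eigenvalue \<open>y > b\<close> would make the product vanish at \<open>-1/y\<close>, which lies in \<open>[-1/b, 0]\<close>. There the products
  converge uniformly to \<open>D\<close>, and \<open>D\<close> is bounded below by \<open>D (-1/b) > 0\<close>. Hence eventually all
  eigenvalues lie in \<open>[0, b]\<close>, where the polynomial approximation applies to each factor.
  Positivity of \<open>D\<close> thus takes the place of the operator bound \<open>K \<le> 1\<close>.
\<close>

lemma ln_generating_function_approx:
  fixes x :: "nat \<Rightarrow> nat \<Rightarrow> real"
  assumes x: "\<And>n j. j < n \<Longrightarrow> 0 \<le> x n j"
    and T: "\<And>k. (\<lambda>n. \<Sum>j<n. x n j ^ Suc k) \<longlonglongrightarrow> T k"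
    and e: "\<And>k. (\<lambda>n. elem_sym n (x n) k) \<longlonglongrightarrow> e k"
    and D: "\<And>v. v > -1 \<Longrightarrow> (\<lambda>k. e k * v ^ k) sums D v"
    and pos: "\<And>v. v > -1 \<Longrightarrow> D v > 0" and mono: "\<And>v w. -1 < v \<Longrightarrow> v \<le> w \<Longrightarrow> D v \<le> D w"
    and b: "b > 1" and ub: "1 + u * b > 0" and u: "u > -1"
    and p: "\<And>y. 0 \<le> y \<Longrightarrow> y \<le> b \<Longrightarrow> \<bar>ln (1 + u * y) - (\<Sum>i\<le>N. c i * y ^ Suc i)\<bar> \<le> \<delta> * y"
  shows "\<bar>ln (D u) - (\<Sum>i\<le>N. c i * T i)\<bar> \<le> \<delta> * T 0"
proof -
  have T0: "(\<lambda>n. \<Sum>j<n. x n j) \<longlonglongrightarrow> T 0" using T[of 0] by simp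
  have b1: "-1 < -1/b" using b by (simp add: field_simps)
  have "uniform_limit {-1/b..0} (\<lambda>n v. \<Prod>j<n. 1 + v * x n j) D sequentially"
    by (rule elem_sym_series_uniform[OF x T0 e, of 1]) (use b1 in \<open>auto intro!: D\<close>)
  moreover have m: "D (-1/b) > 0" by (rule pos[OF b1])
  ultimately have "\<forall>\<^sub>F n in sequentially. \<forall>v\<in>{-1/b..0}. dist (\<Prod>j<n. 1 + v * x n j) (D v) < D (-1/b)"
    by (rule uniform_limitD)
  then have ev: "\<forall>\<^sub>F n in sequentially. \<forall>j<n. x n j \<le> b"
  proof eventually_elim
    case (elim n)
    show ?case
    proof (intro allI impI, rule ccontr)
      fix j assume j: "j < n" "\<not> x n j \<le> b"
      define v where "v = - 1 / x n j"
      have "x n j > b" "x n j > 0" using j b by auto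
      then have v: "v \<in> {-1/b..0}" "1 + v * x n j = 0" using b by (auto simp: v_def field_simps)
      have "(\<Prod>j<n. 1 + v * x n j) = 0" using v(2) j(1) by (intro prod_zero) auto
      moreover have "D (-1/b) \<le> D v" using v(1) b1 by (intro mono) auto
      moreover have "dist (\<Prod>j<n. 1 + v * x n j) (D v) < D (-1/b)" using elim v(1) by blast
      ultimately show False using m by (simp only: dist_real_def)
    qed
  qed
  have fac: "1 + u * y > 0" if "0 \<le> y" "y \<le> b" for y
  proof (cases "u \<ge> 0")
    case False
    then have "u * b \<le> u * y" using that by (intro mult_left_mono_neg) auto
    then show ?thesis using ub by simp
  qed (use that in \<open>simp add: add_pos_nonneg\<close>)
  have "uniform_limit {u} (\<lambda>n v. \<Prod>j<n. 1 + v * x n j) D sequentially"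
    by (rule elem_sym_series_uniform[OF x T0 e, of "\<bar>u\<bar>"]) (use u D in auto)
  then have "(\<lambda>n. \<Prod>j<n. 1 + u * x n j) \<longlonglongrightarrow> D u" by (rule tendsto_uniform_limitI) simp
  then have "(\<lambda>n. ln (\<Prod>j<n. 1 + u * x n j)) \<longlonglongrightarrow> ln (D u)"
    using pos[OF u] by (intro tendsto_ln) auto
  then have L: "(\<lambda>n. \<bar>ln (\<Prod>j<n. 1 + u * x n j) - (\<Sum>i\<le>N. c i * (\<Sum>j<n. x n j ^ Suc i))\<bar>)
      \<longlonglongrightarrow> \<bar>ln (D u) - (\<Sum>i\<le>N. c i * T i)\<bar>"
    by (intro tendsto_rabs tendsto_diff tendsto_sum tendsto_mult tendsto_const T)
  have R: "(\<lambda>n. \<delta> * (\<Sum>j<n. x n j)) \<longlonglongrightarrow> \<delta> * T 0" by (intro tendsto_intros T0)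
  have "\<forall>\<^sub>F n in sequentially. \<bar>ln (\<Prod>j<n. 1 + u * x n j) - (\<Sum>i\<le>N. c i * (\<Sum>j<n. x n j ^ Suc i))\<bar>
      \<le> \<delta> * (\<Sum>j<n. x n j)"
    using ev
  proof eventually_elim
    case (elim n)
    have "ln (\<Prod>j<n. 1 + u * x n j) = (\<Sum>j<n. ln (1 + u * x n j))"
      using elim x fac by (subst ln_prod) (auto simp: less_imp_neq[symmetric])
    moreover have "(\<Sum>i\<le>N. c i * (\<Sum>j<n. x n j ^ Suc i)) = (\<Sum>j<n. \<Sum>i\<le>N. c i * x n j ^ Suc i)"
      by (simp only: sum_distrib_left) (rule sum.swap)
    ultimately have "\<bar>ln (\<Prod>j<n. 1 + u * x n j) - (\<Sum>i\<le>N. c i * (\<Sum>j<n. x n j ^ Suc i))\<bar>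
        = \<bar>\<Sum>j<n. ln (1 + u * x n j) - (\<Sum>i\<le>N. c i * x n j ^ Suc i)\<bar>"
      by (simp only: sum_subtractf)
    also have "\<dots> \<le> (\<Sum>j<n. \<delta> * x n j)"
      by (rule order_trans[OF sum_abs sum_mono]) (use p x elim in auto)
    finally show ?case by (simp only: sum_distrib_left)
  qed
  then show ?thesis by (rule tendsto_le[OF _ R L, rotated]) simp
qed

text \<open>
  The Weierstrass theorem is applied to \<open>ln (1 + u y) / y\<close>. The factor \<open>y\<close> in the error makes its sum over
  all eigenvalues at most \<open>\<delta>\<close> times the trace.
\<close>

lemma log_polynomial_approx:
  fixes u b \<delta> :: real
  assumes "0 < b" "1 + u * b > 0" "\<delta> > 0"
  obtains N c where "\<And>y. 0 \<le> y \<Longrightarrow> y \<le> b \<Longrightarrow> \<bar>ln (1 + u * y) - (\<Sum>i\<le>N. c i * y ^ Suc i)\<bar> \<le> \<delta> * y"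
proof -
  have fac: "1 + u * y > 0" if "0 \<le> y" "y \<le> b" for y
  proof (cases "u \<ge> 0")
    case False
    then have "u * b \<le> u * y" using that by (intro mult_left_mono_neg) auto
    then show ?thesis using assms(2) by simp
  qed (use that in \<open>simp add: add_pos_nonneg\<close>)
  \<comment> \<open>the value at \<open>0\<close> is the derivative of \<open>ln (1 + u y)\<close> there, which makes \<open>g\<close> continuous\<close>
  define g where "g y = (if y = 0 then u else ln (1 + u * y) / y)" for y
  have "continuous_on {0..b} g"
  proof (rule continuous_at_imp_continuous_on, intro ballI)
    fix y assume y: "y \<in> {0..b}"
    show "isCont g y"
    proof (cases "y = 0")
      case True
      have "((\<lambda>y. ln (1 + u * y)) has_real_derivative u) (at 0)"
        by (auto intro!: derivative_eq_intros)
      then have "((\<lambda>y. ln (1 + u * y) / y) \<longlongrightarrow> u) (at 0)"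
        by (simp add: has_field_derivative_iff)
      then have "(g \<longlongrightarrow> u) (at 0)"
        by (rule Lim_transform_eventually) (auto simp: g_def eventually_at_filter)
      then show ?thesis using True by (simp add: isCont_def g_def)
    next
      case False
      have "isCont (\<lambda>y. ln (1 + u * y) / y) y"
        using fac[of y] y False by (intro continuous_intros) auto
      moreover have "\<forall>\<^sub>F z in nhds y. g z = ln (1 + u * z) / z"
        using False by (auto simp: g_def eventually_nhds intro!: exI[of _ "- {0}"])
      ultimately show ?thesis by (simp add: isCont_cong)
    qed
  qed
  then obtain q where q: "real_polynomial_function q" "\<And>y. y \<in> {0..b} \<Longrightarrow> \<bar>g y - q y\<bar> < \<delta>"
    using Stone_Weierstrass_real_polynomial_function[of "{0..b}" g \<delta>] assms by auto
  obtain c N where qc: "q = (\<lambda>y. \<Sum>i\<le>N. c i * y ^ i)"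
    using q(1) real_polynomial_function_iff_sum by metis
  show ?thesis
  proof (rule that[of c N])
    fix y assume y: "0 \<le> y" "y \<le> b"
    have "ln (1 + u * y) = g y * y" by (simp add: g_def)
    moreover have "(\<Sum>i\<le>N. c i * y ^ Suc i) = q y * y"
      unfolding qc sum_distrib_right by (simp add: mult_ac)
    ultimately have "\<bar>ln (1 + u * y) - (\<Sum>i\<le>N. c i * y ^ Suc i)\<bar> = \<bar>g y - q y\<bar> * y"
      using y by (simp add: left_diff_distrib[symmetric] abs_mult)
    also have "\<dots> \<le> \<delta> * y" using q(2)[of y] y by (intro mult_right_mono) auto
    finally show "\<bar>ln (1 + u * y) - (\<Sum>i\<le>N. c i * y ^ Suc i)\<bar> \<le> \<delta> * y" .
  qed
qed


theorem (in mercer_kernel) ln_generating_function_trace_approx: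
  assumes "\<And>v. v > -1 \<Longrightarrow> (\<lambda>k. Re (minor_integral \<nu> K k) / fact k * v ^ k) sums G v"
    and "\<And>v. v > -1 \<Longrightarrow> G v > 0" and "\<And>v w. -1 < v \<Longrightarrow> v \<le> w \<Longrightarrow> G v \<le> G w"
    and "b > 1" and "1 + u * b > 0" and "u > -1"
    and "\<And>y. 0 \<le> y \<Longrightarrow> y \<le> b \<Longrightarrow> \<bar>ln (1 + u * y) - (\<Sum>i\<le>N. c i * y ^ Suc i)\<bar> \<le> \<delta> * y"
  shows "\<bar>ln (G u) - (\<Sum>i\<le>N. c i * Re (kernel_trace \<nu> K i))\<bar> \<le> \<delta> * Re (kernel_trace \<nu> K 0)"
proof -
  obtain x where x: "\<And>n j. j < n \<Longrightarrow> 0 \<le> x n j"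
    "\<And>k. (\<lambda>n. \<Sum>j<n. x n j ^ Suc k) \<longlonglongrightarrow> Re (kernel_trace \<nu> K k)"
    "\<And>k. (\<lambda>n. fact k * elem_sym n (x n) k) \<longlonglongrightarrow> Re (minor_integral \<nu> K k)"
    by (rule approximate_spectrum) blast
  have e: "(\<lambda>n. elem_sym n (x n) k) \<longlonglongrightarrow> Re (minor_integral \<nu> K k) / fact k" for k
    using tendsto_divide[OF x(3)[of k] tendsto_const[of "fact k"]] by simp
  show ?thesis
    by (rule ln_generating_function_approx[OF x(1) x(2) e assms(1)]) (use assms in auto)
qed

section \<open>Comparing the traces of two kernels\<close>

lemma measurable_two_arguments:
  assumes "(\<lambda>p. f (fst p) (snd p)) \<in> borel_measurable (N \<Otimes>\<^sub>M N)" "g \<in> measurable M N" "h \<in> measurable M N"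
  shows "(\<lambda>x. f (g x) (h x)) \<in> borel_measurable M"
  using measurable_compose[OF measurable_Pair[OF assms(2,3)] assms(1)] by simp

lemma norm_integral_le_nn_integral:
  fixes f :: "'b \<Rightarrow> complex"
  shows "ennreal (cmod (\<integral>x. f x \<partial>M)) \<le> (\<integral>\<^sup>+x. cmod (f x) \<partial>M)"
  by (cases "integrable M f") (auto simp: integral_norm_bound_ennreal not_integrable_integral_eq)

context mercer_kernel
begin

lemma iter_measurable' [measurable (raw)]:
  assumes "g \<in> measurable M \<nu>" "h \<in> measurable M \<nu>"
  shows "(\<lambda>x. iter_kernel \<nu> K k (g x) (h x)) \<in> borel_measurable M"
  by (rule measurable_two_arguments[OF iter_kernel_measurable2 assms])

lemma kernel_measurable' [measurable (raw)]:
  assumes "g \<in> measurable M \<nu>" "h \<in> measurable M \<nu>"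
  shows "(\<lambda>x. K (g x) (h x)) \<in> borel_measurable M"
  using iter_measurable'[OF assms, of 0] by simp

lemma iter_integrable: "integrable \<nu> (\<lambda>\<zeta>. iter_kernel \<nu> K k z \<zeta> * K \<zeta> w)"
proof (rule Bochner_Integration.integrable_bound)
  show "integrable \<nu> (\<lambda>\<zeta>. C * (C * mass) ^ k * ind z * C * ind w * ind \<zeta>)"
    using ind_integrable by simp
  show "(\<lambda>\<zeta>. iter_kernel \<nu> K k z \<zeta> * K \<zeta> w) \<in> borel_measurable \<nu>"
    by (intro borel_measurable_times iter_kernel_measurable kernel_measurable)
  have "norm (iter_kernel \<nu> K k z \<zeta> * K \<zeta> w) \<le> C * (C * mass) ^ k * ind z * C * ind w * ind \<zeta>" for \<zeta>
    by (intro iter_bound_step iter_kernel_bound kernel_bound) (use C_nonneg in simp)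
  then show "AE \<zeta> in \<nu>. norm (iter_kernel \<nu> K k z \<zeta> * K \<zeta> w)
      \<le> norm (C * (C * mass) ^ k * ind z * C * ind w * ind \<zeta>)"
    using abs_ge_self order_trans by (intro AE_I2) (fastforce simp only: real_norm_def)
qed

lemma iter_diagonal_integrable: "integrable \<nu> (\<lambda>z. iter_kernel \<nu> K k z z)"
proof (rule Bochner_Integration.integrable_bound)
  show "integrable \<nu> (\<lambda>\<zeta>. C * (C * mass) ^ k * ind \<zeta>)"
    using ind_integrable by simp
  show "AE z in \<nu>. norm (iter_kernel \<nu> K k z z) \<le> norm (C * (C * mass) ^ k * ind z)"
  proof (rule AE_I2)
    fix z show "norm (iter_kernel \<nu> K k z z) \<le> norm (C * (C * mass) ^ k * ind z)"
      using iter_kernel_bound[of k z z] C_nonneg by (cases "z \<in> D") auto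
  qed
qed (rule iter_kernel_measurable)

lemma iter_norm_le:
  "ennreal (cmod (iter_kernel \<nu> K (Suc k) z w))
     \<le> (\<integral>\<^sup>+\<zeta>. cmod (iter_kernel \<nu> K k z \<zeta>) * ennreal (cmod (K \<zeta> w)) \<partial>\<nu>)"
  using norm_integral_le_nn_integral[of \<nu> "\<lambda>\<zeta>. iter_kernel \<nu> K k z \<zeta> * K \<zeta> w"]
  by (simp add: norm_mult ennreal_mult)

lemma pair: "pair_sigma_finite \<nu> \<nu>" by standard

context
  fixes R :: real
  assumes R: "0 \<le> R" and columns: "\<And>w. w \<in> space \<nu> \<Longrightarrow> (\<integral>\<^sup>+z. cmod (K z w) \<partial>\<nu>) \<le> ennreal R"
begin

lemma iter_sup_bound: "w \<in> space \<nu> \<Longrightarrow> ennreal (cmod (iter_kernel \<nu> K k z w)) \<le> ennreal (C * R ^ k)"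
proof (induction k arbitrary: w)
  case 0
  have "cmod (K z w) \<le> C"
    using kernel_bound[of z w] C_nonneg by (cases "z \<in> D"; cases "w \<in> D") auto
  then show ?case by (simp add: ennreal_leI)
next
  case (Suc k)
  note [measurable] = Suc.prems
  have "ennreal (cmod (iter_kernel \<nu> K (Suc k) z w)) \<le> (\<integral>\<^sup>+\<zeta>. ennreal (C * R ^ k) * ennreal (cmod (K \<zeta> w)) \<partial>\<nu>)"
    by (rule order_trans[OF iter_norm_le]) (intro nn_integral_mono mult_right_mono Suc.IH, auto)
  also have "\<dots> = ennreal (C * R ^ k) * (\<integral>\<^sup>+\<zeta>. ennreal (cmod (K \<zeta> w)) \<partial>\<nu>)"
    by (rule nn_integral_cmult) measurable
  also have "\<dots> \<le> ennreal (C * R ^ k) * ennreal R" by (intro mult_left_mono columns Suc.prems) auto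
  also have "\<dots> = ennreal (C * R ^ Suc k)" using R C_nonneg by (simp add: ennreal_mult[symmetric] mult_ac)
  finally show ?case .
qed

lemma iter_columns: "w \<in> space \<nu> \<Longrightarrow> (\<integral>\<^sup>+z. cmod (iter_kernel \<nu> K k z w) \<partial>\<nu>) \<le> ennreal (R ^ Suc k)"
proof (induction k arbitrary: w)
  case 0
  then show ?case using columns by simp
next
  case (Suc k)
  interpret P: pair_sigma_finite \<nu> \<nu> by (rule pair)
  note [measurable] = Suc.prems
  have "(\<integral>\<^sup>+z. cmod (iter_kernel \<nu> K (Suc k) z w) \<partial>\<nu>)
      \<le> (\<integral>\<^sup>+z. \<integral>\<^sup>+\<zeta>. cmod (iter_kernel \<nu> K k z \<zeta>) * ennreal (cmod (K \<zeta> w)) \<partial>\<nu> \<partial>\<nu>)"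
    by (intro nn_integral_mono iter_norm_le)
  also have "\<dots> = (\<integral>\<^sup>+\<zeta>. \<integral>\<^sup>+z. cmod (iter_kernel \<nu> K k z \<zeta>) * ennreal (cmod (K \<zeta> w)) \<partial>\<nu> \<partial>\<nu>)"
    by (rule P.Fubini') measurable
  also have "\<dots> = (\<integral>\<^sup>+\<zeta>. (\<integral>\<^sup>+z. cmod (iter_kernel \<nu> K k z \<zeta>) \<partial>\<nu>) * ennreal (cmod (K \<zeta> w)) \<partial>\<nu>)"
    by (intro nn_integral_cong nn_integral_multc) measurable
  also have "\<dots> \<le> (\<integral>\<^sup>+\<zeta>. ennreal (R ^ Suc k) * ennreal (cmod (K \<zeta> w)) \<partial>\<nu>)"
    by (intro nn_integral_mono mult_right_mono Suc.IH) auto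
  also have "\<dots> = ennreal (R ^ Suc k) * (\<integral>\<^sup>+\<zeta>. ennreal (cmod (K \<zeta> w)) \<partial>\<nu>)"
    by (rule nn_integral_cmult) measurable
  also have "\<dots> \<le> ennreal (R ^ Suc k) * ennreal R" by (intro mult_left_mono columns Suc.prems) auto
  also have "\<dots> = ennreal (R ^ Suc (Suc k))" using R by (simp add: ennreal_mult[symmetric] mult_ac)
  finally show ?case .
qed

end

end

text \<open>
  In the application \<open>C\<close> and \<open>R\<close> do not depend on the length of the rectangle, while the \<open>L\<^sup>1\<close> distance of the
  two kernels grows more slowly than that length. The traces of powers are therefore compared
  with constants that involve only \<open>C\<close>, \<open>R\<close> and the exponent.
\<close>

locale mercer_kernel_pair =
  K: mercer_kernel \<nu> D C \<phi> K + B: mercer_kernel \<nu> D C \<phi>' B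
  for \<nu> :: "'b measure" and D C \<phi> \<phi>' K B +
  fixes R :: real
  assumes R: "0 \<le> R"
    and rows_K: "\<And>z. z \<in> space \<nu> \<Longrightarrow> (\<integral>\<^sup>+w. cmod (K z w) \<partial>\<nu>) \<le> ennreal R"
    and columns_B: "\<And>w. w \<in> space \<nu> \<Longrightarrow> (\<integral>\<^sup>+z. cmod (B z w) \<partial>\<nu>) \<le> ennreal R"
begin

definition delta :: "nat \<Rightarrow> 'b \<Rightarrow> 'b \<Rightarrow> ennreal" where
  "delta k z w = ennreal (cmod (iter_kernel \<nu> K k z w - iter_kernel \<nu> B k z w))"

abbreviation dist_L1 :: "ennreal" where "dist_L1 \<equiv> \<integral>\<^sup>+z. \<integral>\<^sup>+w. cmod (K z w - B z w) \<partial>\<nu> \<partial>\<nu>"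

lemma delta_0: "delta 0 = (\<lambda>z w. ennreal (cmod (K z w - B z w)))"
  by (intro ext) (simp add: delta_def)

lemma delta_measurable [measurable (raw)]:
  assumes "g \<in> measurable M \<nu>" "h \<in> measurable M \<nu>"
  shows "(\<lambda>x. delta k (g x) (h x)) \<in> borel_measurable M"
  using assms unfolding delta_def by measurable

text \<open>
  This is the telescoping identity \<open>K\<^sup>k\<^sup>+\<^sup>2 - B\<^sup>k\<^sup>+\<^sup>2 = (K\<^sup>k\<^sup>+\<^sup>1 - B\<^sup>k\<^sup>+\<^sup>1) K + B\<^sup>k\<^sup>+\<^sup>1 (K - B)\<close>
  with absolute values inside the integrals.
\<close>

lemma delta_Suc:
  assumes [measurable]: "z \<in> space \<nu>" "w \<in> space \<nu>"
  shows "delta (Suc k) z w \<le> (\<integral>\<^sup>+\<zeta>. delta k z \<zeta> * cmod (K \<zeta> w) \<partial>\<nu>)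
     + (\<integral>\<^sup>+\<zeta>. cmod (iter_kernel \<nu> B k z \<zeta>) * delta 0 \<zeta> w \<partial>\<nu>)"
proof -
  have "iter_kernel \<nu> K (Suc k) z w - iter_kernel \<nu> B (Suc k) z w
      = (\<integral>\<zeta>. iter_kernel \<nu> K k z \<zeta> * K \<zeta> w - iter_kernel \<nu> B k z \<zeta> * B \<zeta> w \<partial>\<nu>)"
    by (simp add: Bochner_Integration.integral_diff[OF K.iter_integrable B.iter_integrable])
  then have "delta (Suc k) z w
      \<le> (\<integral>\<^sup>+\<zeta>. cmod (iter_kernel \<nu> K k z \<zeta> * K \<zeta> w - iter_kernel \<nu> B k z \<zeta> * B \<zeta> w) \<partial>\<nu>)"
    unfolding delta_def by (simp only: norm_integral_le_nn_integral)
  also have "\<dots> \<le> (\<integral>\<^sup>+\<zeta>. delta k z \<zeta> * cmod (K \<zeta> w) + cmod (iter_kernel \<nu> B k z \<zeta>) * delta 0 \<zeta> w \<partial>\<nu>)"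
  proof (rule nn_integral_mono)
    fix \<zeta>
    have "iter_kernel \<nu> K k z \<zeta> * K \<zeta> w - iter_kernel \<nu> B k z \<zeta> * B \<zeta> w
      = (iter_kernel \<nu> K k z \<zeta> - iter_kernel \<nu> B k z \<zeta>) * K \<zeta> w + iter_kernel \<nu> B k z \<zeta> * (K \<zeta> w - B \<zeta> w)"
      by (simp add: algebra_simps)
    then have "cmod (iter_kernel \<nu> K k z \<zeta> * K \<zeta> w - iter_kernel \<nu> B k z \<zeta> * B \<zeta> w)
      \<le> cmod (iter_kernel \<nu> K k z \<zeta> - iter_kernel \<nu> B k z \<zeta>) * cmod (K \<zeta> w)
        + cmod (iter_kernel \<nu> B k z \<zeta>) * cmod (K \<zeta> w - B \<zeta> w)"
      by (metis norm_mult norm_triangle_ineq)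
    then show "ennreal (cmod (iter_kernel \<nu> K k z \<zeta> * K \<zeta> w - iter_kernel \<nu> B k z \<zeta> * B \<zeta> w))
      \<le> delta k z \<zeta> * cmod (K \<zeta> w) + cmod (iter_kernel \<nu> B k z \<zeta>) * delta 0 \<zeta> w"
      by (simp add: delta_def ennreal_mult[symmetric] ennreal_plus[symmetric] ennreal_leI del: ennreal_plus)
  qed
  also have "\<dots> = (\<integral>\<^sup>+\<zeta>. delta k z \<zeta> * cmod (K \<zeta> w) \<partial>\<nu>)
     + (\<integral>\<^sup>+\<zeta>. cmod (iter_kernel \<nu> B k z \<zeta>) * delta 0 \<zeta> w \<partial>\<nu>)"
    by (rule nn_integral_add) measurable
  finally show ?thesis .
qed

text \<open>
  In the first term of the telescoping identity the rows of \<open>K\<close> are integrated first, in the second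
  one the columns of the iterates of \<open>B\<close>; each further power costs one factor \<open>R\<close>.
\<close>

lemma delta_L1: "(\<integral>\<^sup>+z. \<integral>\<^sup>+w. delta k z w \<partial>\<nu> \<partial>\<nu>) \<le> ennreal (real (Suc k) * R ^ k) * dist_L1"
proof (induction k)
  case 0
  then show ?case by (simp add: delta_def)
next
  case (Suc k)
  interpret P: pair_sigma_finite \<nu> \<nu> by (rule K.pair)
  have row: "(\<integral>\<^sup>+w. delta (Suc k) z w \<partial>\<nu>) \<le> (\<integral>\<^sup>+\<zeta>. delta k z \<zeta> \<partial>\<nu>) * ennreal R
      + (\<integral>\<^sup>+\<zeta>. cmod (iter_kernel \<nu> B k z \<zeta>) * (\<integral>\<^sup>+w. delta 0 \<zeta> w \<partial>\<nu>) \<partial>\<nu>)"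
    if [measurable]: "z \<in> space \<nu>" for z
  proof -
    have "(\<integral>\<^sup>+w. delta (Suc k) z w \<partial>\<nu>) \<le> (\<integral>\<^sup>+w. (\<integral>\<^sup>+\<zeta>. delta k z \<zeta> * cmod (K \<zeta> w) \<partial>\<nu>)
       + (\<integral>\<^sup>+\<zeta>. cmod (iter_kernel \<nu> B k z \<zeta>) * delta 0 \<zeta> w \<partial>\<nu>) \<partial>\<nu>)"
      by (intro nn_integral_mono delta_Suc that)
    also have "\<dots> = (\<integral>\<^sup>+w. \<integral>\<^sup>+\<zeta>. delta k z \<zeta> * cmod (K \<zeta> w) \<partial>\<nu> \<partial>\<nu>)
       + (\<integral>\<^sup>+w. \<integral>\<^sup>+\<zeta>. cmod (iter_kernel \<nu> B k z \<zeta>) * delta 0 \<zeta> w \<partial>\<nu> \<partial>\<nu>)"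
      by (rule nn_integral_add) measurable
    also have "(\<integral>\<^sup>+w. \<integral>\<^sup>+\<zeta>. delta k z \<zeta> * cmod (K \<zeta> w) \<partial>\<nu> \<partial>\<nu>)
        = (\<integral>\<^sup>+\<zeta>. \<integral>\<^sup>+w. delta k z \<zeta> * cmod (K \<zeta> w) \<partial>\<nu> \<partial>\<nu>)"
      by (rule P.Fubini') measurable
    also have "\<dots> = (\<integral>\<^sup>+\<zeta>. delta k z \<zeta> * (\<integral>\<^sup>+w. cmod (K \<zeta> w) \<partial>\<nu>) \<partial>\<nu>)"
      by (intro nn_integral_cong nn_integral_cmult) measurable
    also have "\<dots> \<le> (\<integral>\<^sup>+\<zeta>. delta k z \<zeta> * ennreal R \<partial>\<nu>)"
      by (intro nn_integral_mono mult_left_mono rows_K) auto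
    also have "\<dots> = (\<integral>\<^sup>+\<zeta>. delta k z \<zeta> \<partial>\<nu>) * ennreal R"
      by (rule nn_integral_multc) measurable
    also have "(\<integral>\<^sup>+w. \<integral>\<^sup>+\<zeta>. cmod (iter_kernel \<nu> B k z \<zeta>) * delta 0 \<zeta> w \<partial>\<nu> \<partial>\<nu>)
        = (\<integral>\<^sup>+\<zeta>. \<integral>\<^sup>+w. cmod (iter_kernel \<nu> B k z \<zeta>) * delta 0 \<zeta> w \<partial>\<nu> \<partial>\<nu>)"
      by (rule P.Fubini') measurable
    also have "\<dots> = (\<integral>\<^sup>+\<zeta>. cmod (iter_kernel \<nu> B k z \<zeta>) * (\<integral>\<^sup>+w. delta 0 \<zeta> w \<partial>\<nu>) \<partial>\<nu>)"
      by (intro nn_integral_cong nn_integral_cmult) measurable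
    finally show ?thesis by (simp add: add_mono)
  qed
  have "(\<integral>\<^sup>+z. \<integral>\<^sup>+w. delta (Suc k) z w \<partial>\<nu> \<partial>\<nu>) \<le> (\<integral>\<^sup>+z. (\<integral>\<^sup>+\<zeta>. delta k z \<zeta> \<partial>\<nu>) * ennreal R
      + (\<integral>\<^sup>+\<zeta>. cmod (iter_kernel \<nu> B k z \<zeta>) * (\<integral>\<^sup>+w. delta 0 \<zeta> w \<partial>\<nu>) \<partial>\<nu>) \<partial>\<nu>)"
    by (intro nn_integral_mono row)
  also have "\<dots> = (\<integral>\<^sup>+z. (\<integral>\<^sup>+\<zeta>. delta k z \<zeta> \<partial>\<nu>) * ennreal R \<partial>\<nu>)
      + (\<integral>\<^sup>+z. \<integral>\<^sup>+\<zeta>. cmod (iter_kernel \<nu> B k z \<zeta>) * (\<integral>\<^sup>+w. delta 0 \<zeta> w \<partial>\<nu>) \<partial>\<nu> \<partial>\<nu>)"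
    by (rule nn_integral_add) measurable
  also have "(\<integral>\<^sup>+z. (\<integral>\<^sup>+\<zeta>. delta k z \<zeta> \<partial>\<nu>) * ennreal R \<partial>\<nu>) = (\<integral>\<^sup>+z. \<integral>\<^sup>+\<zeta>. delta k z \<zeta> \<partial>\<nu> \<partial>\<nu>) * ennreal R"
    by (rule nn_integral_multc) measurable
  also have "(\<integral>\<^sup>+z. \<integral>\<^sup>+\<zeta>. cmod (iter_kernel \<nu> B k z \<zeta>) * (\<integral>\<^sup>+w. delta 0 \<zeta> w \<partial>\<nu>) \<partial>\<nu> \<partial>\<nu>)
     = (\<integral>\<^sup>+\<zeta>. \<integral>\<^sup>+z. cmod (iter_kernel \<nu> B k z \<zeta>) * (\<integral>\<^sup>+w. delta 0 \<zeta> w \<partial>\<nu>) \<partial>\<nu> \<partial>\<nu>)"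
    by (rule P.Fubini') measurable
  also have "\<dots> = (\<integral>\<^sup>+\<zeta>. (\<integral>\<^sup>+z. cmod (iter_kernel \<nu> B k z \<zeta>) \<partial>\<nu>) * (\<integral>\<^sup>+w. delta 0 \<zeta> w \<partial>\<nu>) \<partial>\<nu>)"
    by (intro nn_integral_cong nn_integral_multc) measurable
  also have "\<dots> \<le> (\<integral>\<^sup>+\<zeta>. ennreal (R ^ Suc k) * (\<integral>\<^sup>+w. delta 0 \<zeta> w \<partial>\<nu>) \<partial>\<nu>)"
    by (intro nn_integral_mono mult_right_mono B.iter_columns[OF R columns_B]) auto
  also have "\<dots> = ennreal (R ^ Suc k) * dist_L1"
    unfolding delta_0 by (rule nn_integral_cmult) measurable
  finally have "(\<integral>\<^sup>+z. \<integral>\<^sup>+w. delta (Suc k) z w \<partial>\<nu> \<partial>\<nu>)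
      \<le> (\<integral>\<^sup>+z. \<integral>\<^sup>+w. delta k z w \<partial>\<nu> \<partial>\<nu>) * ennreal R + ennreal (R ^ Suc k) * dist_L1"
    by (simp add: add_left_mono)
  also have "\<dots> \<le> (ennreal (real (Suc k) * R ^ k) * dist_L1) * ennreal R + ennreal (R ^ Suc k) * dist_L1"
    by (intro add_mono mult_right_mono Suc.IH) auto
  also have "\<dots> = (ennreal (real (Suc k) * R ^ k) * ennreal R + ennreal (R ^ Suc k)) * dist_L1"
    unfolding distrib_right by (simp only: mult_ac)
  also have "ennreal (real (Suc k) * R ^ k) * ennreal R + ennreal (R ^ Suc k)
      = ennreal (real (Suc (Suc k)) * R ^ Suc k)"
    using R by (simp add: ennreal_mult[symmetric] ennreal_plus[symmetric] algebra_simps del: ennreal_plus)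
  finally show ?case .
qed

text \<open>
  On the diagonal one factor of each product is estimated by its supremum, which leaves an \<open>L\<^sup>1\<close> norm.
  The trace of the first power is not covered, since the diagonal is a null set for the \<open>L\<^sup>1\<close> distance.
\<close>

lemma kernel_trace_diff_Suc:
  "ennreal (cmod (kernel_trace \<nu> K (Suc k) - kernel_trace \<nu> B (Suc k)))
     \<le> ennreal (C * real (k + 2) * R ^ k) * dist_L1"
proof -
  interpret P: pair_sigma_finite \<nu> \<nu> by (rule K.pair)
  have C: "0 \<le> C" by (rule K.C_nonneg)
  have Kb: "ennreal (cmod (K z w)) \<le> ennreal C" for z w
    using K.kernel_bound[of z w] C by (cases "z \<in> D"; cases "w \<in> D") (auto intro!: ennreal_leI)
  have "kernel_trace \<nu> K (Suc k) - kernel_trace \<nu> B (Suc k)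
      = (\<integral>z. iter_kernel \<nu> K (Suc k) z z - iter_kernel \<nu> B (Suc k) z z \<partial>\<nu>)"
    unfolding kernel_trace_def
    by (rule Bochner_Integration.integral_diff[symmetric, OF K.iter_diagonal_integrable B.iter_diagonal_integrable])
  then have "ennreal (cmod (kernel_trace \<nu> K (Suc k) - kernel_trace \<nu> B (Suc k)))
      \<le> (\<integral>\<^sup>+z. delta (Suc k) z z \<partial>\<nu>)"
    unfolding delta_def by (simp only: norm_integral_le_nn_integral)
  also have "\<dots> \<le> (\<integral>\<^sup>+z. (\<integral>\<^sup>+\<zeta>. delta k z \<zeta> * cmod (K \<zeta> z) \<partial>\<nu>)
     + (\<integral>\<^sup>+\<zeta>. cmod (iter_kernel \<nu> B k z \<zeta>) * delta 0 \<zeta> z \<partial>\<nu>) \<partial>\<nu>)"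
    by (intro nn_integral_mono delta_Suc)
  also have "\<dots> \<le> (\<integral>\<^sup>+z. (\<integral>\<^sup>+\<zeta>. delta k z \<zeta> * ennreal C \<partial>\<nu>)
     + (\<integral>\<^sup>+\<zeta>. ennreal (C * R ^ k) * delta 0 \<zeta> z \<partial>\<nu>) \<partial>\<nu>)"
    by (intro nn_integral_mono add_mono mult_left_mono mult_right_mono Kb B.iter_sup_bound[OF R columns_B]) auto
  also have "\<dots> = (\<integral>\<^sup>+z. \<integral>\<^sup>+\<zeta>. delta k z \<zeta> * ennreal C \<partial>\<nu> \<partial>\<nu>)
     + (\<integral>\<^sup>+z. \<integral>\<^sup>+\<zeta>. ennreal (C * R ^ k) * delta 0 \<zeta> z \<partial>\<nu> \<partial>\<nu>)"
    by (rule nn_integral_add) measurable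
  also have "(\<integral>\<^sup>+z. \<integral>\<^sup>+\<zeta>. ennreal (C * R ^ k) * delta 0 \<zeta> z \<partial>\<nu> \<partial>\<nu>)
     = (\<integral>\<^sup>+\<zeta>. \<integral>\<^sup>+z. ennreal (C * R ^ k) * delta 0 \<zeta> z \<partial>\<nu> \<partial>\<nu>)"
    by (rule P.Fubini') measurable
  also have "\<dots> = ennreal (C * R ^ k) * dist_L1"
  proof -
    have "(\<integral>\<^sup>+\<zeta>. \<integral>\<^sup>+z. ennreal (C * R ^ k) * delta 0 \<zeta> z \<partial>\<nu> \<partial>\<nu>)
        = (\<integral>\<^sup>+\<zeta>. ennreal (C * R ^ k) * (\<integral>\<^sup>+z. delta 0 \<zeta> z \<partial>\<nu>) \<partial>\<nu>)"
      by (intro nn_integral_cong nn_integral_cmult) measurable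
    also have "\<dots> = ennreal (C * R ^ k) * dist_L1"
      unfolding delta_0 by (rule nn_integral_cmult) measurable
    finally show ?thesis .
  qed
  also have "(\<integral>\<^sup>+z. \<integral>\<^sup>+\<zeta>. delta k z \<zeta> * ennreal C \<partial>\<nu> \<partial>\<nu>) = (\<integral>\<^sup>+z. \<integral>\<^sup>+\<zeta>. delta k z \<zeta> \<partial>\<nu> \<partial>\<nu>) * ennreal C"
  proof -
    have "(\<integral>\<^sup>+z. \<integral>\<^sup>+\<zeta>. delta k z \<zeta> * ennreal C \<partial>\<nu> \<partial>\<nu>) = (\<integral>\<^sup>+z. (\<integral>\<^sup>+\<zeta>. delta k z \<zeta> \<partial>\<nu>) * ennreal C \<partial>\<nu>)"
      by (intro nn_integral_cong nn_integral_multc) measurable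
    also have "\<dots> = (\<integral>\<^sup>+z. \<integral>\<^sup>+\<zeta>. delta k z \<zeta> \<partial>\<nu> \<partial>\<nu>) * ennreal C"
      by (rule nn_integral_multc) measurable
    finally show ?thesis .
  qed
  also have "(\<integral>\<^sup>+z. \<integral>\<^sup>+\<zeta>. delta k z \<zeta> \<partial>\<nu> \<partial>\<nu>) * ennreal C + ennreal (C * R ^ k) * dist_L1
      \<le> (ennreal (real (Suc k) * R ^ k) * dist_L1) * ennreal C + ennreal (C * R ^ k) * dist_L1"
    by (intro add_mono mult_right_mono delta_L1) auto
  also have "\<dots> = (ennreal (real (Suc k) * R ^ k) * ennreal C + ennreal (C * R ^ k)) * dist_L1"
    unfolding distrib_right by (simp only: mult_ac)
  also have "ennreal (real (Suc k) * R ^ k) * ennreal C + ennreal (C * R ^ k)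
      = ennreal (C * real (k + 2) * R ^ k)"
    using R C by (simp add: ennreal_mult[symmetric] ennreal_plus[symmetric] algebra_simps del: ennreal_plus)
  finally show ?thesis .
qed

end


section \<open>Area measure on rectangles\<close>

lemma lborel_complex: "lborel = distr (lborel \<Otimes>\<^sub>M lborel) borel (\<lambda>(x, y). Complex x y)"
proof (rule lborel_eqI)
  have m: "(\<lambda>(x, y). Complex x y) \<in> borel_measurable (lborel \<Otimes>\<^sub>M lborel)"
    unfolding Complex_eq by measurable
  fix l u :: complex assume lu: "\<And>b. b \<in> Basis \<Longrightarrow> l \<bullet> b \<le> u \<bullet> b"
  have le: "Re l \<le> Re u" "Im l \<le> Im u" using lu[of 1] lu[of \<i>] by (auto simp: Basis_complex_def)
  have "(\<lambda>(x, y). Complex x y) -` box l u \<inter> space (lborel \<Otimes>\<^sub>M lborel) = {Re l<..<Re u} \<times> {Im l<..<Im u}"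
    by (auto simp: in_box_complex_iff space_pair_measure)
  then show "emeasure (distr (lborel \<Otimes>\<^sub>M lborel) borel (\<lambda>(x, y). Complex x y)) (box l u)
      = ennreal (\<Prod>b\<in>Basis. (u - l) \<bullet> b)"
    using le by (subst emeasure_distr[OF m])
      (auto simp: lborel.emeasure_pair_measure_Times Basis_complex_def ennreal_mult)
qed simp

definition rect :: "real \<Rightarrow> real \<Rightarrow> complex set" where
  "rect a L = {z. 0 \<le> Re z \<and> Re z \<le> L \<and> 1 \<le> Im z \<and> Im z \<le> a}"

lemma rect_borel [measurable]: "rect a L \<in> sets borel"
  unfolding rect_def by measurable

lemma rect_subset: "rect a L \<subseteq> upper_half_plane"
  by (auto simp: rect_def upper_half_plane_def)

lemma upper_half_plane_borel [measurable]: "upper_half_plane \<in> sets borel"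
  unfolding upper_half_plane_def by measurable

lemma space_area_H: "space area_H = upper_half_plane"
  by (simp add: space_restrict_space)

lemma sigma_finite_area_H: "sigma_finite_measure area_H"
  by (rule sigma_finite_measure_restrict_space) (auto intro: sigma_finite_lborel)

lemma rect_sets_area_H: "rect a L \<in> sets area_H"
  using rect_subset[of a L] by (auto simp: sets_restrict_space image_iff intro!: bexI[of _ "rect a L"])

lemma measurable_area_H: "f \<in> borel_measurable borel \<Longrightarrow> f \<in> borel_measurable area_H"
  by (rule measurable_restrict_space1) simp

lemma nn_integral_area_H:
  assumes f: "f \<in> borel_measurable borel" and zero: "\<And>z. z \<notin> upper_half_plane \<Longrightarrow> f z = 0"
  shows "(\<integral>\<^sup>+z. f z \<partial>area_H) = (\<integral>\<^sup>+x. \<integral>\<^sup>+y. f (Complex x y) \<partial>lborel \<partial>lborel)"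
proof -
  have m: "(\<lambda>(x, y). Complex x y) \<in> borel_measurable (lborel \<Otimes>\<^sub>M lborel)"
    unfolding Complex_eq by measurable
  have "(\<integral>\<^sup>+z. f z \<partial>area_H) = (\<integral>\<^sup>+z. f z * indicator upper_half_plane z \<partial>lborel)"
    by (subst nn_integral_restrict_space) auto
  also have "\<dots> = (\<integral>\<^sup>+z. f z \<partial>lborel)"
    using zero by (intro nn_integral_cong) (auto simp: indicator_def)
  also have "\<dots> = (\<integral>\<^sup>+p. f (case p of (x, y) \<Rightarrow> Complex x y) \<partial>(lborel \<Otimes>\<^sub>M lborel))"
    by (subst lborel_complex, subst nn_integral_distr) (use m f in auto)
  also have "\<dots> = (\<integral>\<^sup>+x. \<integral>\<^sup>+y. f (Complex x y) \<partial>lborel \<partial>lborel)"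
    by (subst lborel.nn_integral_fst[symmetric]) (use measurable_compose[OF m f] in auto)
  finally show ?thesis .
qed

lemma integral_area_H_product:
  fixes f g :: "real \<Rightarrow> complex"
  assumes f: "integrable lborel f" and g: "integrable lborel g"
    and h: "\<And>z. h z = f (Re z) * g (Im z)" and zero: "\<And>z. z \<notin> upper_half_plane \<Longrightarrow> h z = 0"
  shows "(\<integral>z. h z \<partial>area_H) = (\<integral>x. f x \<partial>lborel) * (\<integral>y. g y \<partial>lborel)"
proof -
  have m: "(\<lambda>(x, y). Complex x y) \<in> borel_measurable (lborel \<Otimes>\<^sub>M lborel)"
    unfolding Complex_eq by measurable
  have [measurable]: "f \<in> borel_measurable borel" "g \<in> borel_measurable borel"
    using borel_measurable_integrable[OF f] borel_measurable_integrable[OF g] by auto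
  have hm: "h \<in> borel_measurable borel" unfolding h by measurable
  have "integrable (lborel \<Otimes>\<^sub>M lborel) (\<lambda>(x, y). f x * g y)"
  proof (rule lborel_pair.Fubini_integrable)
    show "AE x in lborel. integrable lborel (\<lambda>y. case (x, y) of (x, y) \<Rightarrow> f x * g y)"
      using g by simp
    show "integrable lborel (\<lambda>x. \<integral>y. norm (case (x, y) of (x, y) \<Rightarrow> f x * g y) \<partial>lborel)"
      using f by (simp add: norm_mult)
  qed measurable
  then have int: "integrable (lborel \<Otimes>\<^sub>M lborel) (\<lambda>(x, y). f x * g y)" .
  have "(\<integral>z. h z \<partial>area_H) = (\<integral>z. indicator upper_half_plane z *\<^sub>R h z \<partial>lborel)"
    by (subst integral_restrict_space) auto
  also have "\<dots> = (\<integral>z. h z \<partial>lborel)"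
    using zero by (intro Bochner_Integration.integral_cong) (auto simp: indicator_def)
  also have "\<dots> = (\<integral>p. h (case p of (x, y) \<Rightarrow> Complex x y) \<partial>(lborel \<Otimes>\<^sub>M lborel))"
    by (subst lborel_complex, subst integral_distr) (use m hm in auto)
  also have "\<dots> = (\<integral>p. (case p of (x, y) \<Rightarrow> f x * g y) \<partial>(lborel \<Otimes>\<^sub>M lborel))"
    by (intro Bochner_Integration.integral_cong) (auto simp: h)
  also have "\<dots> = (\<integral>x. \<integral>y. f x * g y \<partial>lborel \<partial>lborel)"
    using lborel_pair.integral_fst'[OF int] by simp
  finally show ?thesis by simp
qed

lemma nn_integral_rect_Re:
  assumes f: "f \<in> borel_measurable borel" and "1 \<le> a"
  shows "(\<integral>\<^sup>+z. f (Re z) * indicator (rect a L) z \<partial>area_H)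
           = ennreal (a - 1) * (\<integral>\<^sup>+x. f x * indicator {0..L} x \<partial>lborel)"
proof -
  note [measurable] = f
  have "(\<integral>\<^sup>+z. f (Re z) * indicator (rect a L) z \<partial>area_H)
      = (\<integral>\<^sup>+x. \<integral>\<^sup>+y. f x * indicator (rect a L) (Complex x y) \<partial>lborel \<partial>lborel)"
    by (subst nn_integral_area_H) (use rect_subset in \<open>auto simp: indicator_def\<close>)
  also have "\<dots> = (\<integral>\<^sup>+x. \<integral>\<^sup>+y. (f x * indicator {0..L} x) * indicator {1..a} y \<partial>lborel \<partial>lborel)"
    by (intro nn_integral_cong) (auto simp: rect_def indicator_def)
  also have "\<dots> = (\<integral>\<^sup>+x. ennreal (a - 1) * (f x * indicator {0..L} x) \<partial>lborel)"
    using assms(2) by (subst nn_integral_cmult) (auto simp: mult.commute)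
  also have "\<dots> = ennreal (a - 1) * (\<integral>\<^sup>+x. f x * indicator {0..L} x \<partial>lborel)"
    by (rule nn_integral_cmult) measurable
  finally show ?thesis .
qed

lemma emeasure_rect: "1 \<le> a \<Longrightarrow> 0 \<le> L \<Longrightarrow> emeasure area_H (rect a L) = ennreal ((a - 1) * L)"
  using nn_integral_rect_Re[of "\<lambda>_. 1" a L] rect_sets_area_H[of a L] by (simp add: ennreal_mult)

lemma nn_integral_Cauchy_le:
  "0 \<le> L \<Longrightarrow> (\<integral>\<^sup>+x. ennreal (1 / (1 + (x - c)\<^sup>2)) * indicator {0..L} x \<partial>lborel) \<le> ennreal pi"
proof -
  assume L: "0 \<le> L"
  have "(\<integral>\<^sup>+x. ennreal (1 / (1 + (x - c)\<^sup>2)) * indicator {0..L} x \<partial>lborel) = ennreal (arctan (L - c) - arctan (0 - c))"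
    using L by (intro nn_integral_FTC_Icc[where F = "\<lambda>x. arctan (x - c)"])
      (auto intro!: derivative_eq_intros simp: inverse_eq_divide)
  also have "\<dots> \<le> ennreal pi"
    using arctan_lbound[of "- c"] arctan_ubound[of "L - c"] by (intro ennreal_leI) auto
  finally show ?thesis .
qed

lemma nn_integral_inverse_linear:
  "0 \<le> L \<Longrightarrow> (\<integral>\<^sup>+x. ennreal (1 / (1 + x)) * indicator {0..L} x \<partial>lborel) = ennreal (ln (1 + L))"
proof -
  assume L: "0 \<le> L"
  have "(\<integral>\<^sup>+x. ennreal (1 / (1 + x)) * indicator {0..L} x \<partial>lborel) = ennreal (ln (1 + L) - ln (1 + 0))"
    using L by (intro nn_integral_FTC_Icc[where F = "\<lambda>x. ln (1 + x)"])
      (auto intro!: derivative_eq_intros simp: inverse_eq_divide)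
  then show ?thesis by simp
qed

lemma nn_integral_inverse_linear':
  "0 \<le> L \<Longrightarrow> (\<integral>\<^sup>+x. ennreal (1 / (1 + (L - x))) * indicator {0..L} x \<partial>lborel) = ennreal (ln (1 + L))"
proof -
  assume L: "0 \<le> L"
  have "(\<integral>\<^sup>+x. ennreal (1 / (1 + (L - x))) * indicator {0..L} x \<partial>lborel) = ennreal (- ln (1 + (L - L)) - (- ln (1 + (L - 0))))"
    using L by (intro nn_integral_FTC_Icc[where F = "\<lambda>x. - ln (1 + (L - x))"])
      (auto intro!: derivative_eq_intros simp: inverse_eq_divide)
  then show ?thesis by simp
qed


section \<open>The kernel and its periodic comparison kernel\<close>

definition K_rect :: "real \<Rightarrow> real \<Rightarrow> complex \<Rightarrow> complex \<Rightarrow> complex" where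
  "K_rect a L z w = indicator (rect a L) z * indicator (rect a L) w * K_H z w"

text \<open>
  The Cayley transform \<open>z \<mapsto> (z - \<i>) / (z + \<i>)\<close> maps the half-plane onto the unit disc. These functions are the
  pull-back of the orthonormal basis \<open>sqrt ((m + 1) / \<pi>) z\<^sup>m\<close> of the Bergman space, times an indicator.
\<close>

definition disc_basis :: "real \<Rightarrow> real \<Rightarrow> nat \<Rightarrow> complex \<Rightarrow> complex" where
  "disc_basis a L m z = indicator (rect a L) z * of_real (sqrt (real (Suc m) / pi)) *
     (2 * \<i> / (z + \<i>)\<^sup>2) * ((z - \<i>) / (z + \<i>)) ^ m"

text \<open>
  The frequency \<open>0\<close> is left out: its coefficient \<open>\<xi>\<close> in the Fourier expansion of \<open>K_H\<close> vanishes.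
\<close>

definition freq :: "real \<Rightarrow> nat \<Rightarrow> real" where
  "freq L j = 2 * pi * real (Suc j) / L"

text \<open>
  As \<open>1 / (sin s)\<^sup>2\<close> is the sum of \<open>1 / (s - m \<pi>)\<^sup>2\<close> over all integers \<open>m\<close>, this is the periodisation
  \<open>\<Sum>m. K_H (z + m L) w\<close>, cut off to the rectangle.
\<close>

definition K_per :: "real \<Rightarrow> real \<Rightarrow> complex \<Rightarrow> complex \<Rightarrow> complex" where
  "K_per a L z w = indicator (rect a L) z * indicator (rect a L) w *
     (- of_real (pi / L\<^sup>2) / (sin (of_real (pi / L) * (z - cnj w)))\<^sup>2)"

definition per_basis :: "real \<Rightarrow> real \<Rightarrow> nat \<Rightarrow> complex \<Rightarrow> complex" where
  "per_basis a L j z = indicator (rect a L) z * of_real (sqrt (2 * freq L j / L)) *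
     exp (\<i> * of_real (freq L j) * z)"

text \<open>
  The series \<open>\<Sum>m. (m + 1) p\<^sup>m = 1 / (1 - p)\<^sup>2\<close> is used at the product \<open>p\<close> of the Cayley images of \<open>z\<close> and
  \<open>cnj w\<close>; the factor \<open>1 - p\<close> is a multiple of \<open>z - cnj w\<close>.
\<close>

lemma K_H_expansion:
  assumes "Im z > 0" "Im w > 0"
  shows "(\<lambda>m. of_real (real (Suc m) / pi) * (2 * \<i> / (z + \<i>)\<^sup>2) * cnj (2 * \<i> / (w + \<i>)\<^sup>2) *
     (((z - \<i>) / (z + \<i>)) * cnj ((w - \<i>) / (w + \<i>))) ^ m) sums K_H z w"
proof -
  have lt: "cmod ((z - \<i>) / (z + \<i>)) < 1" if "Im z > 0" for z
  proof -
    have "(cmod (z - \<i>))\<^sup>2 < (cmod (z + \<i>))\<^sup>2"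
      using that unfolding cmod_power2 by (simp add: power2_eq_square algebra_simps)
    then have "cmod (z - \<i>) < cmod (z + \<i>)" by (rule power2_less_imp_less) simp
    then show ?thesis by (simp add: norm_divide divide_less_eq_1)
  qed
  let ?p = "((z - \<i>) / (z + \<i>)) * cnj ((w - \<i>) / (w + \<i>))"
  have "cmod ?p < 1"
  proof -
    have "cmod ?p = cmod ((z - \<i>) / (z + \<i>)) * cmod ((w - \<i>) / (w + \<i>))" by (simp only: norm_mult complex_mod_cnj)
    also have "\<dots> < 1 * 1" by (intro mult_strict_mono' lt assms) auto
    finally show ?thesis by simp
  qed
  from geometric_deriv_sums[OF this]
  have "(\<lambda>m. (2 * \<i> / (z + \<i>)\<^sup>2) * cnj (2 * \<i> / (w + \<i>)\<^sup>2) / of_real pi * (of_nat (Suc m) * ?p ^ m))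
     sums ((2 * \<i> / (z + \<i>)\<^sup>2) * cnj (2 * \<i> / (w + \<i>)\<^sup>2) / of_real pi * (1 / (1 - ?p)\<^sup>2))"
    by (rule sums_mult)
  moreover have "(2 * \<i> / (z + \<i>)\<^sup>2) * cnj (2 * \<i> / (w + \<i>)\<^sup>2) / of_real pi * (1 / (1 - ?p)\<^sup>2) = K_H z w"
  proof -
    define v where "v = cnj w"
    have nz: "z + \<i> \<noteq> 0" "v - \<i> \<noteq> 0" "z - v \<noteq> 0"
      using assms by (auto simp: complex_eq_iff v_def)
    have c: "cnj (2 * \<i> / (w + \<i>)\<^sup>2) = - 2 * \<i> / (v - \<i>)\<^sup>2" "cnj ((w - \<i>) / (w + \<i>)) = (v + \<i>) / (v - \<i>)"
      by (simp_all add: v_def)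
    have "1 - (z - \<i>) / (z + \<i>) * ((v + \<i>) / (v - \<i>)) = - 2 * \<i> * (z - v) / ((z + \<i>) * (v - \<i>))"
    proof -
      have num: "(z + \<i>) * (v - \<i>) - (z - \<i>) * (v + \<i>) = - 2 * \<i> * (z - v)"
        by (simp add: algebra_simps)
      have "1 - A / B * (C / E) = (B * E - A * C) / (B * E)" if "B \<noteq> 0" "E \<noteq> 0" for A B C E :: complex
        using that by (simp add: field_simps)
      from this[OF nz(1,2), of "z - \<i>" "v + \<i>"]
      show ?thesis by (simp only: num)
    qed
    then have "1 / (1 - (z - \<i>) / (z + \<i>) * ((v + \<i>) / (v - \<i>)))\<^sup>2
        = - ((z + \<i>)\<^sup>2 * (v - \<i>)\<^sup>2) / (4 * (z - v)\<^sup>2)"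
      by (simp add: power_mult_distrib power_divide)
    then show ?thesis unfolding c K_H_def v_def[symmetric] using nz by (simp add: field_simps)
  qed
  moreover have "of_real (real (Suc m) / pi) * A * B * p ^ m = A * B / of_real pi * (of_nat (Suc m) * p ^ m)"
    for A B p :: complex and m
    by (simp del: of_nat_Suc)
  ultimately show ?thesis by (simp only:)
qed

lemma K_rect_expansion: "(\<lambda>m. disc_basis a L m z * cnj (disc_basis a L m w)) sums K_rect a L z w"
proof (cases "z \<in> rect a L \<and> w \<in> rect a L")
  case True
  then have "Im z > 0" "Im w > 0" by (auto simp: rect_def)
  have "disc_basis a L m z * cnj (disc_basis a L m w)
      = of_real (real (Suc m) / pi) * (2 * \<i> / (z + \<i>)\<^sup>2) * cnj (2 * \<i> / (w + \<i>)\<^sup>2) *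
     (((z - \<i>) / (z + \<i>)) * cnj ((w - \<i>) / (w + \<i>))) ^ m" for m
  proof -
    have "of_real (sqrt (real (Suc m) / pi)) * of_real (sqrt (real (Suc m) / pi))
       = complex_of_real (real (Suc m) / pi)"
      by (simp only: of_real_mult[symmetric] real_sqrt_mult_self) simp
    moreover have "(of_real r * A * p ^ m) * cnj (of_real r * B * q ^ m)
       = (of_real r * of_real r) * A * cnj B * (p * cnj q) ^ m" for r and A B p q :: complex
      by (simp add: power_mult_distrib mult_ac)
    ultimately show ?thesis using True by (simp only: disc_basis_def indicator_simps mult_1 simp_thms)
  qed
  then show ?thesis using K_H_expansion[OF \<open>Im z > 0\<close> \<open>Im w > 0\<close>] True by (simp add: K_rect_def)
qed (auto simp: disc_basis_def K_rect_def)

text \<open>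
  The same series is used at \<open>q = exp (2 \<i> s)\<close> with \<open>s = \<pi> (z - cnj w) / L\<close>, where
  \<open>q / (1 - q)\<^sup>2 = - 1 / (4 (sin s)\<^sup>2)\<close>.
\<close>

lemma K_per_expansion:
  assumes L: "L > 0"
  shows "(\<lambda>j. per_basis a L j z * cnj (per_basis a L j w)) sums K_per a L z w"
proof (cases "z \<in> rect a L \<and> w \<in> rect a L")
  case True
  define s where "s = of_real (pi / L) * (z - cnj w)"
  define q where "q = exp (2 * \<i> * s)"
  have Ims: "Im s > 0" using True L by (auto simp: s_def rect_def intro!: mult_pos_pos)
  then have "cmod q < 1" by (simp add: q_def)
  have q1: "q \<noteq> 1" using \<open>cmod q < 1\<close> by auto
  have eq: "per_basis a L j z * cnj (per_basis a L j w) = of_real (4 * pi / L\<^sup>2) * q * (of_nat (Suc j) * q ^ j)" for j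
  proof -
    have "cnj (exp (\<i> * of_real (freq L j) * w)) = exp (- (\<i> * of_real (freq L j) * cnj w))"
      by (subst exp_cnj) simp
    moreover have "\<i> * of_real (freq L j) * z + - (\<i> * of_real (freq L j) * cnj w) = of_nat (Suc j) * (2 * \<i> * s)"
      unfolding freq_def s_def by (simp add: diff_divide_distrib algebra_simps)
    ultimately have "exp (\<i> * of_real (freq L j) * z) * cnj (exp (\<i> * of_real (freq L j) * w)) = exp (of_nat (Suc j) * (2 * \<i> * s))"
      by (simp only: exp_add[symmetric])
    also have "\<dots> = q ^ Suc j" unfolding q_def by (rule exp_of_nat_mult)
    finally have e: "exp (\<i> * of_real (freq L j) * z) * cnj (exp (\<i> * of_real (freq L j) * w)) = q ^ Suc j" .
    have f: "of_real (sqrt (2 * freq L j / L)) * of_real (sqrt (2 * freq L j / L))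
       = complex_of_real (2 * freq L j / L)"
      using L by (simp only: of_real_mult[symmetric] real_sqrt_mult_self) (simp add: freq_def)
    have "per_basis a L j z * cnj (per_basis a L j w)
       = (of_real (sqrt (2 * freq L j / L)) * of_real (sqrt (2 * freq L j / L))) *
         (exp (\<i> * of_real (freq L j) * z) * cnj (exp (\<i> * of_real (freq L j) * w)))"
      using True by (simp add: per_basis_def mult_ac)
    also have "\<dots> = of_real (4 * pi / L\<^sup>2) * q * (of_nat (Suc j) * q ^ j)"
      unfolding e f by (simp add: freq_def power2_eq_square field_simps)
    finally show ?thesis .
  qed
  define E F where "E = exp (\<i> * s)" and "F = exp (- (\<i> * s))"
  have EF: "E * F = 1" by (simp add: E_def F_def exp_add[symmetric])
  have qE: "q = E * E" by (simp add: q_def E_def exp_add[symmetric] mult.assoc)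
  have "sin s = (E - F) / (2 * \<i>)" by (simp add: sin_exp_eq E_def F_def)
  then have "- 4 * q * (sin s)\<^sup>2 = (E * (E - F))\<^sup>2"
    by (simp add: qE power_divide power_mult_distrib power2_eq_square[of E])
  also have "E * (E - F) = q - 1" by (simp add: right_diff_distrib EF qE)
  finally have "- 4 * q * (sin s)\<^sup>2 = (1 - q)\<^sup>2" by (simp add: power2_commute)
  then have sq: "(1 - q)\<^sup>2 = - 4 * q * (sin s)\<^sup>2" by simp
  have "q \<noteq> 0" by (simp add: q_def)
  then have "q * (1 / (1 - q)\<^sup>2) = - 1 / (4 * (sin s)\<^sup>2)" unfolding sq by simp
  then have "of_real (4 * pi / L\<^sup>2) * q * (1 / (1 - q)\<^sup>2) = of_real (4 * pi / L\<^sup>2) * (- 1 / (4 * (sin s)\<^sup>2))"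
    by (simp only: mult.assoc)
  also have "\<dots> = - of_real (pi / L\<^sup>2) / (sin s)\<^sup>2" by simp
  also have "\<dots> = K_per a L z w"
    using True unfolding K_per_def s_def by (simp only: indicator_simps mult_1 simp_thms)
  finally have "of_real (4 * pi / L\<^sup>2) * q * (1 / (1 - q)\<^sup>2) = K_per a L z w" .
  then show ?thesis unfolding eq
    using sums_mult[OF geometric_deriv_sums[OF \<open>cmod q < 1\<close>], of "of_real (4 * pi / L\<^sup>2) * q"] by simp
qed (auto simp: per_basis_def K_per_def)

text \<open>
  One has \<open>|sin s|\<^sup>2 = (sin (Re s))\<^sup>2 + (sinh (Im s))\<^sup>2\<close>, and \<open>sin x \<ge> x / 2\<close> on \<open>[0, \<pi>/2]\<close>.
\<close>

lemma norm_sin_ge: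
  assumes "\<bar>Re s\<bar> \<le> pi / 2"
  shows "(cmod (sin s))\<^sup>2 \<ge> (Re s)\<^sup>2 / 4 + (Im s)\<^sup>2"
proof -
  have half: "x / 2 \<le> sin x" if "0 \<le> x" "x \<le> pi / 2" for x :: real
  proof -
    have "sin (pi/6) = 1/2" by (rule sin_30)
    show ?thesis
    proof (cases "x \<le> pi / 3")
      case True
      define f where "f = (\<lambda>t :: real. sin t - t / 2)"
      have "f 0 \<le> f x"
      proof (rule DERIV_nonneg_imp_nondecreasing[OF that(1)])
        fix t assume t: "0 \<le> t" "t \<le> x"
        have "cos (pi/3) \<le> cos t" using t True by (intro cos_monotone_0_pi_le) auto
        then show "\<exists>d. (f has_real_derivative d) (at t) \<and> 0 \<le> d"
          unfolding f_def by (intro exI[of _ "cos t - 1/2"]) (auto intro!: derivative_eq_intros simp: cos_60)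
      qed
      then show ?thesis by (simp add: f_def)
    next
      case False
      have "sin (pi/3) \<le> sin x" using False that by (intro sin_monotone_2pi_le) auto
      moreover have "sin (pi/3) = sqrt 3 / 2" by (rule sin_60)
      moreover have "sqrt 3 \<ge> 1.7" by (rule real_le_rsqrt) (simp add: power2_eq_square)
      moreover have "pi < 3.2" using pi_approx by simp
      ultimately show ?thesis using that by simp
    qed
  qed
  have "\<bar>Re s\<bar> / 2 \<le> \<bar>sin (Re s)\<bar>"
    using half[of "\<bar>Re s\<bar>"] assms by (cases "Re s \<ge> 0") auto
  then have sx: "(Re s)\<^sup>2 / 4 \<le> (sin (Re s))\<^sup>2"
    using power_mono[of "\<bar>Re s\<bar> / 2" "\<bar>sin (Re s)\<bar>" 2] by (simp add: power_divide)
  have sh: "\<bar>y\<bar> \<le> \<bar>sinh y\<bar>" for y :: real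
  proof -
    have "y \<le> sinh y" if "y \<ge> 0" for y :: real
    proof -
      have "sinh 0 - 0 \<le> sinh y - y"
      proof (rule DERIV_nonneg_imp_nondecreasing[OF that, of "\<lambda>y. sinh y - y"])
        fix t :: real
        show "\<exists>d. ((\<lambda>y. sinh y - y) has_real_derivative d) (at t) \<and> 0 \<le> d"
          by (intro exI[of _ "cosh t - 1"]) (auto intro!: derivative_eq_intros simp: cosh_real_ge_1)
      qed
      then show ?thesis by simp
    qed
    from this[of y] this[of "- y"] show ?thesis by (cases "y \<ge> 0") auto
  qed
  have "(cmod (sin s))\<^sup>2 = (sin (Re s))\<^sup>2 + (sinh (Im s))\<^sup>2"
  proof -
    have "exp (2 * Im s) + inverse (exp (2 * Im s)) = 4 * (sinh (Im s))\<^sup>2 + 2"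
      by (simp add: sinh_def power2_eq_square algebra_simps exp_add[symmetric] exp_minus[symmetric]) 
    then show ?thesis unfolding norm_sin_squared
      using cos_double_sin[of "Re s"] by (simp add: power2_eq_square)
  qed
  moreover have "(Im s)\<^sup>2 \<le> (sinh (Im s))\<^sup>2" using sh[of "Im s"] by (simp add: abs_le_square_iff)
  ultimately show ?thesis using sx by simp
qed

text \<open>
  The singularity at \<open>0\<close> cancels: by Taylor's theorem \<open>sin s - s\<close> is of third and \<open>sin s + s\<close> of first order,
  and the denominator \<open>s\<^sup>2 (sin s)\<^sup>2\<close> is bounded below by a multiple of \<open>|s|\<^sup>4\<close>.
\<close>

lemma csc_squared_minus_inverse_squared:
  assumes "\<bar>Re s\<bar> \<le> pi / 2" "\<bar>Im s\<bar> \<le> 1" "s \<noteq> 0"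
  shows "cmod (1 / (sin s)\<^sup>2 - 1 / s\<^sup>2) \<le> 200"
proof -
  let ?n = "cmod s"
  have n0: "?n > 0" using assms by simp
  have n2: "?n\<^sup>2 \<le> 4"
  proof -
    have "\<bar>Re s\<bar> \<le> 1.6" using assms(1) pi_approx by simp
    then have "(Re s)\<^sup>2 \<le> 1.6\<^sup>2" by (subst abs_le_square_iff[symmetric]) simp
    moreover have "(Im s)\<^sup>2 \<le> 1\<^sup>2" using assms(2) by (subst abs_le_square_iff[symmetric]) simp
    ultimately show ?thesis unfolding cmod_power2 by (simp add: power2_eq_square)
  qed
  have low: "(cmod (sin s))\<^sup>2 \<ge> ?n\<^sup>2 / 4"
  proof -
    have "u / 4 + v \<le> w \<Longrightarrow> 0 \<le> v \<Longrightarrow> (u + v) / 4 \<le> w" for u v w :: real by simp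
    from this[OF norm_sin_ge[OF assms(1)]] show ?thesis by (simp only: cmod_power2 zero_le_power2)
  qed
  have "cmod (sin s - (\<Sum>k\<le>2. complex_of_real (sin_coeff k) * s ^ k)) \<le> exp \<bar>Im s\<bar> * ?n ^ 3 / 2"
    using Taylor_sin[of s 2] by (simp add: eval_nat_numeral)
  also have "\<dots> \<le> 3 * ?n ^ 3 / 2"
  proof -
    have "exp \<bar>Im s\<bar> \<le> exp 1" using assms(2) by simp
    also have "exp (1 :: real) \<le> 3" by (rule exp_le)
    finally show ?thesis by (intro divide_right_mono mult_right_mono) auto
  qed
  finally have d: "cmod (sin s - s) \<le> 3/2 * ?n ^ 3"
    by (simp add: numeral_2_eq_2 sin_coeff_def)
  have "cmod (sin s + s) \<le> cmod (sin s - s) + cmod (2 * s)"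
    using norm_triangle_ineq[of "sin s - s" "2 * s"] by (simp add: add.commute)
  also have "\<dots> \<le> 3/2 * ?n ^ 3 + 2 * ?n" using d by (simp add: norm_mult)
  also have "\<dots> = ?n * (3/2 * ?n\<^sup>2 + 2)" by (simp add: power2_eq_square power3_eq_cube algebra_simps)
  also have "\<dots> \<le> ?n * 8" using n2 by (intro mult_left_mono) auto
  finally have p: "cmod (sin s + s) \<le> ?n * 8" .
  have s0: "sin s \<noteq> 0" using low n0 by auto
  have "1 / (sin s)\<^sup>2 - 1 / s\<^sup>2 = - ((sin s - s) * (sin s + s)) / ((sin s)\<^sup>2 * s\<^sup>2)"
    using s0 assms(3) by (simp add: field_simps power2_eq_square)
  then have "cmod (1 / (sin s)\<^sup>2 - 1 / s\<^sup>2) = cmod (sin s - s) * cmod (sin s + s) / ((cmod (sin s))\<^sup>2 * ?n\<^sup>2)"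
    by (simp add: norm_divide norm_mult norm_power)
  also have "\<dots> \<le> (3/2 * ?n ^ 3) * (?n * 8) / ((?n\<^sup>2 / 4) * ?n\<^sup>2)"
    using n0 low d p by (intro frac_le mult_mono mult_pos_pos) auto
  also have "\<dots> = 48" using n0 by (simp add: power2_eq_square power3_eq_cube)
  finally show ?thesis by simp
qed


section \<open>Bounds for the two kernels\<close>

lemma K_H_bound:
  assumes "1 \<le> Im z" "1 \<le> Im w"
  shows "cmod (K_H z w) \<le> 1 / (pi * ((Re z - Re w)\<^sup>2 + 4))"
    and "cmod (K_H z w) \<le> 2 / (1 + (Re z - Re w)\<^sup>2)"
proof -
  have "2\<^sup>2 \<le> (Im z + Im w)\<^sup>2" using assms by (intro power_mono) auto
  then have le: "(Re z - Re w)\<^sup>2 + 4 \<le> (cmod (z - cnj w))\<^sup>2" unfolding cmod_power2 by simp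
  have pos: "0 < (Re z - Re w)\<^sup>2 + 4" by (simp add: add_nonneg_pos)
  have "cmod (K_H z w) = 1 / (pi * (cmod (z - cnj w))\<^sup>2)"
    by (simp add: K_H_def norm_divide norm_mult norm_power)
  also have "\<dots> \<le> 1 / (pi * ((Re z - Re w)\<^sup>2 + 4))"
    using pos le by (intro divide_left_mono mult_left_mono mult_pos_pos) auto
  finally show 1: "cmod (K_H z w) \<le> 1 / (pi * ((Re z - Re w)\<^sup>2 + 4))" .
  have "1 * (1 + (Re z - Re w)\<^sup>2) \<le> pi * ((Re z - Re w)\<^sup>2 + 4)"
    using pi_ge_two by (intro mult_mono) auto
  then have "1 / (pi * ((Re z - Re w)\<^sup>2 + 4)) \<le> 1 / (1 + (Re z - Re w)\<^sup>2)"
    using pos by (intro divide_left_mono) (auto simp: add_pos_nonneg intro!: mult_pos_pos)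
  also have "\<dots> \<le> 2 / (1 + (Re z - Re w)\<^sup>2)" by (intro divide_right_mono) auto
  finally show "cmod (K_H z w) \<le> 2 / (1 + (Re z - Re w)\<^sup>2)" using 1 by simp
qed

definition csc_kernel :: "real \<Rightarrow> complex \<Rightarrow> complex \<Rightarrow> complex" where
  "csc_kernel L z w = - of_real (pi / L\<^sup>2) / (sin (of_real (pi / L) * (z - cnj w)))\<^sup>2"

lemma K_per_csc: "K_per a L z w = indicator (rect a L) z * indicator (rect a L) w * csc_kernel L z w"
  by (simp add: K_per_def csc_kernel_def)

lemma csc_kernel_periodic:
  assumes "L > 0"
  shows "csc_kernel L (z - of_real L) w = csc_kernel L z w" "csc_kernel L (z + of_real L) w = csc_kernel L z w"
proof -
  have "of_real (pi / L) * (z - of_real L - cnj w) = of_real (pi / L) * (z - cnj w) - of_real pi"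
    "of_real (pi / L) * (z + of_real L - cnj w) = of_real (pi / L) * (z - cnj w) + of_real pi"
    using assms by (simp_all add: field_simps)
  then show "csc_kernel L (z - of_real L) w = csc_kernel L z w" "csc_kernel L (z + of_real L) w = csc_kernel L z w"
    unfolding csc_kernel_def by (simp_all only: sin_minus_pi sin_plus_pi sin_diff sin_add sin_of_real cos_of_real) auto
qed

lemma abs_scaled_le_half_pi:
  fixes t :: real
  assumes "L > 0" "\<bar>t\<bar> \<le> L / 2"
  shows "\<bar>pi / L * t\<bar> \<le> pi / 2"
proof -
  have "\<bar>pi / L * t\<bar> = pi / L * \<bar>t\<bar>" using assms by (simp add: abs_mult)
  also have "\<dots> \<le> pi / L * (L / 2)" using assms by (intro mult_left_mono) auto
  finally show ?thesis using assms by simp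
qed

text \<open>
  Up to half a period the periodic kernel obeys the same bound as \<open>K_H\<close>; beyond that, the bound applies to
  its translate by one period.
\<close>

lemma csc_kernel_bound:
  assumes L: "L > 0" and z: "1 \<le> Im z" "1 \<le> Im w" and t: "\<bar>Re z - Re w\<bar> \<le> L / 2"
  shows "cmod (csc_kernel L z w) \<le> 2 / (1 + (Re z - Re w)\<^sup>2)"
proof -
  define s where "s = of_real (pi / L) * (z - cnj w)"
  define u where "u = (Re z - Re w)\<^sup>2"
  have Re: "Re s = pi / L * (Re z - Re w)" and Im: "Im s = pi / L * (Im z + Im w)"
    by (simp_all add: s_def)
  have "\<bar>Re s\<bar> \<le> pi / 2" unfolding Re by (rule abs_scaled_le_half_pi[OF L t])
  from norm_sin_ge[OF this] have low: "(pi / L)\<^sup>2 * u / 4 + (pi / L)\<^sup>2 * (Im z + Im w)\<^sup>2 \<le> (cmod (sin s))\<^sup>2"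
    unfolding Re Im power_mult_distrib u_def .
  have "2\<^sup>2 \<le> (Im z + Im w)\<^sup>2" using z by (intro power_mono) auto
  then have "(pi / L)\<^sup>2 * 4 \<le> (pi / L)\<^sup>2 * (Im z + Im w)\<^sup>2" by (intro mult_left_mono) auto
  with low have low: "(pi / L)\<^sup>2 * (u / 4 + 4) \<le> (cmod (sin s))\<^sup>2" by (simp add: algebra_simps)
  have u0: "0 \<le> u" by (simp add: u_def)
  have "cmod (csc_kernel L z w) = pi / L\<^sup>2 / (cmod (sin s))\<^sup>2"
    using L by (simp add: csc_kernel_def s_def norm_divide norm_power norm_mult)
  also have "\<dots> \<le> pi / L\<^sup>2 / ((pi / L)\<^sup>2 * (u / 4 + 4))"
    using L u0 low by (intro divide_left_mono) (auto intro!: mult_pos_pos add_nonneg_pos order.strict_trans2[OF _ low])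
  also have "\<dots> = 1 / (pi * (u / 4 + 4))" using L by (simp add: power2_eq_square)
  also have "\<dots> \<le> 1 / ((1 + u) / 2)"
  proof (rule divide_left_mono)
    have "2 * (u / 4 + 4) \<le> pi * (u / 4 + 4)" using u0 pi_ge_two by (intro mult_right_mono) auto
    then show "(1 + u) / 2 \<le> pi * (u / 4 + 4)" using u0 by simp
  qed (use u0 in \<open>auto intro!: mult_pos_pos\<close>)
  finally show ?thesis by (simp add: u_def)
qed

lemma csc_kernel_bound_far:
  assumes L: "L > 0" and z: "1 \<le> Im z" "1 \<le> Im w" and t: "L / 2 < \<bar>Re z - Re w\<bar>" "\<bar>Re z - Re w\<bar> \<le> L"
  shows "cmod (csc_kernel L z w) \<le> 2 / (1 + (L - \<bar>Re z - Re w\<bar>)\<^sup>2)"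
proof (cases "Re z - Re w > 0")
  case True
  have "cmod (csc_kernel L (z - of_real L) w) \<le> 2 / (1 + (Re (z - of_real L) - Re w)\<^sup>2)"
    by (rule csc_kernel_bound) (use assms True in auto)
  moreover have "(Re (z - of_real L) - Re w)\<^sup>2 = (L - \<bar>Re z - Re w\<bar>)\<^sup>2"
    using True by (simp add: power2_eq_square algebra_simps)
  ultimately show ?thesis using csc_kernel_periodic[OF L] by simp
next
  case False
  have "cmod (csc_kernel L (z + of_real L) w) \<le> 2 / (1 + (Re (z + of_real L) - Re w)\<^sup>2)"
    by (rule csc_kernel_bound) (use assms False in auto)
  moreover have "(Re (z + of_real L) - Re w)\<^sup>2 = (L - \<bar>Re z - Re w\<bar>)\<^sup>2"
    using False by (simp add: power2_eq_square algebra_simps)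
  ultimately show ?thesis using csc_kernel_periodic[OF L] by simp
qed

lemma kernel_difference_near:
  assumes L: "L \<ge> 2 * pi * a" "a > 0" and z: "1 \<le> Im z" "1 \<le> Im w" "Im z \<le> a" "Im w \<le> a"
    and t: "\<bar>Re z - Re w\<bar> \<le> L / 2"
  shows "cmod (K_H z w - csc_kernel L z w) \<le> 800 / L\<^sup>2"
proof -
  have L0: "L > 0" by (rule less_le_trans[OF _ L(1)]) (use L in simp)
  define s where "s = of_real (pi / L) * (z - cnj w)"
  have Re: "Re s = pi / L * (Re z - Re w)" and Im: "Im s = pi / L * (Im z + Im w)"
    by (simp_all add: s_def)
  have "\<bar>Re s\<bar> \<le> pi / 2" unfolding Re by (rule abs_scaled_le_half_pi[OF L0 t])
  moreover have "\<bar>Im s\<bar> \<le> 1"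
  proof -
    have "pi * (Im z + Im w) \<le> pi * (2 * a)" using z by (intro mult_left_mono) auto
    also have "\<dots> = 2 * pi * a" by simp
    finally have "pi * (Im z + Im w) \<le> L" using L(1) by linarith
    moreover have "0 \<le> pi * (Im z + Im w)" using z by (intro mult_nonneg_nonneg) auto
    ultimately show ?thesis using L0 by (simp add: Im)
  qed
  moreover have s0: "s \<noteq> 0"
  proof -
    have "Im s > 0" using z L0 by (auto simp: Im intro!: mult_pos_pos)
    then show ?thesis by auto
  qed
  ultimately have b: "cmod (1 / (sin s)\<^sup>2 - 1 / s\<^sup>2) \<le> 200"
    by (rule csc_squared_minus_inverse_squared)
  have "K_H z w = - of_real (pi / L\<^sup>2) * (1 / s\<^sup>2)"
    using L0 unfolding K_H_def s_def power_mult_distrib by (simp add: power_divide power2_eq_square)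
  moreover have "csc_kernel L z w = - of_real (pi / L\<^sup>2) / (sin s)\<^sup>2"
    by (simp only: csc_kernel_def s_def)
  ultimately have "K_H z w - csc_kernel L z w = of_real (pi / L\<^sup>2) * (1 / (sin s)\<^sup>2 - 1 / s\<^sup>2)"
    by (simp only: right_diff_distrib) simp
  then have "cmod (K_H z w - csc_kernel L z w) = pi / L\<^sup>2 * cmod (1 / (sin s)\<^sup>2 - 1 / s\<^sup>2)"
    by (simp only: norm_mult norm_of_real) simp
  also have "\<dots> \<le> pi / L\<^sup>2 * 200" by (intro mult_left_mono b) auto
  also have "\<dots> \<le> 4 / L\<^sup>2 * 200" using pi_less_4 by (intro mult_right_mono divide_right_mono) auto
  finally show ?thesis by simp
qed

text \<open>
  The product on the right separates the two points, so that its double integral is a product of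
  logarithms.
\<close>

lemma corner_bound:
  fixes p q :: real
  assumes "0 \<le> p" "0 \<le> q"
  shows "1 / (1 + (p + q)\<^sup>2) \<le> 2 / ((1 + p) * (1 + q))"
proof -
  have "(1 + p) * (1 + q) \<le> 2 * (1 + (p + q)\<^sup>2)"
  proof -
    have "0 \<le> (p + q - 1/2)\<^sup>2" "0 \<le> (p - q)\<^sup>2" "0 \<le> p * q" using assms by auto
    then show ?thesis by (simp add: power2_eq_square algebra_simps) 
  qed
  then have "2 / (2 * (1 + (p + q)\<^sup>2)) \<le> 2 / ((1 + p) * (1 + q))"
    using assms by (intro divide_left_mono) (auto intro!: mult_pos_pos add_pos_nonneg)
  moreover have "2 / (2 * y) = 1 / y" for y :: real by simp
  ultimately show ?thesis by (simp only:)
qed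

text \<open>
  If the real parts differ by at most \<open>L / 2\<close>, both kernels are close to each other. Otherwise \<open>K_H\<close> is small
  by itself, and \<open>K_per\<close> is large only where \<open>Re z\<close> and \<open>Re w\<close> are near opposite ends of \<open>[0, L]\<close>;
  the last two terms belong to the two ways in which this happens.
\<close>

lemma kernel_difference_bound:
  assumes L: "L \<ge> 2 * pi * a" "a > 0" and z: "z \<in> rect a L" "w \<in> rect a L"
  shows "cmod (K_rect a L z w - K_per a L z w) \<le> 800 / L\<^sup>2 +
     4 * (1 / (1 + Re z) * (1 / (1 + (L - Re w)))) + 4 * (1 / (1 + (L - Re z)) * (1 / (1 + Re w)))"
    (is "_ \<le> ?A + 4 * ?P + 4 * ?Q")
proof -
  have L0: "L > 0" by (rule less_le_trans[OF _ L(1)]) (use L in simp)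
  have zz: "0 \<le> Re z" "Re z \<le> L" "1 \<le> Im z" "Im z \<le> a" "0 \<le> Re w" "Re w \<le> L" "1 \<le> Im w" "Im w \<le> a"
    using z by (auto simp: rect_def)
  have PQ: "0 \<le> ?P" "0 \<le> ?Q" using zz by auto
  have eq: "K_rect a L z w - K_per a L z w = K_H z w - csc_kernel L z w"
    using z by (simp add: K_rect_def K_per_csc)
  show ?thesis
  proof (cases "\<bar>Re z - Re w\<bar> \<le> L / 2")
    case True
    show ?thesis unfolding eq using kernel_difference_near[OF L zz(3,7,4,8) True] PQ by linarith
  next
    case False
    then have t: "L / 2 < \<bar>Re z - Re w\<bar>" "\<bar>Re z - Re w\<bar> \<le> L" using zz by auto
    have "cmod (K_H z w) \<le> 1 / (pi * ((Re z - Re w)\<^sup>2 + 4))" by (rule K_H_bound(1)) (use zz in auto)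
    also have "\<dots> \<le> 1 / (L\<^sup>2 / 4)"
    proof (rule divide_left_mono)
      have "(L / 2)\<^sup>2 \<le> \<bar>Re z - Re w\<bar>\<^sup>2" using t L0 by (intro power_mono) auto
      then have "1 * (L\<^sup>2 / 4) \<le> pi * ((Re z - Re w)\<^sup>2 + 4)"
        using pi_ge_two by (intro mult_mono) (auto simp: power_divide)
      then show "L\<^sup>2 / 4 \<le> pi * ((Re z - Re w)\<^sup>2 + 4)" by simp
    qed (use L0 in \<open>auto intro!: mult_pos_pos add_nonneg_pos\<close>)
    also have "\<dots> \<le> 800 / L\<^sup>2" using L0 by (simp add: field_simps)
    finally have k: "cmod (K_H z w) \<le> 800 / L\<^sup>2" .
    have c: "cmod (csc_kernel L z w) \<le> 2 / (1 + (L - \<bar>Re z - Re w\<bar>)\<^sup>2)"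
      by (rule csc_kernel_bound_far[OF L0 zz(3,7) t])
    have "1 / (1 + (L - \<bar>Re z - Re w\<bar>)\<^sup>2) \<le> 2 * ?P + 2 * ?Q"
    proof (cases "Re w \<le> Re z")
      case True
      then have "1 / (1 + (L - \<bar>Re z - Re w\<bar>)\<^sup>2) \<le> 2 * ?Q"
        using corner_bound[of "L - Re z" "Re w"] zz by (simp add: algebra_simps)
      then show ?thesis using PQ by linarith
    next
      case False
      then have "1 / (1 + (L - \<bar>Re z - Re w\<bar>)\<^sup>2) \<le> 2 * ?P"
        using corner_bound[of "Re z" "L - Re w"] zz by (simp add: algebra_simps)
      then show ?thesis using PQ by linarith
    qed
    then have c': "cmod (csc_kernel L z w) \<le> 4 * ?P + 4 * ?Q" using c by simp
    show ?thesis unfolding eq using norm_triangle_ineq4[of "K_H z w" "csc_kernel L z w"] k c' by linarith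
  qed
qed


lemma K_rect_mercer:
  assumes "1 \<le> a" "0 \<le> L"
  shows "mercer_kernel area_H (rect a L) 2 (disc_basis a L) (K_rect a L)"
proof (intro mercer_kernel.intro mercer_kernel_axioms.intro)
  show "disc_basis a L m \<in> borel_measurable area_H" for m
    unfolding disc_basis_def by (rule measurable_area_H) measurable
  show "cmod (K_rect a L z z) \<le> 2" for z
  proof (cases "z \<in> rect a L")
    case True
    then have "1 \<le> Im z" by (simp add: rect_def)
    from K_H_bound(2)[OF this this] True show ?thesis by (simp add: K_rect_def)
  qed (simp add: K_rect_def)
  show "z \<notin> rect a L \<Longrightarrow> disc_basis a L m z = 0" for z m by (simp add: disc_basis_def)
qed (auto simp: sigma_finite_area_H rect_sets_area_H emeasure_rect[OF assms] K_rect_expansion simp del: complex_cnj_mult)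

lemma K_per_mercer:
  assumes "1 \<le> a" "0 < L"
  shows "mercer_kernel area_H (rect a L) 2 (per_basis a L) (K_per a L)"
proof (intro mercer_kernel.intro mercer_kernel_axioms.intro)
  show "per_basis a L m \<in> borel_measurable area_H" for m
    unfolding per_basis_def by (rule measurable_area_H) measurable
  show "cmod (K_per a L z z) \<le> 2" for z
  proof (cases "z \<in> rect a L")
    case True
    then have "1 \<le> Im z" by (simp add: rect_def)
    from csc_kernel_bound[OF assms(2) this this] True assms(2) show ?thesis by (simp add: K_per_csc)
  qed (simp add: K_per_csc)
  show "z \<notin> rect a L \<Longrightarrow> per_basis a L m z = 0" for z m by (simp add: per_basis_def)
qed (use assms in \<open>auto simp: sigma_finite_area_H rect_sets_area_H emeasure_rect K_per_expansion\<close>)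

lemma nn_integral_Cauchy_rect:
  assumes "1 \<le> a" "0 \<le> L"
  shows "(\<integral>\<^sup>+z. ennreal (2 / (1 + (Re z - c)\<^sup>2)) * indicator (rect a L) z \<partial>area_H) \<le> ennreal (2 * pi * (a - 1))"
proof -
  have "(\<integral>\<^sup>+z. ennreal (2 / (1 + (Re z - c)\<^sup>2)) * indicator (rect a L) z \<partial>area_H)
      = ennreal (a - 1) * (\<integral>\<^sup>+x. ennreal (2 / (1 + (x - c)\<^sup>2)) * indicator {0..L} x \<partial>lborel)"
    by (rule nn_integral_rect_Re) (use assms in auto)
  also have "(\<integral>\<^sup>+x. ennreal (2 / (1 + (x - c)\<^sup>2)) * indicator {0..L} x \<partial>lborel)
     = (\<integral>\<^sup>+x. ennreal 2 * (ennreal (1 / (1 + (x - c)\<^sup>2)) * indicator {0..L} x) \<partial>lborel)"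
    by (intro nn_integral_cong) (simp add: ennreal_mult[symmetric] mult.assoc[symmetric] del: ennreal_numeral)
  also have "\<dots> = ennreal 2 * (\<integral>\<^sup>+x. ennreal (1 / (1 + (x - c)\<^sup>2)) * indicator {0..L} x \<partial>lborel)"
    by (rule nn_integral_cmult) measurable
  also have "ennreal (a - 1) * \<dots> \<le> ennreal (a - 1) * (ennreal 2 * ennreal pi)"
    by (intro mult_left_mono nn_integral_Cauchy_le assms) auto
  also have "\<dots> = ennreal (2 * pi * (a - 1))"
    using assms by (simp add: ennreal_mult[symmetric] mult_ac del: ennreal_numeral)
  finally show ?thesis .
qed

lemma K_rect_rows:
  assumes "1 \<le> a" "0 \<le> L"
  shows "(\<integral>\<^sup>+w. cmod (K_rect a L z w) \<partial>area_H) \<le> ennreal (6 * pi * (a - 1))"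
proof -
  have "(\<integral>\<^sup>+w. cmod (K_rect a L z w) \<partial>area_H)
     \<le> (\<integral>\<^sup>+w. ennreal (2 / (1 + (Re w - Re z)\<^sup>2)) * indicator (rect a L) w \<partial>area_H)"
  proof (rule nn_integral_mono)
    fix w
    show "ennreal (cmod (K_rect a L z w)) \<le> ennreal (2 / (1 + (Re w - Re z)\<^sup>2)) * indicator (rect a L) w"
    proof (cases "z \<in> rect a L \<and> w \<in> rect a L")
      case True
      then show ?thesis using K_H_bound(2)[of z w]
        by (auto simp: K_rect_def rect_def power2_commute[of "Re z"] intro!: ennreal_leI)
    qed (auto simp: K_rect_def)
  qed
  also have "\<dots> \<le> ennreal (2 * pi * (a - 1))" by (rule nn_integral_Cauchy_rect[OF assms])
  also have "\<dots> \<le> ennreal (6 * pi * (a - 1))" using assms by (intro ennreal_leI mult_right_mono) auto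
  finally show ?thesis .
qed

text \<open>
  The three summands in the proof belong to the kernel itself and to its translates by one period to
  the left and to the right.
\<close>

lemma K_per_columns:
  assumes "1 \<le> a" "0 < L"
  shows "(\<integral>\<^sup>+z. cmod (K_per a L z w) \<partial>area_H) \<le> ennreal (6 * pi * (a - 1))"
proof -
  let ?f = "\<lambda>c z. ennreal (2 / (1 + (Re z - c)\<^sup>2)) * indicator (rect a L) z"
  let ?x = "Re w"
  have m: "?f c \<in> borel_measurable area_H" for c
    by (rule measurable_area_H) measurable
  have "(\<integral>\<^sup>+z. cmod (K_per a L z w) \<partial>area_H) \<le> (\<integral>\<^sup>+z. ?f ?x z + (?f (?x + L) z + ?f (?x - L) z) \<partial>area_H)"
  proof (rule nn_integral_mono)
    fix z
    show "ennreal (cmod (K_per a L z w)) \<le> ?f ?x z + (?f (?x + L) z + ?f (?x - L) z)"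
    proof (cases "z \<in> rect a L \<and> w \<in> rect a L")
      case True
      then have zz: "1 \<le> Im z" "1 \<le> Im w" "\<bar>Re z - Re w\<bar> \<le> L" by (auto simp: rect_def)
      let ?g = "\<lambda>c. 2 / (1 + (Re z - c)\<^sup>2)"
      have nn: "0 \<le> ?g c" for c by auto
      have "cmod (csc_kernel L z w) \<le> ?g ?x + (?g (?x + L) + ?g (?x - L))"
      proof (cases "\<bar>Re z - Re w\<bar> \<le> L / 2")
        case True
        show ?thesis using csc_kernel_bound[OF assms(2) zz(1,2) True] nn[of "?x + L"] nn[of "?x - L"] by linarith
      next
        case False
        have "cmod (csc_kernel L z w) \<le> 2 / (1 + (L - \<bar>Re z - Re w\<bar>)\<^sup>2)"
          by (rule csc_kernel_bound_far) (use assms zz False in auto)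
        moreover have "(L - \<bar>Re z - Re w\<bar>)\<^sup>2 = (Re z - (?x + L))\<^sup>2 \<or> (L - \<bar>Re z - Re w\<bar>)\<^sup>2 = (Re z - (?x - L))\<^sup>2"
          by (cases "Re z \<ge> Re w") (auto simp: power2_eq_square algebra_simps)
        ultimately have "cmod (csc_kernel L z w) \<le> ?g (?x + L) \<or> cmod (csc_kernel L z w) \<le> ?g (?x - L)"
          by metis
        then show ?thesis using nn[of "?x + L"] nn[of "?x - L"] nn[of ?x] by linarith
      qed
      then show ?thesis using True nn
        by (simp add: K_per_csc ennreal_plus[symmetric] ennreal_leI del: ennreal_plus)
    qed (auto simp: K_per_csc)
  qed
  also have "\<dots> = (\<integral>\<^sup>+z. ?f ?x z \<partial>area_H) + ((\<integral>\<^sup>+z. ?f (?x + L) z \<partial>area_H) + (\<integral>\<^sup>+z. ?f (?x - L) z \<partial>area_H))"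
    using m by (simp only: nn_integral_add borel_measurable_add)
  also have "\<dots> \<le> ennreal (2 * pi * (a - 1)) + (ennreal (2 * pi * (a - 1)) + ennreal (2 * pi * (a - 1)))"
    using assms by (intro add_mono nn_integral_Cauchy_rect) auto
  also have "\<dots> = ennreal (6 * pi * (a - 1))"
    using assms by (simp add: ennreal_plus[symmetric] del: ennreal_plus)
  finally show ?thesis .
qed

lemma rect_kernel_pair:
  assumes "1 \<le> a" "0 < L"
  shows "mercer_kernel_pair area_H (rect a L) 2 (disc_basis a L) (per_basis a L) (K_rect a L) (K_per a L) (6 * pi * (a - 1))"
  using assms by (intro mercer_kernel_pair.intro mercer_kernel_pair_axioms.intro K_rect_mercer K_per_mercer
      K_rect_rows K_per_columns) auto

lemma nn_integral_three_products:
  fixes F1 G1 :: "'b \<Rightarrow> ennreal"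
  assumes "F1 \<in> borel_measurable M" "G1 \<in> borel_measurable M" "F2 \<in> borel_measurable M"
    "G2 \<in> borel_measurable M" "F3 \<in> borel_measurable M" "G3 \<in> borel_measurable M"
  shows "(\<integral>\<^sup>+z. \<integral>\<^sup>+w. F1 z * G1 w + (F2 z * G2 w + F3 z * G3 w) \<partial>M \<partial>M)
    = (\<integral>\<^sup>+z. F1 z \<partial>M) * (\<integral>\<^sup>+z. G1 z \<partial>M) + ((\<integral>\<^sup>+z. F2 z \<partial>M) * (\<integral>\<^sup>+z. G2 z \<partial>M) + (\<integral>\<^sup>+z. F3 z \<partial>M) * (\<integral>\<^sup>+z. G3 z \<partial>M))"
  using assms by (simp add: nn_integral_add nn_integral_cmult nn_integral_multc)

text \<open>
  The bound \<open>800 / L\<^sup>2\<close> is integrated over a region of measure \<open>((a - 1) L)\<^sup>2\<close>, and each corner term gives the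
  square of \<open>\<integral>\<^sub>0\<^sup>L 1 / (1 + x) dx = ln (1 + L)\<close>.
\<close>

lemma dist_L1_le:
  assumes a: "1 \<le> a" and L: "L \<ge> 2 * pi * a"
  shows "(\<integral>\<^sup>+z. \<integral>\<^sup>+w. cmod (K_rect a L z w - K_per a L z w) \<partial>area_H \<partial>area_H)
     \<le> ennreal ((a - 1)\<^sup>2 * (800 + 8 * (ln (1 + L))\<^sup>2))"
proof -
  have L0: "L > 0" by (rule less_le_trans[OF _ L(1)]) (use a in simp)
  define lift where "lift c f z = ennreal (c * f (Re z)) * indicator (rect a L) z"
    for c and f :: "real \<Rightarrow> real" and z :: complex
  define p q where "p = (\<lambda>x :: real. 1 / (1 + x))" and "q = (\<lambda>x. 1 / (1 + (L - x)))"
  have mm [measurable]: "p \<in> borel_measurable borel" "q \<in> borel_measurable borel"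
    unfolding p_def q_def by measurable
  have m: "lift c f \<in> borel_measurable area_H" if [measurable]: "f \<in> borel_measurable borel" for c f
    unfolding lift_def by (rule measurable_area_H) measurable
  have I: "(\<integral>\<^sup>+z. lift c f z \<partial>area_H) = ennreal (c * (a - 1) * r)"
    if [measurable]: "f \<in> borel_measurable borel" and r: "0 \<le> r" "(\<integral>\<^sup>+x. ennreal (f x) * indicator {0..L} x \<partial>lborel) = ennreal r"
      and c: "0 \<le> c" for c f r
  proof -
    have "(\<integral>\<^sup>+z. lift c f z \<partial>area_H) = ennreal (a - 1) * (\<integral>\<^sup>+x. ennreal (c * f x) * indicator {0..L} x \<partial>lborel)"
      unfolding lift_def by (rule nn_integral_rect_Re) (use a in auto)
    also have "(\<integral>\<^sup>+x. ennreal (c * f x) * indicator {0..L} x \<partial>lborel) = (\<integral>\<^sup>+x. ennreal c * (ennreal (f x) * indicator {0..L} x) \<partial>lborel)"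
      using c by (intro nn_integral_cong) (simp add: ennreal_mult' mult.assoc)
    also have "\<dots> = ennreal c * ennreal r" by (subst nn_integral_cmult) (use r in auto)
    finally show ?thesis using a c r by (simp add: ennreal_mult[symmetric] mult_ac)
  qed
  have I1: "(\<integral>\<^sup>+z. lift c (\<lambda>_. 1) z \<partial>area_H) = ennreal (c * (a - 1) * L)" if "0 \<le> c" for c
    by (rule I) (use that L0 in auto)
  have l0: "0 \<le> ln (1 + L)" using L0 by simp
  have Ip: "(\<integral>\<^sup>+z. lift c p z \<partial>area_H) = ennreal (c * (a - 1) * ln (1 + L))"
    and Iq: "(\<integral>\<^sup>+z. lift c q z \<partial>area_H) = ennreal (c * (a - 1) * ln (1 + L))" if "0 \<le> c" for c
    using that nn_integral_inverse_linear[of L] nn_integral_inverse_linear'[of L] L0 l0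
    by (auto intro!: I mm simp: p_def q_def)
  have "(\<integral>\<^sup>+z. \<integral>\<^sup>+w. cmod (K_rect a L z w - K_per a L z w) \<partial>area_H \<partial>area_H)
     \<le> (\<integral>\<^sup>+z. \<integral>\<^sup>+w. lift (800 / L\<^sup>2) (\<lambda>_. 1) z * lift 1 (\<lambda>_. 1) w
          + (lift 4 p z * lift 1 q w + lift 4 q z * lift 1 p w) \<partial>area_H \<partial>area_H)"
  proof (intro nn_integral_mono)
    fix z w
    show "ennreal (cmod (K_rect a L z w - K_per a L z w)) \<le> lift (800 / L\<^sup>2) (\<lambda>_. 1) z * lift 1 (\<lambda>_. 1) w
          + (lift 4 p z * lift 1 q w + lift 4 q z * lift 1 p w)"
    proof (cases "z \<in> rect a L \<and> w \<in> rect a L")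
      case True
      then have r: "0 \<le> Re z" "Re z \<le> L" "0 \<le> Re w" "Re w \<le> L" by (auto simp: rect_def)
      then have nn: "0 \<le> p (Re z)" "0 \<le> p (Re w)" "0 \<le> q (Re z)" "0 \<le> q (Re w)"
        by (auto simp: p_def q_def)
      have "cmod (K_rect a L z w - K_per a L z w) \<le> 800 / L\<^sup>2 + (4 * p (Re z) * q (Re w) + 4 * q (Re z) * p (Re w))"
        using kernel_difference_bound[OF L, of z w] a True by (simp add: p_def q_def)
      then have "ennreal (cmod (K_rect a L z w - K_per a L z w))
          \<le> ennreal (800 / L\<^sup>2 + (4 * p (Re z) * q (Re w) + 4 * q (Re z) * p (Re w)))" by (rule ennreal_leI)
      also have "\<dots> = ennreal (800 / L\<^sup>2) + (ennreal (4 * p (Re z)) * ennreal (q (Re w)) + ennreal (4 * q (Re z)) * ennreal (p (Re w)))"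
        using nn L0 by (simp add: ennreal_mult[symmetric] ennreal_plus[symmetric] del: ennreal_plus)
      finally show ?thesis using True by (simp add: lift_def)
    qed (auto simp: K_rect_def K_per_csc)
  qed
  also have "\<dots> = ennreal (800 / L\<^sup>2 * (a - 1) * L) * ennreal (1 * (a - 1) * L) +
     (ennreal (4 * (a - 1) * ln (1 + L)) * ennreal (1 * (a - 1) * ln (1 + L))
    + ennreal (4 * (a - 1) * ln (1 + L)) * ennreal (1 * (a - 1) * ln (1 + L)))"
    by (subst nn_integral_three_products) (simp_all only: m mm borel_measurable_const I1 Ip Iq zero_le_one zero_le_numeral, simp add: I1)
  also have "\<dots> = ennreal ((a - 1)\<^sup>2 * (800 + 8 * (ln (1 + L))\<^sup>2))"
  proof -
    have "800 / L\<^sup>2 * (a - 1) * L * (1 * (a - 1) * L) + (4 * (a - 1) * ln (1 + L) * (1 * (a - 1) * ln (1 + L))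
       + 4 * (a - 1) * ln (1 + L) * (1 * (a - 1) * ln (1 + L))) = (a - 1)\<^sup>2 * (800 + 8 * (ln (1 + L))\<^sup>2)"
      using L0 by (simp add: power2_eq_square field_simps)
    then show ?thesis using a L0 l0 by (simp only: ennreal_mult[symmetric] ennreal_plus[symmetric]
        mult_nonneg_nonneg add_nonneg_nonneg diff_ge_0_iff_ge divide_nonneg_pos zero_le_power2 zero_le_numeral zero_le_one order_less_imp_le zero_less_power)
  qed
  finally show ?thesis .
qed


section \<open>Trace asymptotics\<close>

text \<open>
  The eigenvalue, at frequency \<open>x\<close>, of the rank-one operator on \<open>[1, a]\<close> with kernel
  \<open>2 x exp (- x (y + y'))\<close>.
\<close>

definition symbol :: "real \<Rightarrow> real \<Rightarrow> real" where
  "symbol a x = exp (- 2 * x) - exp (- 2 * a * x)"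

abbreviation rect_trace :: "real \<Rightarrow> real \<Rightarrow> nat \<Rightarrow> real" where
  "rect_trace a L k \<equiv> Re (kernel_trace area_H (K_rect a L) k)"

abbreviation per_trace :: "real \<Rightarrow> real \<Rightarrow> nat \<Rightarrow> real" where
  "per_trace a L k \<equiv> Re (kernel_trace area_H (K_per a L) k)"

text \<open>
  The integral over the rectangle is a product. The real parts contribute orthogonality of the
  exponentials on a full period, the imaginary parts the integral of \<open>exp (- 2 \<xi> y)\<close> over \<open>[1, a]\<close>.
\<close>

lemma per_basis_gram:
  assumes a: "1 \<le> a" and L: "0 < L"
  shows "(\<integral>z. cnj (per_basis a L i z) * per_basis a L j z \<partial>area_H)
           = (if i = j then of_real (symbol a (freq L i)) else 0)"
proof -
  define p where "p = freq L i"
  define q where "q = freq L j"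
  have pq: "p > 0" "q > 0" using L by (auto simp: p_def q_def freq_def)
  define c where "c = sqrt (2 * p / L) * sqrt (2 * q / L)"
  define f where "f x = indicator {0..L} x *\<^sub>R (of_real c * exp (\<i> * of_real ((q - p) * x)))" for x :: real
  define g where "g y = complex_of_real (exp (- (p + q) * y) * indicator {1..a} y)" for y :: real
  have f: "has_bochner_integral lborel f (if i = j then of_real (c * L) else 0)"
  proof (cases "i = j")
    case True
    have "has_bochner_integral lborel f (of_real c * of_real L - of_real c * of_real 0)"
      unfolding f_def using True L
      by (intro has_bochner_integral_FTC_Icc)
         (auto simp: p_def q_def intro!: derivative_eq_intros has_vector_derivative_real_field)
    then show ?thesis using True by simp
  next
    case False
    then have ne: "q - p \<noteq> 0" using L by (auto simp: p_def q_def freq_def)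
    have "has_bochner_integral lborel f (of_real c * exp (\<i> * of_real ((q - p) * L)) / (\<i> * of_real (q - p))
        - of_real c * exp (\<i> * of_real ((q - p) * 0)) / (\<i> * of_real (q - p)))"
      unfolding f_def
    proof (intro has_bochner_integral_FTC_Icc)
      fix x
      have D: "((\<lambda>z. C * exp (e * z) / e) has_field_derivative C * exp (e * y)) (at y)"
        if "e \<noteq> 0" for C e y :: complex
        using that by (auto intro!: derivative_eq_intros)
      have "\<i> * complex_of_real (q - p) \<noteq> 0" using ne by simp
      from has_vector_derivative_real_field[OF D[OF this]]
      show "((\<lambda>x. of_real c * exp (\<i> * of_real ((q - p) * x)) / (\<i> * of_real (q - p))) has_vector_derivative
        of_real c * exp (\<i> * of_real ((q - p) * x))) (at x within {0..L})"
        by (simp add: mult.assoc)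
    qed (use L in \<open>auto intro!: continuous_intros\<close>)
    moreover have "exp (\<i> * of_real ((q - p) * L)) = 1"
    proof -
      have *: "(q - p) * L = 2 * pi * (real j - real i)"
        using L by (simp add: p_def q_def freq_def field_simps)
      have "\<i> * of_real ((q - p) * L) = complex_of_real (2 * real_of_int (int j - int i) * pi) * \<i>"
        unfolding * by simp
      then show ?thesis using exp_integer_2pi[of "of_int (int j - int i)"] by (simp only: Ints_of_int simp_thms)
    qed
    ultimately show ?thesis using False by simp
  qed
  have g: "has_bochner_integral lborel g (of_real ((exp (- (p + q)) - exp (- (p + q) * a)) / (p + q)))"
  proof -
    have "has_bochner_integral lborel (\<lambda>y. exp (- s * y) * indicator {1..a} y)
       (- exp (- s * a) / s - (- exp (- s * 1) / s))" if "s > 0" for s :: real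
      using a that by (intro has_bochner_integral_FTC_Icc_nonneg)
        (auto intro!: derivative_eq_intros)
    from this[OF add_pos_pos[OF pq]]
    have "has_bochner_integral lborel (\<lambda>y. exp (- (p + q) * y) * indicator {1..a} y)
       (- exp (- (p + q) * a) / (p + q) - (- exp (- (p + q) * 1) / (p + q)))" .
    then have "has_bochner_integral lborel g (of_real (- exp (- (p + q) * a) / (p + q) - (- exp (- (p + q) * 1) / (p + q))))"
      unfolding g_def by (rule has_bochner_integral_of_real)
    then show ?thesis by (simp add: diff_divide_distrib)
  qed
  have "(\<integral>z. cnj (per_basis a L i z) * per_basis a L j z \<partial>area_H) = (\<integral>x. f x \<partial>lborel) * (\<integral>y. g y \<partial>lborel)"
  proof (rule integral_area_H_product)
    show "integrable lborel f" "integrable lborel g" using f g by (auto simp: has_bochner_integral_iff)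
    fix z
    show "cnj (per_basis a L i z) * per_basis a L j z = f (Re z) * g (Im z)"
    proof (cases "z \<in> rect a L")
      case True
      have "cnj (exp (\<i> * of_real p * z)) * exp (\<i> * of_real q * z)
          = exp (\<i> * of_real ((q - p) * Re z)) * of_real (exp (- (p + q) * Im z))"
      proof -
        have "cnj (\<i> * of_real p * z) + \<i> * of_real q * z = \<i> * of_real ((q - p) * Re z) + of_real (- (p + q) * Im z)"
          by (simp add: complex_eq_iff algebra_simps)
        then show ?thesis by (simp only: exp_cnj exp_of_real[symmetric] exp_add[symmetric])
      qed
      moreover have "Re z \<in> {0..L}" "Im z \<in> {1..a}" using True by (auto simp: rect_def)
      ultimately show ?thesis using True
        by (simp add: per_basis_def f_def g_def p_def[symmetric] q_def[symmetric] c_def mult_ac)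
    next
      case False
      then have "Re z \<notin> {0..L} \<or> Im z \<notin> {1..a}" by (auto simp: rect_def)
      then show ?thesis using False by (auto simp: per_basis_def f_def g_def)
    qed
  next
    fix z assume "z \<notin> upper_half_plane"
    then have "z \<notin> rect a L" using rect_subset by blast
    then show "cnj (per_basis a L i z) * per_basis a L j z = 0" by (simp add: per_basis_def)
  qed
  also have "\<dots> = (if i = j then of_real (symbol a (freq L i)) else 0)"
  proof (cases "i = j")
    case True
    then have "q = p" "freq L j = p" by (simp_all add: p_def q_def)
    have "c * L = 2 * p" using L pq \<open>q = p\<close> by (simp add: c_def)
    then show ?thesis using True f g pq
      by (simp add: has_bochner_integral_integral_eq \<open>q = p\<close> \<open>freq L j = p\<close> symbol_def p_def[symmetric] field_simps)
  qed (use f in \<open>simp add: has_bochner_integral_integral_eq\<close>)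
  finally show ?thesis .
qed

lemma kernel_trace_per:
  assumes a: "1 \<le> a" and L: "0 < L"
  shows "(\<lambda>j. symbol a (freq L j) ^ Suc k) sums per_trace a L k"
proof -
  interpret mercer_kernel area_H "rect a L" 2 "per_basis a L" "K_per a L"
    by (rule K_per_mercer[OF a L])
  have "kernel_trace area_H (trunc n) k = of_real (\<Sum>j<n. symbol a (freq L j) ^ Suc k)" for n
    by (subst finite_rank_kernel.kernel_trace_triangular[OF trunc_finite_rank])
       (auto simp: per_basis_gram[OF a L])
  then show ?thesis using tendsto_Re[OF kernel_trace_lim[of k]] by (simp add: sums_def)
qed

text \<open>
  For \<open>k = 0\<close> the kernels are compared on the diagonal, where they differ by at most \<open>800 / L\<^sup>2\<close>; for higher
  powers through their \<open>L\<^sup>1\<close> distance.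
\<close>

lemma trace_difference:
  assumes a: "1 \<le> a"
  shows "((\<lambda>L. (rect_trace a L k - per_trace a L k) / L) \<longlongrightarrow> 0) at_top"
proof -
  obtain A where A: "0 \<le> A" "\<And>L. L \<ge> 2 * pi * a \<Longrightarrow> 
     cmod (kernel_trace area_H (K_rect a L) k - kernel_trace area_H (K_per a L) k) \<le> A * (800 + 8 * (ln (1 + L))\<^sup>2)"
  proof (cases k)
    case 0
    have "cmod (kernel_trace area_H (K_rect a L) k - kernel_trace area_H (K_per a L) k) \<le> (a - 1) * (800 + 8 * (ln (1 + L))\<^sup>2)"
      if L: "L \<ge> 2 * pi * a" for L
    proof -
      have L0: "L > 0" by (rule less_le_trans[OF _ L(1)]) (use a in simp)
      have L1: "L \<ge> 1"
      proof -
        have "1 * 1 \<le> 2 * pi * a" using a pi_ge_two by (intro mult_mono) auto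
        then show ?thesis using L by simp
      qed
      interpret mercer_kernel_pair area_H "rect a L" 2 "disc_basis a L" "per_basis a L" "K_rect a L" "K_per a L" "6 * pi * (a - 1)"
        by (rule rect_kernel_pair[OF a L0])
      have "kernel_trace area_H (K_rect a L) k - kernel_trace area_H (K_per a L) k
         = (\<integral>z. K_rect a L z z - K_per a L z z \<partial>area_H)"
        using Bochner_Integration.integral_diff[OF K.iter_diagonal_integrable[of 0] B.iter_diagonal_integrable[of 0]]
        by (simp add: 0 kernel_trace_def)
      then have "ennreal (cmod (kernel_trace area_H (K_rect a L) k - kernel_trace area_H (K_per a L) k))
         \<le> (\<integral>\<^sup>+z. cmod (K_rect a L z z - K_per a L z z) \<partial>area_H)"
        by (simp only: norm_integral_le_nn_integral)
      also have "\<dots> \<le> (\<integral>\<^sup>+z. ennreal (800 / L\<^sup>2) * indicator (rect a L) z \<partial>area_H)"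
      proof (rule nn_integral_mono)
        fix z
        show "ennreal (cmod (K_rect a L z z - K_per a L z z)) \<le> ennreal (800 / L\<^sup>2) * indicator (rect a L) z"
        proof (cases "z \<in> rect a L")
          case True
          then have "cmod (K_H z z - csc_kernel L z z) \<le> 800 / L\<^sup>2"
            using L L0 a by (intro kernel_difference_near[of a]) (auto simp: rect_def)
          then show ?thesis using True by (simp add: K_rect_def K_per_csc ennreal_leI)
        qed (simp add: K_rect_def K_per_csc)
      qed
      also have "\<dots> = ennreal (800 / L\<^sup>2 * ((a - 1) * L))"
        using a L0 by (subst nn_integral_cmult_indicator) (auto simp: rect_sets_area_H emeasure_rect ennreal_mult[symmetric])
      finally have "cmod (kernel_trace area_H (K_rect a L) k - kernel_trace area_H (K_per a L) k) \<le> 800 / L\<^sup>2 * ((a - 1) * L)"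
        using a L0 by (subst (asm) ennreal_le_iff) auto
      also have "\<dots> = (a - 1) * (800 / L)" using L0 by (simp add: power2_eq_square)
      also have "\<dots> \<le> (a - 1) * (800 + 8 * (ln (1 + L))\<^sup>2)"
      proof (rule mult_left_mono)
        have "800 / L \<le> 800" using L1 by (simp add: divide_le_eq)
        then show "800 / L \<le> 800 + 8 * (ln (1 + L))\<^sup>2" by (rule order_trans) simp
      qed (use a in simp)
      finally show ?thesis .
    qed
    then show ?thesis using a by (intro that[of "a - 1"]) auto
  next
    case (Suc k')
    let ?R = "6 * pi * (a - 1)"
    have "cmod (kernel_trace area_H (K_rect a L) k - kernel_trace area_H (K_per a L) k)
        \<le> (2 * real (k' + 2) * ?R ^ k' * (a - 1)\<^sup>2) * (800 + 8 * (ln (1 + L))\<^sup>2)"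
      if L: "L \<ge> 2 * pi * a" for L
    proof -
      have L0: "L > 0" by (rule less_le_trans[OF _ L(1)]) (use a in simp)
      interpret mercer_kernel_pair area_H "rect a L" 2 "disc_basis a L" "per_basis a L" "K_rect a L" "K_per a L" "6 * pi * (a - 1)"
        by (rule rect_kernel_pair[OF a L0])
      have nn: "0 \<le> 2 * real (k' + 2) * ?R ^ k'" using a by (intro mult_nonneg_nonneg zero_le_power) auto
      have "ennreal (cmod (kernel_trace area_H (K_rect a L) k - kernel_trace area_H (K_per a L) k))
         \<le> ennreal (2 * real (k' + 2) * ?R ^ k') * dist_L1"
        unfolding Suc by (rule kernel_trace_diff_Suc)
      also have "\<dots> \<le> ennreal (2 * real (k' + 2) * ?R ^ k') * ennreal ((a - 1)\<^sup>2 * (800 + 8 * (ln (1 + L))\<^sup>2))"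
        by (intro mult_left_mono dist_L1_le[OF a L]) auto
      also have "\<dots> = ennreal (2 * real (k' + 2) * ?R ^ k' * ((a - 1)\<^sup>2 * (800 + 8 * (ln (1 + L))\<^sup>2)))"
        using nn by (simp add: ennreal_mult)
      finally have "cmod (kernel_trace area_H (K_rect a L) k - kernel_trace area_H (K_per a L) k)
        \<le> 2 * real (k' + 2) * ?R ^ k' * ((a - 1)\<^sup>2 * (800 + 8 * (ln (1 + L))\<^sup>2))"
        by (rule ennreal_le_iff[THEN iffD1, rotated]) (intro mult_nonneg_nonneg nn add_nonneg_nonneg; simp)
      then show ?thesis by (simp only: mult.assoc)
    qed
    then show ?thesis
      by (intro that[of "2 * real (k' + 2) * ?R ^ k' * (a - 1)\<^sup>2"] mult_nonneg_nonneg zero_le_power) (use a in auto)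
  qed
  show ?thesis
  proof (rule Lim_null_comparison)
    show "((\<lambda>L. A * (800 + 8 * (ln (1 + L))\<^sup>2) / L) \<longlongrightarrow> 0) at_top" by real_asymp
    show "\<forall>\<^sub>F L in at_top. norm ((rect_trace a L k - per_trace a L k) / L)
        \<le> A * (800 + 8 * (ln (1 + L))\<^sup>2) / L"
      using eventually_ge_at_top[of "2 * pi * a"] eventually_gt_at_top[of 0]
    proof eventually_elim
      case (elim L)
      have "\<bar>rect_trace a L k - per_trace a L k\<bar>
         \<le> cmod (kernel_trace area_H (K_rect a L) k - kernel_trace area_H (K_per a L) k)"
        using abs_Re_le_cmod[of "kernel_trace area_H (K_rect a L) k - kernel_trace area_H (K_per a L) k"] by simp
      with A(2)[OF elim(1)] elim(2) show ?case by (simp add: divide_right_mono)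
    qed
  qed
qed


text \<open>
  The frequencies have spacing \<open>2 \<pi> / L\<close>, so the sums over them divided by \<open>L\<close> approximate the integral over
  \<open>(0, \<infinity>)\<close> divided by \<open>2 \<pi>\<close>. The property is linear in \<open>f\<close> and evident for decaying exponentials, whose
  sums are geometric series; powers of the symbol are linear combinations of these.
\<close>

definition riemann_summable :: "(real \<Rightarrow> real) \<Rightarrow> real \<Rightarrow> bool" where
  "riemann_summable f v \<longleftrightarrow>
     (\<forall>L>0. summable (\<lambda>j. f (freq L j))) \<and>
     ((\<lambda>L. (\<Sum>j. f (freq L j)) / L) \<longlongrightarrow> v / (2 * pi)) at_top \<and>
     has_bochner_integral lborel (\<lambda>x. indicator {0<..} x *\<^sub>R f x) v"

lemma has_bochner_integral_exp_decay:
  assumes "0 < c"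
  shows "has_bochner_integral lborel (\<lambda>x. indicator {0<..} x *\<^sub>R exp (- c * x)) (1 / c :: real)"
proof -
  have "(\<integral>\<^sup>+x. ennreal (exp (- c * x)) * indicator {0 ..} x \<partial>lborel) = ennreal (0 - (- exp (- c * 0) / c))"
  proof (rule nn_integral_FTC_atLeast)
    show "((\<lambda>x. - exp (- c * x) / c) \<longlongrightarrow> 0) at_top" using assms by real_asymp
  qed (use assms in \<open>auto intro!: derivative_eq_intros\<close>)
  then have "has_bochner_integral lborel (\<lambda>x. indicator {0..} x *\<^sub>R exp (- c * x)) (1 / c)"
    using assms by (intro has_bochner_integral_nn_integral)
      (auto simp: ennreal_indicator[symmetric] ennreal_mult[symmetric] mult.commute simp del: ennreal_indicator)
  then show ?thesis
  proof (subst has_bochner_integral_cong_AE)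
    show "AE x in lborel. indicator {0<..} x *\<^sub>R exp (- c * x) = indicator {0..} x *\<^sub>R exp (- c * x)"
      using AE_lborel_singleton[of "0::real"] by eventually_elim (auto simp: indicator_def)
  qed auto
qed

lemma riemann_summable_exp:
  assumes "0 < c"
  shows "riemann_summable (\<lambda>x. exp (- c * x)) (1 / c)"
  unfolding riemann_summable_def
proof (intro conjI allI impI)
  let ?q = "\<lambda>L. exp (- c * (2 * pi / L))"
  have s: "(\<lambda>j. exp (- c * freq L j)) sums (?q L * (1 / (1 - ?q L)))" if "L > 0" for L
  proof -
    have eq: "exp (- c * freq L j) = ?q L * ?q L ^ j" for j
    proof -
      have "- c * freq L j = real (Suc j) * (- c * (2 * pi / L))" by (simp add: freq_def)
      then show ?thesis by (simp only: exp_of_nat_mult power_Suc)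
    qed
    have "norm (?q L) < 1" using assms that by (auto intro!: mult_pos_pos)
    from sums_mult[OF geometric_sums[OF this], of "?q L"] show ?thesis by (simp only: eq)
  qed
  show "summable (\<lambda>j. exp (- c * freq L j))" if "L > 0" for L
    using s[OF that] by (simp add: sums_iff)
  have "((\<lambda>L. ?q L * (1 / (1 - ?q L)) / L) \<longlongrightarrow> 1 / c / (2 * pi)) at_top"
    using assms pi_gt_zero by (real_asymp simp: field_simps)
  moreover have "\<forall>\<^sub>F L in at_top. ?q L * (1 / (1 - ?q L)) / L = (\<Sum>j. exp (- c * freq L j)) / L"
    using eventually_gt_at_top[of 0] by eventually_elim (use s in \<open>simp add: sums_iff\<close>)
  ultimately show "((\<lambda>L. (\<Sum>j. exp (- c * freq L j)) / L) \<longlongrightarrow> 1 / c / (2 * pi)) at_top"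
    by (rule Lim_transform_eventually)
qed (rule has_bochner_integral_exp_decay[OF assms])

lemma riemann_summable_add:
  assumes "riemann_summable f v" "riemann_summable g w"
  shows "riemann_summable (\<lambda>x. f x + g x) (v + w)"
  unfolding riemann_summable_def
proof (intro conjI allI impI)
  have s: "summable (\<lambda>j. f (freq L j))" "summable (\<lambda>j. g (freq L j))" if "L > 0" for L
    using assms that by (auto simp: riemann_summable_def)
  then show "summable (\<lambda>j. f (freq L j) + g (freq L j))" if "L > 0" for L
    using that by (intro summable_add) auto
  have "((\<lambda>L. (\<Sum>j. f (freq L j)) / L + (\<Sum>j. g (freq L j)) / L) \<longlongrightarrow> v / (2 * pi) + w / (2 * pi)) at_top"
    using assms by (intro tendsto_add) (auto simp: riemann_summable_def)
  moreover have "\<forall>\<^sub>F L in at_top. (\<Sum>j. f (freq L j)) / L + (\<Sum>j. g (freq L j)) / L = (\<Sum>j. f (freq L j) + g (freq L j)) / L"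
    using eventually_gt_at_top[of 0]
    by eventually_elim (simp add: suminf_add[OF s, symmetric] add_divide_distrib)
  ultimately have "((\<lambda>L. (\<Sum>j. f (freq L j) + g (freq L j)) / L) \<longlongrightarrow> v / (2 * pi) + w / (2 * pi)) at_top"
    by (rule Lim_transform_eventually)
  then show "((\<lambda>L. (\<Sum>j. f (freq L j) + g (freq L j)) / L) \<longlongrightarrow> (v + w) / (2 * pi)) at_top"
    by (simp add: add_divide_distrib)
  show "has_bochner_integral lborel (\<lambda>x. indicator {0<..} x *\<^sub>R (f x + g x)) (v + w)"
    unfolding scaleR_add_right using assms by (intro has_bochner_integral_add) (auto simp: riemann_summable_def)
qed

lemma riemann_summable_cmult:
  assumes "riemann_summable f v"
  shows "riemann_summable (\<lambda>x. c * f x) (c * v)"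
  unfolding riemann_summable_def
proof (intro conjI allI impI)
  have s: "summable (\<lambda>j. f (freq L j))" if "L > 0" for L
    using assms that by (auto simp: riemann_summable_def)
  then show "summable (\<lambda>j. c * f (freq L j))" if "L > 0" for L
    using that by (intro summable_mult) auto
  have "((\<lambda>L. c * ((\<Sum>j. f (freq L j)) / L)) \<longlongrightarrow> c * (v / (2 * pi))) at_top"
    using assms by (intro tendsto_mult tendsto_const) (auto simp: riemann_summable_def)
  moreover have "\<forall>\<^sub>F L in at_top. c * ((\<Sum>j. f (freq L j)) / L) = (\<Sum>j. c * f (freq L j)) / L"
    using eventually_gt_at_top[of 0]
    by eventually_elim (simp add: suminf_mult[OF s])
  ultimately have "((\<lambda>L. (\<Sum>j. c * f (freq L j)) / L) \<longlongrightarrow> c * (v / (2 * pi))) at_top"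
    by (rule Lim_transform_eventually)
  then show "((\<lambda>L. (\<Sum>j. c * f (freq L j)) / L) \<longlongrightarrow> c * v / (2 * pi)) at_top" by simp
  have "has_bochner_integral lborel (\<lambda>x. c * (indicator {0<..} x *\<^sub>R f x)) (c * v)"
    using assms by (intro has_bochner_integral_mult_right) (auto simp: riemann_summable_def)
  then show "has_bochner_integral lborel (\<lambda>x. indicator {0<..} x *\<^sub>R (c * f x)) (c * v)"
    by (simp add: mult_ac)
qed

lemma riemann_summable_0: "riemann_summable (\<lambda>x. 0) 0"
  using has_bochner_integral_zero by (simp add: riemann_summable_def)

lemma riemann_summable_sum:
  assumes "\<And>i. i \<in> A \<Longrightarrow> riemann_summable (f i) (v i)" "finite A"
  shows "riemann_summable (\<lambda>x. \<Sum>i\<in>A. f i x) (\<Sum>i\<in>A. v i)"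
  using assms(2,1) by (induction rule: finite_induct) (auto intro!: riemann_summable_add riemann_summable_0)

lemma riemann_summable_symbol_power:
  assumes "0 < a"
  shows "\<exists>v. riemann_summable (\<lambda>x. symbol a x ^ Suc k) v"
proof -
  let ?e = "\<lambda>i. 2 * real i + 2 * a * real (Suc k - i)"
  have eq: "symbol a x ^ Suc k = (\<Sum>i\<le>Suc k. (real (Suc k choose i) * (-1) ^ (Suc k - i)) * exp (- ?e i * x))" for x
  proof -
    have "symbol a x ^ Suc k = (exp (- 2 * x) + - exp (- 2 * a * x)) ^ Suc k" by (simp add: symbol_def)
    also have "\<dots> = (\<Sum>i\<le>Suc k. real (Suc k choose i) * exp (- 2 * x) ^ i * (- exp (- 2 * a * x)) ^ (Suc k - i))"
      by (rule binomial_ring)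
    also have "\<dots> = (\<Sum>i\<le>Suc k. (real (Suc k choose i) * (-1) ^ (Suc k - i)) * exp (- ?e i * x))"
    proof (rule sum.cong[OF refl])
      fix i
      have "(- exp (- 2 * a * x)) ^ (Suc k - i) = (-1) ^ (Suc k - i) * exp (- 2 * a * x) ^ (Suc k - i)"
        by (rule power_minus)
      moreover have "exp (- ?e i * x) = exp (- 2 * x) ^ i * exp (- 2 * a * x) ^ (Suc k - i)"
        unfolding exp_of_nat_mult[symmetric] exp_add[symmetric] by (simp add: algebra_simps)
      ultimately show "real (Suc k choose i) * exp (- 2 * x) ^ i * (- exp (- 2 * a * x)) ^ (Suc k - i)
         = (real (Suc k choose i) * (-1) ^ (Suc k - i)) * exp (- ?e i * x)" by simp
    qed
    finally show ?thesis .
  qed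
  have pos: "?e i > 0" for i
    using assms by (cases i) (auto intro: add_pos_nonneg)
  show ?thesis unfolding eq
    by (rule exI, rule riemann_summable_sum, rule riemann_summable_cmult, rule riemann_summable_exp, rule pos) simp
qed

lemma symbol_power_integrable: "0 < a \<Longrightarrow> set_integrable lborel {0<..} (\<lambda>x. symbol a x ^ Suc k)"
  using riemann_summable_symbol_power[of a k]
  by (auto simp: riemann_summable_def set_integrable_def has_bochner_integral_iff)

theorem trace_limit:
  assumes a: "1 \<le> a"
  shows "((\<lambda>L. rect_trace a L k / L) \<longlongrightarrow>
    1 / (2 * pi) * (LINT x:{0<..}|lborel. symbol a x ^ Suc k)) at_top"
proof -
  obtain v where v: "riemann_summable (\<lambda>x. symbol a x ^ Suc k) v"
    using riemann_summable_symbol_power[of a k] a by auto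
  then have I: "(LINT x:{0<..}|lborel. symbol a x ^ Suc k) = v"
    by (simp add: riemann_summable_def set_lebesgue_integral_def has_bochner_integral_integral_eq)
  have "((\<lambda>L. (rect_trace a L k - per_trace a L k) / L
      + (\<Sum>j. symbol a (freq L j) ^ Suc k) / L) \<longlongrightarrow> 0 + v / (2 * pi)) at_top"
    using v by (intro tendsto_add trace_difference[OF a]) (simp add: riemann_summable_def)
  moreover have "\<forall>\<^sub>F L in at_top. (rect_trace a L k - per_trace a L k) / L
      + (\<Sum>j. symbol a (freq L j) ^ Suc k) / L = rect_trace a L k / L"
    using eventually_gt_at_top[of 0]
  proof eventually_elim
    case (elim L)
    have "(\<Sum>j. symbol a (freq L j) ^ Suc k) = per_trace a L k"
      using kernel_trace_per[OF a elim, of k] by (simp only: sums_iff)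
    then show ?case by (simp add: diff_divide_distrib)
  qed
  ultimately show ?thesis unfolding I by (simp add: Lim_transform_eventually)
qed


section \<open>The generating function of the number of points\<close>

lemma compact_rect: "compact (rect a L)"
proof -
  have "rect a L = cbox (Complex 0 1) (Complex L a)"
    by (auto simp: rect_def in_cbox_complex_iff)
  then show ?thesis by (simp add: compact_cbox)
qed

locale rect_counts =
  fixes M :: "'w measure" and Z :: "'w \<Rightarrow> complex set" and a L :: real
  assumes process: "determinantal_process M area_H K_H Z" and a: "1 < a" and L: "0 < L"
begin

abbreviation N :: "'w \<Rightarrow> nat" where "N \<equiv> box_count Z a L"

lemma N_eq: "\<omega> \<in> space M \<Longrightarrow> N \<omega> = card (Z \<omega> \<inter> rect a L)"
  by (auto simp: box_count_def rect_def intro!: arg_cong[where f=card])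

lemma process': "point_process M area_H Z"
  using process by (simp add: determinantal_process_def)

sublocale prob_space M
  using process' by (simp add: point_process_def)

sublocale mercer: mercer_kernel area_H "rect a L" 2 "disc_basis a L" "K_rect a L"
  using K_rect_mercer[of a L] a L by simp

lemma finite_points: "\<omega> \<in> space M \<Longrightarrow> finite (Z \<omega> \<inter> rect a L)"
  using process' compact_rect[of a L] rect_subset[of a L]
  by (simp add: point_process_def space_area_H)

lemma N_measurable [measurable]: "N \<in> measurable M (count_space UNIV)"
proof -
  have "(\<lambda>\<omega>. emeasure (count_space UNIV) (Z \<omega> \<inter> rect a L)) \<in> borel_measurable M"
    using process' rect_sets_area_H by (simp add: point_process_def)
  then have "(\<lambda>\<omega>. enn2real (emeasure (count_space UNIV) (Z \<omega> \<inter> rect a L))) \<in> borel_measurable M"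
    by measurable
  moreover have "enn2real (emeasure (count_space UNIV) (Z \<omega> \<inter> rect a L)) = real (N \<omega>)" if "\<omega> \<in> space M" for \<omega>
    using finite_points[OF that] N_eq[OF that] by (simp add: emeasure_count_space)
  ultimately have "(\<lambda>\<omega>. real (N \<omega>)) \<in> borel_measurable M"
    by (simp cong: measurable_cong)
  then have "(\<lambda>\<omega>. nat \<lfloor>real (N \<omega>)\<rfloor>) \<in> measurable M (count_space UNIV)" by measurable
  then show ?thesis by simp
qed

definition fmoment :: "nat \<Rightarrow> real" where "fmoment k = Re (minor_integral area_H (K_rect a L) k)"

text \<open>
  The number of injective \<open>k\<close>-tuples of points in the rectangle is \<open>N (N - 1) ... (N - k + 1)\<close>. The determinant
  of the cut-off kernel has a zero row as soon as one point lies outside.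
\<close>

lemma factorial_moment:
  "(\<integral>\<^sup>+\<omega>. ennreal (fact k * real (N \<omega> choose k)) \<partial>M) = ennreal (fmoment k)"
proof -
  let ?P = "Pi\<^sub>M {..<k} (\<lambda>_. area_H)" and ?B = "{..<k} \<rightarrow>\<^sub>E rect a L"
  obtain \<rho> where \<rho>: "correlation_function M area_H Z k \<rho>"
    "\<And>z. z \<in> {..<k} \<rightarrow>\<^sub>E space area_H \<Longrightarrow> complex_of_real (\<rho> z) = Determinant.det (Matrix.mat k k (\<lambda>(i, j). K_H (z i) (z j)))"
    using process unfolding determinantal_process_def by blast
  have B: "?B \<in> sets ?P" by (intro sets_PiM_I_finite rect_sets_area_H) auto
  let ?d = "\<lambda>z. Determinant.det (Matrix.mat k k (\<lambda>(i, j). K_rect a L (z i) (z j)))"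
  have d: "?d z = complex_of_real (\<rho> z * indicator ?B z)" if z: "z \<in> space ?P" for z
  proof (cases "z \<in> ?B")
    case True
    then have "z i \<in> rect a L" if "i < k" for i using that by (auto simp: PiE_iff)
    then have "Matrix.mat k k (\<lambda>(i, j). K_rect a L (z i) (z j)) = Matrix.mat k k (\<lambda>(i, j). K_H (z i) (z j))"
      by (intro eq_matI) (auto simp: K_rect_def)
    then show ?thesis using \<rho>(2)[of z] z True by (simp add: space_PiM)
  next
    case False
    then obtain i where i: "i < k" "z i \<notin> rect a L" using z by (auto simp: space_PiM PiE_iff)
    have "(\<Prod>j<k. K_rect a L (z j) (z (p j))) = 0" for p
      using i by (intro prod_zero) (auto intro!: bexI[of _ i] simp: K_rect_def)
    then have "?d z = 0" unfolding det_permutation_sum by simp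
    then show ?thesis using False by simp
  qed
  have int: "integrable ?P ?d" by (rule mercer.minor_integrable)
  have g: "integrable ?P (\<lambda>z. \<rho> z * indicator ?B z)"
  proof -
    have "integrable ?P (\<lambda>z. Re (?d z))" using int by simp
    then show ?thesis by (rule Bochner_Integration.integrable_cong[THEN iffD1, rotated -1]) (auto simp: d)
  qed
  have "(\<integral>\<^sup>+\<omega>. ennreal (fact k * real (N \<omega> choose k)) \<partial>M)
     = (\<integral>\<^sup>+\<omega>. emeasure (count_space UNIV) {z\<in>?B. inj_on z {..<k} \<and> (\<forall>i<k. z i \<in> Z \<omega>)} \<partial>M)"
  proof (rule nn_integral_cong)
    fix \<omega> assume \<omega>: "\<omega> \<in> space M"
    let ?S = "Z \<omega> \<inter> rect a L"
    have eq: "{z\<in>?B. inj_on z {..<k} \<and> (\<forall>i<k. z i \<in> Z \<omega>)} = {f \<in> {..<k} \<rightarrow>\<^sub>E ?S. inj_on f {..<k}}"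
      by (auto simp: PiE_iff)
    have fin: "finite {f \<in> {..<k} \<rightarrow>\<^sub>E ?S. inj_on f {..<k}}"
      by (rule finite_subset[OF _ finite_PiE[of "{..<k}" "\<lambda>_. ?S"]]) (use finite_points[OF \<omega>] in auto)
    show "ennreal (fact k * real (N \<omega> choose k))
      = emeasure (count_space UNIV) {z\<in>?B. inj_on z {..<k} \<and> (\<forall>i<k. z i \<in> Z \<omega>)}"
      unfolding eq using fin card_injective_tuples[OF finite_points[OF \<omega>], of k]
      by (simp add: emeasure_count_space N_eq[OF \<omega>] ennreal_of_nat_eq_real_of_nat del: of_nat_mult)
         (simp add: of_nat_mult)
  qed
  also have "\<dots> = (\<integral>\<^sup>+z\<in>?B. ennreal (\<rho> z) \<partial>?P)"
    using \<rho>(1) B unfolding correlation_function_def by blast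
  also have "\<dots> = (\<integral>\<^sup>+z. ennreal (\<rho> z * indicator ?B z) \<partial>?P)"
    by (intro nn_integral_cong) (auto simp: indicator_def)
  also have "\<dots> = ennreal (\<integral>z. \<rho> z * indicator ?B z \<partial>?P)"
  proof (rule nn_integral_eq_integral[OF g])
    show "AE z in ?P. 0 \<le> \<rho> z * indicator ?B z"
      using \<rho>(1) unfolding correlation_function_def by (intro AE_I2) (auto simp: space_PiM)
  qed
  also have "(\<integral>z. \<rho> z * indicator ?B z \<partial>?P) = Re (\<integral>z. ?d z \<partial>?P)"
  proof -
    have "(\<integral>z. ?d z \<partial>?P) = (\<integral>z. complex_of_real (\<rho> z * indicator ?B z) \<partial>?P)"
      by (intro Bochner_Integration.integral_cong refl d)
    then show ?thesis by (simp only: integral_complex_of_real Re_complex_of_real)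
  qed
  finally show ?thesis by (simp add: fmoment_def minor_integral_def)
qed

lemma fmoment_bounds: "0 \<le> fmoment k" "fmoment k \<le> rect_trace a L 0 ^ k"
  unfolding fmoment_def by (rule mercer.minor_integral_bounds)+

lemma binomial_moment:
  "integrable M (\<lambda>\<omega>. real (N \<omega> choose k))" "(\<integral>\<omega>. real (N \<omega> choose k) \<partial>M) = fmoment k / fact k"
proof -
  have "integrable M (\<lambda>\<omega>. fact k * real (N \<omega> choose k)) \<and> (\<integral>\<omega>. fact k * real (N \<omega> choose k) \<partial>M) = fmoment k"
    using factorial_moment[of k] fmoment_bounds(1)[of k]
    by (subst (asm) nn_integral_eq_integrable) auto
  then show "integrable M (\<lambda>\<omega>. real (N \<omega> choose k))" "(\<integral>\<omega>. real (N \<omega> choose k) \<partial>M) = fmoment k / fact k"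
    by (auto simp: field_simps)
qed

text \<open>
  The expansion \<open>(1 + u)\<^sup>N = \<Sum>k. (N choose k) u\<^sup>k\<close> is integrated term by term; the integrals of the absolute
  values are dominated by the exponential series of \<open>|u|\<close> times the trace.
\<close>

lemma generating_function:
  "integrable M (\<lambda>\<omega>. (1 + u) ^ N \<omega>)"
  "(\<lambda>k. fmoment k / fact k * u ^ k) sums (\<integral>\<omega>. (1 + u) ^ N \<omega> \<partial>M)"
proof -
  let ?f = "\<lambda>k \<omega>. real (N \<omega> choose k) * u ^ k"
  let ?T = "rect_trace a L 0"
  have int: "integrable M (?f k)" for k using binomial_moment(1) by simp
  have fin: "(\<lambda>k. real (n choose k) * v ^ k) sums (1 + v) ^ n" for n and v :: real
  proof -
    have "(\<lambda>k. real (n choose k) * v ^ k) sums (\<Sum>k\<le>n. real (n choose k) * v ^ k)"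
      by (rule sums_finite) (auto simp: binomial_eq_0)
    also have "(\<Sum>k\<le>n. real (n choose k) * v ^ k) = (v + 1) ^ n"
      by (simp add: binomial_ring)
    finally show ?thesis by (simp add: add.commute)
  qed
  have s1: "AE \<omega> in M. summable (\<lambda>k. norm (?f k \<omega>))"
    using fin[of _ "\<bar>u\<bar>"] by (auto simp: abs_mult power_abs sums_iff)
  have s2: "summable (\<lambda>k. \<integral>\<omega>. norm (?f k \<omega>) \<partial>M)"
  proof (rule summable_comparison_test')
    show "summable (\<lambda>k. (?T * \<bar>u\<bar>) ^ k /\<^sub>R fact k)" by (rule summable_exp_generic)
    fix k
    have "(\<integral>\<omega>. norm (?f k \<omega>) \<partial>M) = fmoment k / fact k * \<bar>u\<bar> ^ k"
      using binomial_moment(2)[of k] by (simp add: abs_mult power_abs)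
    also have "\<dots> \<le> ?T ^ k / fact k * \<bar>u\<bar> ^ k"
      by (intro mult_right_mono divide_right_mono fmoment_bounds) auto
    finally show "norm (\<integral>\<omega>. norm (?f k \<omega>) \<partial>M) \<le> (?T * \<bar>u\<bar>) ^ k /\<^sub>R fact k"
      by (simp add: power_mult_distrib divide_inverse mult_ac integral_nonneg_AE)
  qed
  have S: "(\<Sum>k. ?f k \<omega>) = (1 + u) ^ N \<omega>" for \<omega> using fin[of "N \<omega>" u] by (simp add: sums_iff)
  show "integrable M (\<lambda>\<omega>. (1 + u) ^ N \<omega>)"
    using integrable_suminf[OF int s1 s2] by (simp add: S)
  show "(\<lambda>k. fmoment k / fact k * u ^ k) sums (\<integral>\<omega>. (1 + u) ^ N \<omega> \<partial>M)"
    using sums_integral[OF int s1 s2] by (simp add: S binomial_moment(2))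
qed

lemma exp_count: "exp (\<theta> * real (N \<omega>)) = (1 + (exp \<theta> - 1)) ^ N \<omega>"
  by (simp add: exp_of_nat_mult[symmetric] mult.commute)

lemma exp_count_integrable: "integrable M (\<lambda>\<omega>. exp (\<theta> * real (N \<omega>)))"
  unfolding exp_count by (rule generating_function)

lemma log_mgf_trace_approx:
  assumes "b > 1" and "1 + u * b > 0" and u: "u > -1"
    and "\<And>y. 0 \<le> y \<Longrightarrow> y \<le> b \<Longrightarrow> \<bar>ln (1 + u * y) - (\<Sum>i\<le>n. c i * y ^ Suc i)\<bar> \<le> \<delta> * y"
  shows "\<bar>ln (\<integral>\<omega>. (1 + u) ^ N \<omega> \<partial>M) - (\<Sum>i\<le>n. c i * rect_trace a L i)\<bar>
     \<le> \<delta> * rect_trace a L 0"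
proof (rule mercer.ln_generating_function_trace_approx[where G = "\<lambda>v. \<integral>\<omega>. (1 + v) ^ N \<omega> \<partial>M"])
  show "(\<lambda>k. Re (minor_integral area_H (K_rect a L) k) / fact k * v ^ k) sums (\<integral>\<omega>. (1 + v) ^ N \<omega> \<partial>M)" for v
    using generating_function(2)[of v] by (simp add: fmoment_def)
  show "0 < (\<integral>\<omega>. (1 + v) ^ N \<omega> \<partial>M)" if "v > -1" for v :: real
    by (rule expectation_greater) (use that generating_function(1) in auto)
  show "(\<integral>\<omega>. (1 + v) ^ N \<omega> \<partial>M) \<le> (\<integral>\<omega>. (1 + w) ^ N \<omega> \<partial>M)" if "-1 < v" "v \<le> w" for v w :: real
    by (intro integral_mono generating_function power_mono) (use that in auto)
qed (use assms in auto)

end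


section \<open>The limit of the scaled cumulant generating functions\<close>

lemma symbol_bounds:
  assumes "1 < a" "0 < x"
  shows "0 < symbol a x" "symbol a x < 1"
proof -
  have "2 * x < 2 * a * x" using assms by simp
  then show "0 < symbol a x" by (simp add: symbol_def)
  have "exp (- 2 * x) < 1" using assms by simp
  then show "symbol a x < 1" unfolding symbol_def using exp_gt_zero[of "- 2 * a * x"] by linarith
qed

lemma symbol_measurable [measurable]: "symbol a \<in> borel_measurable borel"
  unfolding symbol_def by measurable

text \<open>
  The scaled cumulant generating function in the limit of long rectangles.
\<close>

definition scgf :: "real \<Rightarrow> real \<Rightarrow> real" where
  "scgf a \<theta> = 1 / (2 * pi) * (LINT \<xi>:{0<..}|lborel. ln (1 + (exp \<theta> - 1) * symbol a \<xi>))"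

lemma set_integral_sum:
  fixes f :: "'i \<Rightarrow> 'b \<Rightarrow> real"
  assumes "\<And>i. i \<in> I \<Longrightarrow> set_integrable M A (f i)"
  shows "set_integrable M A (\<lambda>x. \<Sum>i\<in>I. f i x)"
    and "(LINT x:A|M. (\<Sum>i\<in>I. f i x)) = (\<Sum>i\<in>I. LINT x:A|M. f i x)"
  using assms unfolding set_integrable_def set_lebesgue_integral_def scaleR_sum_right
  by (simp_all add: Bochner_Integration.integral_sum)

lemma ln_symbol_approx:
  fixes a u \<delta> :: real
  assumes a: "1 < a" and u: "u > -1" and "\<delta> > 0"
  obtains b n c where "b > 1" "1 + u * b > 0"
    "\<And>y. 0 \<le> y \<Longrightarrow> y \<le> b \<Longrightarrow> \<bar>ln (1 + u * y) - (\<Sum>i\<le>n. c i * y ^ Suc i)\<bar> \<le> \<delta> * y"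
proof -
  obtain b :: real where b: "b > 1" "1 + u * b > 0"
  proof (cases "u \<ge> 0")
    case True
    then have "1 + u * 2 > 0" by simp
    then show ?thesis using that[of 2] by simp
  next
    case False
    define v where "v = - u"
    have v: "0 < v" "v < 1" using u False by (auto simp: v_def)
    then have "1 < 1 / v" by simp
    then obtain b where b: "1 < b" "b < 1 / v" using dense by blast
    then have "b * v < 1" using v by (simp add: less_divide_eq)
    then have "1 + u * b > 0" by (simp add: v_def algebra_simps)
    then show ?thesis using that[of b] b by simp
  qed
  have "0 < b" using b by simp
  then show ?thesis by (rule log_polynomial_approx[OF _ b(2) \<open>\<delta> > 0\<close>]) (rule that[OF b])
qed

text \<open>
  The function is within \<open>symbol a\<close> of a polynomial in \<open>symbol a\<close> without constant term.
\<close>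

lemma ln_symbol_integrable:
  assumes a: "1 < a" and u: "u > -1"
  shows "set_integrable lborel {0<..} (\<lambda>\<xi>. ln (1 + u * symbol a \<xi>))"
proof -
  obtain b n c where b: "b > 1" "1 + u * b > 0"
    and p: "\<And>y. 0 \<le> y \<Longrightarrow> y \<le> b \<Longrightarrow> \<bar>ln (1 + u * y) - (\<Sum>i\<le>n. c i * y ^ Suc i)\<bar> \<le> 1 * y"
    by (rule ln_symbol_approx[OF a u, of 1]) auto
  have "set_integrable lborel {0<..} (\<lambda>x. \<Sum>i\<le>n. \<bar>c i\<bar> * symbol a x ^ Suc i)"
    using symbol_power_integrable[of a] a by (intro set_integral_sum set_integrable_mult_right) auto
  then have "set_integrable lborel {0<..} (\<lambda>x. (\<Sum>i\<le>n. \<bar>c i\<bar> * symbol a x ^ Suc i) + symbol a x)"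
    using symbol_power_integrable[of a 0] a by (intro set_integral_add) auto
  then show ?thesis
  proof (rule set_integrable_bound)
    show "AE x in lborel. x \<in> {0<..} \<longrightarrow> norm (ln (1 + u * symbol a x)) \<le> norm ((\<Sum>i\<le>n. \<bar>c i\<bar> * symbol a x ^ Suc i) + symbol a x)"
    proof (intro AE_I2 impI)
      fix x :: real assume "x \<in> {0<..}"
      then have s: "0 < symbol a x" "symbol a x < 1" using symbol_bounds[OF a] by auto
      have "\<bar>\<Sum>i\<le>n. c i * symbol a x ^ Suc i\<bar> \<le> (\<Sum>i\<le>n. \<bar>c i\<bar> * symbol a x ^ Suc i)"
        by (rule order_trans[OF sum_abs]) (use s in \<open>simp add: abs_mult power_abs\<close>)
      moreover have "\<bar>ln (1 + u * symbol a x) - (\<Sum>i\<le>n. c i * symbol a x ^ Suc i)\<bar> \<le> 1 * symbol a x"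
        by (rule p) (use s b in auto)
      ultimately show "norm (ln (1 + u * symbol a x)) \<le> norm ((\<Sum>i\<le>n. \<bar>c i\<bar> * symbol a x ^ Suc i) + symbol a x)"
        unfolding real_norm_def by linarith
    qed
    show "set_borel_measurable lborel {0<..} (\<lambda>x. ln (1 + u * symbol a x))"
      unfolding set_borel_measurable_def by measurable
  qed
qed

text \<open>
  A polynomial that approximates \<open>ln (1 + u y)\<close> with error \<open>\<delta> y\<close> approximates both sides with an error of at most
  \<open>\<delta>\<close> times the trace per unit length; for the polynomial itself the limit is that of the traces.
\<close>

theorem scaled_log_mgf_limit:
  assumes proc: "determinantal_process M area_H K_H Z" and a: "1 < a"
  shows "((\<lambda>L. scaled_log_mgf M Z a L \<theta>) \<longlongrightarrow> scgf a \<theta>) at_top"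
proof (rule tendstoI)
  fix \<epsilon> :: real assume \<epsilon>: "\<epsilon> > 0"
  define u where "u = exp \<theta> - 1"
  have u: "u > -1" by (simp add: u_def)
  define \<tau> where "\<tau> k = 1 / (2 * pi) * (LINT x:{0<..}|lborel. symbol a x ^ Suc k)" for k
  have \<tau>: "((\<lambda>L. rect_trace a L k / L) \<longlongrightarrow> \<tau> k) at_top" for k
    unfolding \<tau>_def by (rule trace_limit) (use a in simp)
  \<comment> \<open>the three errors add up to less than \<open>\<delta> (\<tau> 0 + 1) + \<delta> + \<delta> \<tau> 0\<close>\<close>
  define \<delta> where "\<delta> = \<epsilon> / (2 * \<bar>\<tau> 0\<bar> + 3)"
  have \<delta>: "\<delta> > 0" using \<epsilon> by (simp add: \<delta>_def add_nonneg_pos)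
  obtain b n c where b: "b > 1" "1 + u * b > 0"
    and p: "\<And>y. 0 \<le> y \<Longrightarrow> y \<le> b \<Longrightarrow> \<bar>ln (1 + u * y) - (\<Sum>i\<le>n. c i * y ^ Suc i)\<bar> \<le> \<delta> * y"
    by (rule ln_symbol_approx[OF a u \<delta>]) blast
  have lim: "\<bar>(\<Sum>i\<le>n. c i * \<tau> i) - scgf a \<theta>\<bar> \<le> \<delta> * \<tau> 0"
  proof -
    have i1: "set_integrable lborel {0<..} (\<lambda>x. \<Sum>i\<le>n. c i * symbol a x ^ Suc i)"
      using symbol_power_integrable[of a] a by (intro set_integral_sum set_integrable_mult_right) auto
    note i2 = ln_symbol_integrable[OF a u]
    have i0: "set_integrable lborel {0<..} (\<lambda>x. \<delta> * symbol a x)"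
      using symbol_power_integrable[of a 0] a by (intro set_integrable_mult_right) auto
    have "(\<Sum>i\<le>n. c i * \<tau> i) = 1 / (2 * pi) * (LINT x:{0<..}|lborel. \<Sum>i\<le>n. c i * symbol a x ^ Suc i)"
    proof -
      have "(LINT x:{0<..}|lborel. \<Sum>i\<le>n. c i * symbol a x ^ Suc i) = (\<Sum>i\<le>n. LINT x:{0<..}|lborel. c i * symbol a x ^ Suc i)"
        using symbol_power_integrable[of a] a by (intro set_integral_sum set_integrable_mult_right) auto
      also have "\<dots> = (\<Sum>i\<le>n. c i * (LINT x:{0<..}|lborel. symbol a x ^ Suc i))"
        by (simp only: set_integral_mult_right)
      finally show ?thesis by (simp only: \<tau>_def sum_distrib_left mult_ac)
    qed
    then have "(\<Sum>i\<le>n. c i * \<tau> i) - scgf a \<theta> = 1 / (2 * pi) * (LINT x:{0<..}|lborel.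
        (\<Sum>i\<le>n. c i * symbol a x ^ Suc i) - ln (1 + u * symbol a x))"
      unfolding scgf_def u_def[symmetric] set_integral_diff(2)[OF i1 i2] by (simp only: right_diff_distrib)
    also have "\<bar>\<dots>\<bar> = 1 / (2 * pi) * \<bar>LINT x:{0<..}|lborel.
        (\<Sum>i\<le>n. c i * symbol a x ^ Suc i) - ln (1 + u * symbol a x)\<bar>"
      by (simp add: abs_mult)
    also have "\<dots> \<le> 1 / (2 * pi) * (LINT x:{0<..}|lborel. \<delta> * symbol a x)"
    proof (rule mult_left_mono)
      have "\<bar>LINT x:{0<..}|lborel. (\<Sum>i\<le>n. c i * symbol a x ^ Suc i) - ln (1 + u * symbol a x)\<bar>
         \<le> (\<integral>x. norm (indicator {0<..} x *\<^sub>R ((\<Sum>i\<le>n. c i * symbol a x ^ Suc i) - ln (1 + u * symbol a x))) \<partial>lborel)"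
        unfolding set_lebesgue_integral_def real_norm_def[symmetric] by (rule integral_norm_bound)
      also have "\<dots> \<le> (LINT x:{0<..}|lborel. \<delta> * symbol a x)"
        unfolding set_lebesgue_integral_def
      proof (rule integral_mono')
        show "integrable lborel (\<lambda>x. indicator {0<..} x *\<^sub>R (\<delta> * symbol a x))"
          using i0 by (simp only: set_integrable_def)
        fix x :: real
        show "norm (indicator {0<..} x *\<^sub>R ((\<Sum>i\<le>n. c i * symbol a x ^ Suc i) - ln (1 + u * symbol a x)))
           \<le> indicator {0<..} x *\<^sub>R (\<delta> * symbol a x)"
          using p[of "symbol a x"] symbol_bounds[OF a, of x] b by (auto simp: indicator_def abs_minus_commute)
        show "0 \<le> indicator {0<..} x *\<^sub>R (\<delta> * symbol a x)"
          using symbol_bounds[OF a, of x] \<delta> by (auto simp: indicator_def)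
      qed
      finally show "\<bar>LINT x:{0<..}|lborel. (\<Sum>i\<le>n. c i * symbol a x ^ Suc i) - ln (1 + u * symbol a x)\<bar>
         \<le> (LINT x:{0<..}|lborel. \<delta> * symbol a x)" .
    qed simp
    also have "\<dots> = \<delta> * \<tau> 0" by (simp add: \<tau>_def)
    finally show ?thesis .
  qed
  have near: "\<forall>\<^sub>F L in at_top. \<bar>(\<Sum>i\<le>n. c i * (rect_trace a L i / L)) - (\<Sum>i\<le>n. c i * \<tau> i)\<bar> < \<delta>"
  proof -
    have "((\<lambda>L. \<Sum>i\<le>n. c i * (rect_trace a L i / L)) \<longlongrightarrow> (\<Sum>i\<le>n. c i * \<tau> i)) at_top"
      by (intro tendsto_sum tendsto_mult tendsto_const \<tau>)
    from tendstoD[OF this \<delta>] show ?thesis by (simp add: dist_real_def)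
  qed
  have near0: "\<forall>\<^sub>F L in at_top. rect_trace a L 0 / L < \<tau> 0 + 1"
    using order_tendstoD(2)[OF \<tau>[of 0], of "\<tau> 0 + 1"] by simp
  show "\<forall>\<^sub>F L in at_top. dist (scaled_log_mgf M Z a L \<theta>) (scgf a \<theta>) < \<epsilon>"
    using near near0 eventually_gt_at_top[of 0]
  proof eventually_elim
    case (elim L)
    interpret rect_counts M Z a L by unfold_locales (use proc a elim in auto)
    define G where "G = ln (\<integral>\<omega>. (1 + u) ^ N \<omega> \<partial>M)"
    have G: "\<bar>G - (\<Sum>i\<le>n. c i * rect_trace a L i)\<bar> \<le> \<delta> * rect_trace a L 0"
      unfolding G_def by (rule log_mgf_trace_approx[OF b u p])
    have eq: "scaled_log_mgf M Z a L \<theta> = G / L"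
      by (simp only: scaled_log_mgf_def exp_count u_def G_def) simp
    have "\<bar>G / L - (\<Sum>i\<le>n. c i * (rect_trace a L i / L))\<bar>
        = \<bar>G - (\<Sum>i\<le>n. c i * rect_trace a L i)\<bar> / L"
      using elim(3) by (simp add: sum_divide_distrib[symmetric] diff_divide_distrib[symmetric])
    also have "\<dots> \<le> \<delta> * (rect_trace a L 0 / L)"
      using G elim(3) by (simp add: divide_right_mono)
    also have "\<dots> \<le> \<delta> * (\<tau> 0 + 1)" using elim(2) \<delta> by (intro mult_left_mono) auto
    finally have 1: "\<bar>G / L - (\<Sum>i\<le>n. c i * (rect_trace a L i / L))\<bar> \<le> \<delta> * (\<tau> 0 + 1)" .
    have "\<bar>G / L - scgf a \<theta>\<bar> < \<delta> * (\<tau> 0 + 1) + \<delta> + \<delta> * \<tau> 0"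
      using 1 elim(1) lim by linarith
    also have "\<dots> \<le> \<delta> * (2 * \<bar>\<tau> 0\<bar> + 3)"
    proof -
      have "\<delta> * (\<tau> 0 + 1) + \<delta> + \<delta> * \<tau> 0 = \<delta> * (2 * \<tau> 0 + 2)" by (simp add: algebra_simps)
      also have "\<dots> \<le> \<delta> * (2 * \<bar>\<tau> 0\<bar> + 3)" using \<delta> by (intro mult_left_mono) auto
      finally show ?thesis .
    qed
    also have "\<dots> = \<epsilon>"
    proof -
      have "2 * \<bar>\<tau> 0\<bar> + 3 > 0" by (simp add: add_nonneg_pos)
      then show ?thesis by (simp add: \<delta>_def)
    qed
    finally show ?case by (simp add: eq dist_real_def)
  qed
qed


section \<open>Holomorphic dependence on the parameter\<close>

text \<open>
  The coefficient of order \<open>n\<close> is the limit at \<open>z0\<close> of the remainder of order \<open>n\<close> divided by its power of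
  \<open>z - z0\<close>, and the remainder involves only lower coefficients.
\<close>

lemma taylor_coefficient_measurable:
  fixes g :: "'b \<Rightarrow> complex \<Rightarrow> complex"
  assumes r: "0 < r" and hol: "\<And>x. x \<in> space M \<Longrightarrow> g x holomorphic_on ball z0 r"
    and meas: "\<And>z. z \<in> ball z0 r \<Longrightarrow> (\<lambda>x. g x z) \<in> borel_measurable M"
  shows "(\<lambda>x. (deriv ^^ n) (g x) z0 / fact n) \<in> borel_measurable M"
proof (induction n rule: less_induct)
  case (less n)
  let ?a = "\<lambda>n x. (deriv ^^ n) (g x) z0 / fact n"
  define \<epsilon> where "\<epsilon> k = complex_of_real (r / (real k + 2))" for k :: nat
  have \<epsilon>: "\<epsilon> k \<noteq> 0" "cmod (\<epsilon> k) < r" for k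
  proof -
    have "0 < r / (real k + 2)" "r / (real k + 2) < r"
      using r by (auto simp: pos_divide_less_eq intro!: divide_pos_pos)
    then show "\<epsilon> k \<noteq> 0" "cmod (\<epsilon> k) < r"
      unfolding \<epsilon>_def norm_of_real of_real_eq_0_iff by auto
  qed
  have "(\<lambda>k. r / (real k + 2)) \<longlonglongrightarrow> 0" by real_asymp
  from tendsto_of_real[OF this, where ?'a = complex] have \<epsilon>0: "\<epsilon> \<longlonglongrightarrow> 0"
    unfolding \<epsilon>_def by simp
  let ?q = "\<lambda>x \<zeta>. (g x (z0 + \<zeta>) - (\<Sum>m<n. ?a m x * \<zeta> ^ m)) / \<zeta> ^ n"
  show ?case
  proof (rule borel_measurable_LIMSEQ_metric)
    fix k
    show "(\<lambda>x. ?q x (\<epsilon> k)) \<in> borel_measurable M"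
      using \<epsilon>[of k] by (intro borel_measurable_divide borel_measurable_diff borel_measurable_sum
        borel_measurable_times borel_measurable_const less meas) (auto simp: dist_norm)
  next
    fix x assume x: "x \<in> space M"
    have "(?q x \<longlongrightarrow> ?a (0 + n) x) (at 0)"
    proof (rule powser_limit_0_strong[OF r])
      fix \<zeta> :: complex assume \<zeta>: "\<zeta> \<noteq> 0" "norm \<zeta> < r"
      have "(\<lambda>m. ?a m x * (z0 + \<zeta> - z0) ^ m) sums g x (z0 + \<zeta>)"
        by (rule holomorphic_power_series[OF hol[OF x]]) (use \<zeta> in \<open>auto simp: dist_norm\<close>)
      then have "(\<lambda>m. ?a (m + n) x * \<zeta> ^ (m + n)) sums (g x (z0 + \<zeta>) - (\<Sum>m<n. ?a m x * \<zeta> ^ m))"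
        by (subst sums_iff_shift) simp
      from sums_divide[OF this, of "\<zeta> ^ n"] show "(\<lambda>m. ?a (m + n) x * \<zeta> ^ m) sums ?q x \<zeta>"
        using \<zeta> by (simp add: power_add)
    qed
    moreover have "filterlim \<epsilon> (at 0) sequentially"
      using \<epsilon>0 \<epsilon>(1) by (simp add: filterlim_at)
    ultimately show "(\<lambda>k. ?q x (\<epsilon> k)) \<longlonglongrightarrow> ?a n x"
      using filterlim_compose by fastforce
  qed
qed

text \<open>
  Cauchy's estimate on a circle between \<open>z\<close> and the boundary of the disc bounds the Taylor coefficients
  by \<open>h x / \<rho>\<^sup>n\<close>, so that sum and integral may be interchanged.
\<close>

theorem parameter_integral_power_series:
  fixes g :: "'b \<Rightarrow> complex \<Rightarrow> complex"
  assumes r: "0 < r" and hol: "\<And>x. x \<in> space M \<Longrightarrow> g x holomorphic_on ball z0 r"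
    and meas: "\<And>z. z \<in> ball z0 r \<Longrightarrow> (\<lambda>x. g x z) \<in> borel_measurable M"
    and bound: "\<And>x z. x \<in> space M \<Longrightarrow> z \<in> ball z0 r \<Longrightarrow> norm (g x z) \<le> h x"
    and h: "integrable M h" and z: "z \<in> ball z0 r"
  shows "(\<lambda>n. (\<integral>x. (deriv ^^ n) (g x) z0 / fact n \<partial>M) * (z - z0) ^ n) sums (\<integral>x. g x z \<partial>M)"
proof -
  let ?a = "\<lambda>n x. (deriv ^^ n) (g x) z0 / fact n"
  have "cmod (z - z0) < r" using z by (simp add: dist_norm norm_minus_commute)
  then obtain \<rho> where \<rho>: "cmod (z - z0) < \<rho>" "\<rho> < r" using dense by blast
  have \<rho>0: "0 < \<rho>" by (rule le_less_trans[OF norm_ge_zero \<rho>(1)])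
  have coeff: "norm (?a n x) \<le> h x / \<rho> ^ n" if x: "x \<in> space M" for n x
  proof -
    have "norm ((deriv ^^ n) (g x) z0) \<le> fact n * h x / \<rho> ^ n"
    proof (rule Cauchy_inequality)
      show "g x holomorphic_on ball z0 \<rho>" by (rule holomorphic_on_subset[OF hol[OF x]]) (use \<rho> in auto)
      show "continuous_on (cball z0 \<rho>) (g x)"
        by (rule holomorphic_on_imp_continuous_on, rule holomorphic_on_subset[OF hol[OF x]]) (use \<rho> in auto)
      show "norm (g x y) \<le> h x" if "norm (z0 - y) = \<rho>" for y
        by (rule bound[OF x]) (use that \<rho> in \<open>auto simp: dist_norm\<close>)
    qed (rule \<rho>0)
    then have "norm ((deriv ^^ n) (g x) z0) / fact n \<le> fact n * h x / \<rho> ^ n / fact n"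
      by (rule divide_right_mono) simp
    then show ?thesis by (simp add: norm_divide)
  qed
  have a_int: "integrable M (?a n)" for n
  proof (rule Bochner_Integration.integrable_bound)
    show "integrable M (\<lambda>x. h x / \<rho> ^ n)" using h by simp
    show "?a n \<in> borel_measurable M" by (rule taylor_coefficient_measurable[OF r hol meas])
    show "AE x in M. norm (?a n x) \<le> norm (h x / \<rho> ^ n)"
    proof (rule AE_I2)
      fix x assume "x \<in> space M"
      from coeff[OF this, of n] show "norm (?a n x) \<le> norm (h x / \<rho> ^ n)"
        using abs_ge_self[of "h x / \<rho> ^ n"] unfolding real_norm_def by linarith
    qed
  qed
  let ?t = "cmod (z - z0) / \<rho>"
  have t: "0 \<le> ?t" "?t < 1" using \<rho> \<rho>0 by auto
  have le: "norm (?a n x * (z - z0) ^ n) \<le> h x * ?t ^ n" if "x \<in> space M" for n x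
    using mult_right_mono[OF coeff[OF that], of "cmod (z - z0) ^ n" n] by (simp add: norm_mult norm_power norm_divide power_divide)
  have sm: "summable (\<lambda>n. B * ?t ^ n)" for B
    by (intro summable_mult summable_geometric) (use t in auto)
  have int: "integrable M (\<lambda>x. ?a n x * (z - z0) ^ n)" for n
    by (rule integrable_mult_left) (rule a_int)
  have s1: "AE x in M. summable (\<lambda>n. norm (?a n x * (z - z0) ^ n))"
    by (intro AE_I2 summable_comparison_test'[OF sm]) (use le in auto)
  have s2: "summable (\<lambda>n. \<integral>x. norm (?a n x * (z - z0) ^ n) \<partial>M)"
  proof (rule summable_comparison_test'[OF sm])
    fix n
    have "(\<integral>x. norm (?a n x * (z - z0) ^ n) \<partial>M) \<le> (\<integral>x. h x * ?t ^ n \<partial>M)"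
      by (rule integral_mono) (use int h le in auto)
    then show "norm (\<integral>x. norm (?a n x * (z - z0) ^ n) \<partial>M) \<le> (\<integral>x. h x \<partial>M) * ?t ^ n"
      by (simp add: integral_nonneg_AE)
  qed
  have "(\<integral>x. (\<Sum>n. ?a n x * (z - z0) ^ n) \<partial>M) = (\<integral>x. g x z \<partial>M)"
  proof (rule Bochner_Integration.integral_cong[OF refl])
    fix x assume x: "x \<in> space M"
    show "(\<Sum>n. ?a n x * (z - z0) ^ n) = g x z"
      using holomorphic_power_series[OF hol[OF x] z] by (simp add: sums_iff)
  qed
  then show ?thesis using sums_integral[OF int s1 s2] by simp
qed

section \<open>Analyticity of the limit\<close>

lemma open_strip_pi: "open strip_pi"
proof -
  have eq: "strip_pi = {z. Im z < pi} \<inter> {z. - pi < Im z}" by (auto simp: strip_pi_def)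
  show ?thesis unfolding eq by (rule open_Int[OF open_halfspace_Im_lt open_halfspace_Im_gt])
qed

text \<open>
  The number is the convex combination \<open>(1 - s) + s exp \<theta>\<close>. It is real only if \<open>s = 0\<close> or \<open>\<theta>\<close> is real, and then
  it is positive. The principal logarithm is therefore the branch obtained by continuation from \<open>0\<close>.
\<close>

lemma strip_pi_slit:
  assumes "\<theta> \<in> strip_pi" "0 \<le> s" "s \<le> 1"
  shows "1 + (exp \<theta> - 1) * of_real s \<notin> \<real>\<^sub>\<le>\<^sub>0"
proof
  assume neg: "1 + (exp \<theta> - 1) * of_real s \<in> \<real>\<^sub>\<le>\<^sub>0"
  have re: "Re (1 + (exp \<theta> - 1) * of_real s) = (1 - s) + s * exp (Re \<theta>) * cos (Im \<theta>)"
    and im: "Im (1 + (exp \<theta> - 1) * of_real s) = s * exp (Re \<theta>) * sin (Im \<theta>)"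
    by (simp_all add: Re_exp Im_exp algebra_simps)
  have "s * exp (Re \<theta>) * sin (Im \<theta>) = 0"
    using neg unfolding complex_nonpos_Reals_iff im by blast
  then have "s = 0 \<or> sin (Im \<theta>) = 0" by simp
  then have "s = 0 \<or> Im \<theta> = 0" using assms(1) sin_eq_0_pi[of "Im \<theta>"] by (auto simp: strip_pi_def abs_less_iff)
  moreover have "(1 - s) + s * exp (Re \<theta>) > 0"
    using assms(2,3) by (cases "s = 1") (auto intro: add_pos_nonneg)
  ultimately have "Re (1 + (exp \<theta> - 1) * of_real s) > 0" unfolding re by auto
  then show False using neg unfolding complex_nonpos_Reals_iff by linarith
qed

text \<open>
  The logarithm vanishes at \<open>s = 0\<close>, and its derivative in \<open>s\<close> is continuous, hence bounded, on the compact set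
  \<open>K \<times> [0, 1]\<close>.
\<close>

lemma Ln_linear_bound:
  assumes K: "compact K" "K \<subseteq> strip_pi"
  obtains C where "\<And>\<theta> s. \<theta> \<in> K \<Longrightarrow> 0 \<le> s \<Longrightarrow> s \<le> 1 \<Longrightarrow> cmod (Ln (1 + (exp \<theta> - 1) * of_real s)) \<le> C * s"
proof -
  let ?d = "\<lambda>(\<theta>, s). (exp \<theta> - 1) / (1 + (exp \<theta> - 1) * complex_of_real s)"
  have nz: "1 + (exp \<theta> - 1) * complex_of_real s \<noteq> 0" if "\<theta> \<in> K" "0 \<le> s" "s \<le> 1" for \<theta> s
    using strip_pi_slit[of \<theta> s] that K by auto
  have "compact (?d ` (K \<times> {0..1}))"
    by (intro compact_continuous_image compact_Times K compact_Icc)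
       (auto simp: case_prod_beta intro!: continuous_intros dest: nz)
  then have "bounded (?d ` (K \<times> {0..1}))" by (rule compact_imp_bounded)
  then obtain C where C: "\<And>y. y \<in> ?d ` (K \<times> {0..1}) \<Longrightarrow> norm y \<le> C"
    unfolding bounded_iff by blast
  show ?thesis
  proof (rule that[of C])
    fix \<theta> and s :: real assume as: "\<theta> \<in> K" "0 \<le> s" "s \<le> 1"
    let ?S = "closed_segment 0 (complex_of_real s)"
    have seg: "\<exists>t. w = complex_of_real t \<and> 0 \<le> t \<and> t \<le> 1" if w: "w \<in> ?S" for w
    proof -
      obtain v where "0 \<le> v" "v \<le> 1" "w = complex_of_real (v * s)"
        using w by (auto simp: in_segment scaleR_conv_of_real)
      then show ?thesis using as by (intro exI[of _ "v * s"]) (auto intro: mult_le_one)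
    qed
    have "norm (Ln (1 + (exp \<theta> - 1) * of_real s) - Ln (1 + (exp \<theta> - 1) * 0)) \<le> C * norm (of_real s - 0 :: complex)"
    proof (rule field_differentiable_bound[where S = ?S and f' = "\<lambda>w. (exp \<theta> - 1) / (1 + (exp \<theta> - 1) * w)"])
      fix w assume "w \<in> ?S"
      then obtain t where t: "w = complex_of_real t" "0 \<le> t" "t \<le> 1" using seg by blast
      have "1 + (exp \<theta> - 1) * w \<notin> \<real>\<^sub>\<le>\<^sub>0" unfolding t by (rule strip_pi_slit) (use as K t in auto)
      then show "((\<lambda>w. Ln (1 + (exp \<theta> - 1) * w)) has_field_derivative (exp \<theta> - 1) / (1 + (exp \<theta> - 1) * w)) (at w within ?S)"
        by (auto intro!: derivative_eq_intros simp: field_simps)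
      show "norm ((exp \<theta> - 1) / (1 + (exp \<theta> - 1) * w)) \<le> C"
        by (rule C) (use as t in \<open>auto intro!: image_eqI[of _ _ "(\<theta>, t)"]\<close>)
    qed auto
    then show "cmod (Ln (1 + (exp \<theta> - 1) * of_real s)) \<le> C * s" using as by simp
  qed
qed

definition log_symbol :: "real \<Rightarrow> real \<Rightarrow> complex \<Rightarrow> complex" where
  "log_symbol a \<xi> \<theta> = Ln (1 + (exp \<theta> - 1) * of_real (symbol a \<xi>))"

lemma log_symbol_slit:
  assumes "1 < a" "0 < \<xi>" "\<theta> \<in> strip_pi"
  shows "1 + (exp \<theta> - 1) * of_real (symbol a \<xi>) \<notin> \<real>\<^sub>\<le>\<^sub>0"
  by (rule strip_pi_slit) (use assms symbol_bounds[of a \<xi>] in auto)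

lemma log_symbol_derivative:
  assumes "1 < a" "0 < \<xi>" "\<theta> \<in> strip_pi"
  shows "(log_symbol a \<xi> has_field_derivative
    exp \<theta> * of_real (symbol a \<xi>) / (1 + (exp \<theta> - 1) * of_real (symbol a \<xi>))) (at \<theta>)"
  unfolding log_symbol_def using log_symbol_slit[OF assms]
  by (auto intro!: derivative_eq_intros simp: divide_inverse mult.commute)

lemma log_symbol_holomorphic: "1 < a \<Longrightarrow> 0 < \<xi> \<Longrightarrow> log_symbol a \<xi> holomorphic_on strip_pi"
  using log_symbol_derivative holomorphic_on_open[OF open_strip_pi] by blast

lemma log_symbol_branch:
  assumes "1 < a" "0 < \<xi>"
  shows "log_branch_from_0 strip_pi (\<lambda>\<theta>. 1 + (exp \<theta> - 1) * of_real (symbol a \<xi>)) (log_symbol a \<xi>)"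
  unfolding log_branch_from_0_def
proof (intro conjI ballI)
  fix \<theta> assume "\<theta> \<in> strip_pi"
  then have "1 + (exp \<theta> - 1) * of_real (symbol a \<xi>) \<noteq> 0" using log_symbol_slit[OF assms, of \<theta>] by auto
  then show "exp (log_symbol a \<xi> \<theta>) = 1 + (exp \<theta> - 1) * of_real (symbol a \<xi>)"
    unfolding log_symbol_def by (rule exp_Ln)
qed (use log_symbol_holomorphic[OF assms] in \<open>auto simp: log_symbol_def\<close>)

lemma log_symbol_measurable: "(\<lambda>\<xi>. log_symbol a \<xi> \<theta>) \<in> borel_measurable borel"
  unfolding log_symbol_def by measurable

definition scgf_ext :: "real \<Rightarrow> complex \<Rightarrow> complex" where
  "scgf_ext a \<theta> = 1 / (2 * of_real pi) * (LINT \<xi>:{0<..}|lborel. log_symbol a \<xi> \<theta>)"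

definition scgf_coeff :: "real \<Rightarrow> complex \<Rightarrow> nat \<Rightarrow> complex" where
  "scgf_coeff a z0 n = 1 / (2 * of_real pi) *
     (LINT \<xi>:{0<..}|lborel. (deriv ^^ n) (log_symbol a \<xi>) z0 / fact n)"

lemma log_symbol_bound:
  assumes a: "1 < a" and K: "compact K" "K \<subseteq> strip_pi"
  obtains C where "\<And>\<theta> \<xi>. \<theta> \<in> K \<Longrightarrow> 0 < \<xi> \<Longrightarrow> cmod (log_symbol a \<xi> \<theta>) \<le> C * symbol a \<xi>"
proof -
  obtain C where C: "\<And>\<theta> s. \<theta> \<in> K \<Longrightarrow> 0 \<le> s \<Longrightarrow> s \<le> 1 \<Longrightarrow> cmod (Ln (1 + (exp \<theta> - 1) * of_real s)) \<le> C * s"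
    using Ln_linear_bound[OF K] by blast
  show ?thesis
    by (rule that[of C]) (use C symbol_bounds[OF a] in \<open>auto simp: log_symbol_def less_imp_le\<close>)
qed

lemma log_symbol_integrable:
  assumes a: "1 < a" and \<theta>: "\<theta> \<in> strip_pi"
  shows "set_integrable lborel {0<..} (\<lambda>\<xi>. log_symbol a \<xi> \<theta>)"
proof -
  obtain C where C: "\<And>\<theta>' \<xi>. \<theta>' \<in> {\<theta>} \<Longrightarrow> 0 < \<xi> \<Longrightarrow> cmod (log_symbol a \<xi> \<theta>') \<le> C * symbol a \<xi>"
    by (rule log_symbol_bound[OF a, of "{\<theta>}"]) (use \<theta> in auto)
  have "set_integrable lborel {0<..} (\<lambda>\<xi>. C * symbol a \<xi>)"
    using symbol_power_integrable[of a 0] a by (intro set_integrable_mult_right) auto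
  then show ?thesis
  proof (rule set_integrable_bound)
    show "set_borel_measurable lborel {0<..} (\<lambda>\<xi>. log_symbol a \<xi> \<theta>)"
      unfolding set_borel_measurable_def using log_symbol_measurable by measurable
    show "AE \<xi> in lborel. \<xi> \<in> {0<..} \<longrightarrow> norm (log_symbol a \<xi> \<theta>) \<le> norm (C * symbol a \<xi>)"
      using C[of \<theta>] by (intro AE_I2 impI) (auto intro: order_trans[OF _ abs_ge_self])
  qed
qed

lemma scgf_ext_power_series:
  assumes a: "1 < a" and r: "0 < r" and sub: "cball z0 r \<subseteq> strip_pi" and z: "z \<in> ball z0 r"
  shows "(\<lambda>n. scgf_coeff a z0 n * (z - z0) ^ n) sums scgf_ext a z"
proof -
  let ?g = "\<lambda>\<xi> \<theta>. indicator {0<..} \<xi> *\<^sub>R log_symbol a \<xi> \<theta>"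
  obtain C where C: "\<And>\<theta> \<xi>. \<theta> \<in> cball z0 r \<Longrightarrow> 0 < \<xi> \<Longrightarrow> cmod (log_symbol a \<xi> \<theta>) \<le> C * symbol a \<xi>"
    using log_symbol_bound[OF a compact_cball sub] by blast
  have d: "(deriv ^^ n) (?g \<xi>) z0 = indicator {0<..} \<xi> *\<^sub>R (deriv ^^ n) (log_symbol a \<xi>) z0" for n \<xi>
  proof (cases "\<xi> > 0")
    case True
    then have "?g \<xi> = log_symbol a \<xi>" by (auto simp: indicator_def)
    then show ?thesis using True by simp
  next
    case False
    then have "?g \<xi> = (\<lambda>_. 0)" by (auto simp: indicator_def)
    then show ?thesis using False by simp
  qed
  have "(\<lambda>n. (\<integral>\<xi>. (deriv ^^ n) (?g \<xi>) z0 / fact n \<partial>lborel) * (z - z0) ^ n) sums (\<integral>\<xi>. ?g \<xi> z \<partial>lborel)"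
  proof (rule parameter_integral_power_series[OF r _ _ _ _ z])
    show "?g \<xi> holomorphic_on ball z0 r" for \<xi>
    proof (cases "\<xi> > 0")
      case True
      then have "?g \<xi> = log_symbol a \<xi>" by (auto simp: indicator_def)
      then show ?thesis using holomorphic_on_subset[OF log_symbol_holomorphic[OF a True]] sub
        by (metis ball_subset_cball order_trans)
    next
      case False
      then have "?g \<xi> = (\<lambda>_. 0)" by (auto simp: indicator_def)
      then show ?thesis by simp
    qed
    show "(\<lambda>\<xi>. ?g \<xi> \<theta>) \<in> borel_measurable lborel" for \<theta>
      using log_symbol_measurable by measurable
    show "integrable lborel (\<lambda>\<xi>. indicator {0<..} \<xi> *\<^sub>R (C * symbol a \<xi>))"
      using set_integrable_mult_right[of C lborel "{0<..}" "symbol a"] symbol_power_integrable[of a 0] a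
      unfolding set_integrable_def by simp
    show "norm (?g \<xi> \<theta>) \<le> indicator {0<..} \<xi> *\<^sub>R (C * symbol a \<xi>)" if "\<theta> \<in> ball z0 r" for \<xi> \<theta>
      using C[of \<theta> \<xi>] that by (auto simp: indicator_def)
  qed
  from sums_mult[OF this, of "1 / (2 * of_real pi)"] show ?thesis
    by (simp add: d scgf_coeff_def scgf_ext_def set_lebesgue_integral_def mult.assoc)
qed

lemma strip_pi_cball:
  assumes "z0 \<in> strip_pi"
  obtains r where "0 < r" "cball z0 r \<subseteq> strip_pi"
  using open_contains_cball open_strip_pi assms by blast

lemma scgf_ext_holomorphic:
  assumes a: "1 < a"
  shows "scgf_ext a holomorphic_on strip_pi"
  unfolding holomorphic_on_open[OF open_strip_pi]
proof
  fix z0 assume "z0 \<in> strip_pi"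
  then obtain r where r: "0 < r" "cball z0 r \<subseteq> strip_pi" by (rule strip_pi_cball)
  have "scgf_ext a holomorphic_on ball z0 r"
    by (rule power_series_holomorphic) (rule scgf_ext_power_series[OF a r])
  then show "\<exists>f'. (scgf_ext a has_field_derivative f') (at z0)"
    using r(1) holomorphic_on_open[OF open_ball] by (metis centre_in_ball)
qed

lemma of_real_in_strip: "of_real x \<in> strip_pi"
  by (simp add: strip_pi_def)

lemma scgf_ext_of_real:
  assumes a: "1 < a"
  shows "scgf_ext a (of_real \<theta>) = of_real (scgf a \<theta>)"
proof -
  have eq: "log_symbol a \<xi> (of_real \<theta>) = of_real (ln (1 + (exp \<theta> - 1) * symbol a \<xi>))" if "\<xi> > 0" for \<xi>
  proof -
    have "(1 - symbol a \<xi>) + exp \<theta> * symbol a \<xi> > 0"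
      using symbol_bounds[OF a that] by (intro add_pos_pos) auto
    then have "1 + (exp \<theta> - 1) * symbol a \<xi> > 0" by (simp add: algebra_simps)
    moreover have "1 + (exp (of_real \<theta>) - 1) * complex_of_real (symbol a \<xi>) = of_real (1 + (exp \<theta> - 1) * symbol a \<xi>)"
      by (simp add: exp_of_real)
    ultimately show ?thesis unfolding log_symbol_def by (simp only: Ln_of_real)
  qed
  have "(LINT \<xi>:{0<..}|lborel. log_symbol a \<xi> (of_real \<theta>))
      = (LINT \<xi>:{0<..}|lborel. complex_of_real (ln (1 + (exp \<theta> - 1) * symbol a \<xi>)))"
    by (rule set_lebesgue_integral_cong) (use eq in auto)
  also have "\<dots> = of_real (LINT \<xi>:{0<..}|lborel. ln (1 + (exp \<theta> - 1) * symbol a \<xi>))"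
    by (rule set_integral_complex_of_real)
  finally show ?thesis by (simp add: scgf_ext_def scgf_def)
qed

lemma scgf_real_analytic:
  assumes a: "1 < a"
  shows "real_analytic_on (scgf a) UNIV"
  unfolding real_analytic_on_def
proof
  fix x :: real
  obtain r where r: "0 < r" "cball (of_real x) r \<subseteq> strip_pi"
    using strip_pi_cball[OF of_real_in_strip] by blast
  show "\<exists>r>0. \<exists>c. \<forall>y\<in>ball x r. (\<lambda>n. c n * (y - x) ^ n) sums scgf a y"
  proof (intro exI[of _ r] conjI exI[of _ "\<lambda>n. Re (scgf_coeff a (of_real x) n)"] ballI r(1))
    fix y assume y: "y \<in> ball x r"
    have "dist (complex_of_real x) (of_real y) = dist x y"
      by (simp add: dist_norm flip: of_real_diff)
    then have "complex_of_real y \<in> ball (of_real x) r" using y by simp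
    from sums_Re[OF scgf_ext_power_series[OF a r this]]
    show "(\<lambda>n. Re (scgf_coeff a (of_real x) n) * (y - x) ^ n) sums scgf a y"
      by (simp add: scgf_ext_of_real[OF a] flip: of_real_diff of_real_power)
  qed
qed

text \<open>
  Used for the limit function and once more for its derivative.
\<close>

lemma real_derivative_from_extension:
  assumes F: "F holomorphic_on strip_pi" and f: "\<And>x. f x = Re (F (of_real x))"
  shows "(f has_real_derivative Re (deriv F (of_real x))) (at x)"
proof -
  have "(F has_field_derivative deriv F (of_real x)) (at (of_real x))"
    by (rule holomorphic_derivI[OF F open_strip_pi of_real_in_strip])
  then have "((\<lambda>x. F (of_real x)) has_vector_derivative deriv F (of_real x)) (at x)"
    by (rule has_vector_derivative_real_field)
  then have "((\<lambda>x. Re (F (of_real x))) has_vector_derivative Re (deriv F (of_real x))) (at x)"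
    by (rule bounded_linear.has_vector_derivative[OF bounded_linear_Re])
  then show ?thesis unfolding f[abs_def] has_real_derivative_iff_has_vector_derivative .
qed

lemma scgf_eq_Re: "1 < a \<Longrightarrow> scgf a x = Re (scgf_ext a (of_real x))"
  by (simp add: scgf_ext_of_real)

lemma scgf_derivative:
  assumes a: "1 < a"
  shows "(scgf a has_real_derivative Re (deriv (scgf_ext a) (of_real x))) (at x)"
  by (rule real_derivative_from_extension[OF scgf_ext_holomorphic[OF a]]) (rule scgf_eq_Re[OF a])

lemma scgf_second_derivative:
  assumes a: "1 < a"
  shows "(deriv (scgf a) has_real_derivative Re (deriv (deriv (scgf_ext a)) (of_real x))) (at x)"
  by (rule real_derivative_from_extension[OF holomorphic_deriv[OF scgf_ext_holomorphic[OF a] open_strip_pi]])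
     (rule DERIV_imp_deriv[OF scgf_derivative[OF a]])

text \<open>
  The power series at \<open>0\<close> is differentiated twice and evaluated at its centre.
\<close>

lemma scgf_ext_derivatives_0:
  assumes a: "1 < a"
  shows "deriv (scgf_ext a) 0 = scgf_coeff a 0 1" "deriv (deriv (scgf_ext a)) 0 = 2 * scgf_coeff a 0 2"
proof -
  have "(0 :: complex) \<in> strip_pi" using of_real_in_strip[of 0] by simp
  then obtain r where r: "0 < r" "cball 0 r \<subseteq> strip_pi" by (rule strip_pi_cball)
  have hol: "scgf_ext a holomorphic_on ball 0 r"
    by (rule holomorphic_on_subset[OF scgf_ext_holomorphic[OF a]]) (use r in auto)
  have s0: "(\<lambda>n. scgf_coeff a 0 n * z ^ n) sums scgf_ext a z" if "norm z < r" for z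
    using scgf_ext_power_series[OF a r, of z] that by simp
  have s1: "(\<lambda>n. diffs (scgf_coeff a 0) n * z ^ n) sums deriv (scgf_ext a) z" if "norm z < r" for z
    by (rule termdiffs_sums_strong[OF s0 _ that])
       (use that holomorphic_derivI[OF hol open_ball] in auto)
  have s2: "(\<lambda>n. diffs (diffs (scgf_coeff a 0)) n * z ^ n) sums deriv (deriv (scgf_ext a)) z" if "norm z < r" for z
    by (rule termdiffs_sums_strong[OF s1 _ that])
       (use that holomorphic_derivI[OF holomorphic_deriv[OF hol open_ball] open_ball] in auto)
  have "diffs (scgf_coeff a 0) 0 = deriv (scgf_ext a) 0"
    using s1[of 0] r by (simp add: powser_sums_zero_iff)
  then show "deriv (scgf_ext a) 0 = scgf_coeff a 0 1" by (simp add: diffs_def)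
  have "diffs (diffs (scgf_coeff a 0)) 0 = deriv (deriv (scgf_ext a)) 0"
    using s2[of 0] r by (simp add: powser_sums_zero_iff)
  then show "deriv (deriv (scgf_ext a)) 0 = 2 * scgf_coeff a 0 2" by (simp add: diffs_def numeral_2_eq_2)
qed

lemma log_symbol_derivatives_0:
  assumes a: "1 < a" "0 < \<xi>"
  shows "deriv (log_symbol a \<xi>) 0 = of_real (symbol a \<xi>)"
    "deriv (deriv (log_symbol a \<xi>)) 0 = of_real (symbol a \<xi> - symbol a \<xi> ^ 2)"
proof -
  let ?s = "complex_of_real (symbol a \<xi>)"
  have z: "(0 :: complex) \<in> strip_pi" using of_real_in_strip[of 0] by simp
  have d: "deriv (log_symbol a \<xi>) \<theta> = exp \<theta> * ?s / (1 + (exp \<theta> - 1) * ?s)" if "\<theta> \<in> strip_pi" for \<theta>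
    by (rule DERIV_imp_deriv[OF log_symbol_derivative[OF a that]])
  show "deriv (log_symbol a \<xi>) 0 = of_real (symbol a \<xi>)" using d[OF z] by simp
  have "((\<lambda>\<theta>. exp \<theta> * ?s / (1 + (exp \<theta> - 1) * ?s)) has_field_derivative ?s - ?s ^ 2) (at 0)"
    by (auto intro!: derivative_eq_intros simp: power2_eq_square)
  then have "(deriv (log_symbol a \<xi>) has_field_derivative ?s - ?s ^ 2) (at 0)"
    by (rule has_field_derivative_transform_within_open[OF _ open_strip_pi z]) (simp add: d)
  then show "deriv (deriv (log_symbol a \<xi>)) 0 = of_real (symbol a \<xi> - symbol a \<xi> ^ 2)"
    by (simp add: DERIV_imp_deriv)
qed

lemma symbol_moments:
  assumes a: "1 < a"
  shows "has_bochner_integral lborel (\<lambda>\<xi>. indicator {0<..} \<xi> *\<^sub>R symbol a \<xi>) (1 / 2 - 1 / (2 * a))"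
    "has_bochner_integral lborel (\<lambda>\<xi>. indicator {0<..} \<xi> *\<^sub>R symbol a \<xi> ^ 2) (1 / 4 - 2 / (2 + 2 * a) + 1 / (4 * a))"
proof -
  have e: "has_bochner_integral lborel (\<lambda>\<xi>. indicator {0<..} \<xi> *\<^sub>R exp (- c * \<xi>)) (1 / c)" if "0 < c" for c :: real
    by (rule has_bochner_integral_exp_decay[OF that])
  have "has_bochner_integral lborel (\<lambda>\<xi>. indicator {0<..} \<xi> *\<^sub>R exp (- 2 * \<xi>) - indicator {0<..} \<xi> *\<^sub>R exp (- (2 * a) * \<xi>)) (1 / 2 - 1 / (2 * a))"
    by (intro has_bochner_integral_diff e) (use a in auto)
  then show "has_bochner_integral lborel (\<lambda>\<xi>. indicator {0<..} \<xi> *\<^sub>R symbol a \<xi>) (1 / 2 - 1 / (2 * a))"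
    by (simp add: symbol_def scaleR_diff_right right_diff_distrib)
  have "has_bochner_integral lborel (\<lambda>\<xi>. indicator {0<..} \<xi> *\<^sub>R exp (- 4 * \<xi>)
      - 2 * (indicator {0<..} \<xi> *\<^sub>R exp (- (2 + 2 * a) * \<xi>)) + indicator {0<..} \<xi> *\<^sub>R exp (- (4 * a) * \<xi>))
      (1 / 4 - 2 * (1 / (2 + 2 * a)) + 1 / (4 * a))"
    by (intro has_bochner_integral_add has_bochner_integral_diff has_bochner_integral_mult_right e) (use a in auto)
  moreover have "indicator {0<..} \<xi> *\<^sub>R exp (- 4 * \<xi>)
      - 2 * (indicator {0<..} \<xi> *\<^sub>R exp (- (2 + 2 * a) * \<xi>)) + indicator {0<..} \<xi> *\<^sub>R exp (- (4 * a) * \<xi>)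
      = indicator {0<..} \<xi> *\<^sub>R symbol a \<xi> ^ 2" for \<xi> :: real
  proof -
    have "exp (- 4 * \<xi>) = exp (- 2 * \<xi>) * exp (- 2 * \<xi>)" "exp (- (4 * a) * \<xi>) = exp (- 2 * a * \<xi>) * exp (- 2 * a * \<xi>)"
      "exp (- (2 + 2 * a) * \<xi>) = exp (- 2 * \<xi>) * exp (- 2 * a * \<xi>)"
      unfolding exp_add[symmetric] by (simp_all add: algebra_simps)
    then show ?thesis by (simp add: symbol_def power2_eq_square algebra_simps)
  qed
  ultimately show "has_bochner_integral lborel (\<lambda>\<xi>. indicator {0<..} \<xi> *\<^sub>R symbol a \<xi> ^ 2) (1 / 4 - 2 / (2 + 2 * a) + 1 / (4 * a))"
    by simp
qed

theorem scgf_derivatives_at_0: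
  assumes a: "1 < a"
  shows "(scgf a has_real_derivative 1 / (4 * pi) * (1 - 1 / a)) (at 0)"
    "(deriv (scgf a) has_real_derivative (a - 1) * (a + 3) / (8 * pi * a * (a + 1))) (at 0)"
proof -
  have "scgf_coeff a 0 1 = 1 / (2 * of_real pi) * (LINT \<xi>:{0<..}|lborel. complex_of_real (symbol a \<xi>))"
    unfolding scgf_coeff_def
    by (intro arg_cong2[where f = "(*)"] refl set_lebesgue_integral_cong) (auto simp: log_symbol_derivatives_0[OF a])
  also have "\<dots> = of_real (1 / (2 * pi) * (1 / 2 - 1 / (2 * a)))"
    using has_bochner_integral_integral_eq[OF symbol_moments(1)[OF a]]
    by (simp add: set_integral_complex_of_real set_lebesgue_integral_def)
  finally have c1: "Re (deriv (scgf_ext a) 0) = 1 / (2 * pi) * (1 / 2 - 1 / (2 * a))"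
    unfolding scgf_ext_derivatives_0[OF a] by (simp only: Re_complex_of_real)
  have "1 / (2 * pi) * (1 / 2 - 1 / (2 * a)) = 1 / (4 * pi) * (1 - 1 / a)"
    using a by (simp add: field_simps)
  then show "(scgf a has_real_derivative 1 / (4 * pi) * (1 - 1 / a)) (at 0)"
    using scgf_derivative[OF a, of 0] c1 by simp
  have "scgf_coeff a 0 2 = 1 / (2 * of_real pi) * (LINT \<xi>:{0<..}|lborel. complex_of_real ((symbol a \<xi> - symbol a \<xi> ^ 2) / 2))"
    unfolding scgf_coeff_def
    by (intro arg_cong2[where f = "(*)"] refl set_lebesgue_integral_cong)
       (auto simp: log_symbol_derivatives_0[OF a] numeral_2_eq_2)
  also have "\<dots> = of_real (1 / (2 * pi) * (LINT \<xi>:{0<..}|lborel. (symbol a \<xi> - symbol a \<xi> ^ 2) / 2))"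
    by (simp only: set_integral_complex_of_real) simp
  also have "(LINT \<xi>:{0<..}|lborel. (symbol a \<xi> - symbol a \<xi> ^ 2) / 2)
      = ((1 / 2 - 1 / (2 * a)) - (1 / 4 - 2 / (2 + 2 * a) + 1 / (4 * a))) / 2"
    using has_bochner_integral_integral_eq[OF has_bochner_integral_divide_zero[OF has_bochner_integral_diff[OF symbol_moments[OF a]], of 2]]
    by (simp add: set_lebesgue_integral_def scaleR_diff_right right_diff_distrib diff_divide_distrib)
  finally have c2: "Re (deriv (deriv (scgf_ext a)) 0) = 2 * (1 / (2 * pi) * (((1 / 2 - 1 / (2 * a)) - (1 / 4 - 2 / (2 + 2 * a) + 1 / (4 * a))) / 2))"
    unfolding scgf_ext_derivatives_0[OF a] by simp
  have "2 * (1 / (2 * pi) * (((1 / 2 - 1 / (2 * a)) - (1 / 4 - 2 / (2 + 2 * a) + 1 / (4 * a))) / 2))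
      = (a - 1) * (a + 3) / (8 * pi * a * (a + 1))"
  proof -
    have nz: "a \<noteq> 0" "1 + a \<noteq> 0" using a by auto
    have "2 / (2 + 2 * a) = 1 / (1 + a)" using nz by (simp add: field_simps)
    then have "(1 / 2 - 1 / (2 * a)) - (1 / 4 - 2 / (2 + 2 * a) + 1 / (4 * a)) = (a - 1) * (a + 3) / (4 * a * (a + 1))"
      using nz by (simp add: divide_simps) (simp add: algebra_simps)
    then show ?thesis by simp
  qed
  then show "(deriv (scgf a) has_real_derivative (a - 1) * (a + 3) / (8 * pi * a * (a + 1))) (at 0)"
    using scgf_second_derivative[OF a, of 0] c2 by simp
qed


section \<open>Locally uniform convergence\<close>

text \<open>
  This is a theorem of Polya. On an interval on which \<open>g\<close> varies little, a monotone function that is close to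
  \<open>g\<close> at both ends is close to \<open>g\<close> in between; finitely many such intervals cover a compact set.
\<close>

lemma mono_pointwise_limit_uniform:
  fixes f :: "'i \<Rightarrow> real \<Rightarrow> real"
  assumes lim: "\<And>x. ((\<lambda>L. f L x) \<longlongrightarrow> g x) F"
    and mono: "\<forall>\<^sub>F L in F. mono (f L)" and cont: "\<And>x. isCont g x" and K: "compact K"
  shows "uniform_limit K f g F"
  unfolding uniform_limit_iff
proof (intro allI impI)
  fix \<epsilon> :: real assume \<epsilon>: "\<epsilon> > 0"
  have loc: "\<exists>d>0. \<forall>\<^sub>F L in F. \<forall>y\<in>ball x d. dist (f L y) (g y) < \<epsilon>" for x
  proof -
    obtain d' where d': "d' > 0" "\<And>y. \<bar>y - x\<bar> < d' \<Longrightarrow> \<bar>g y - g x\<bar> < \<epsilon> / 3"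
      using cont[of x] \<epsilon> unfolding continuous_at_eps_delta dist_real_def by (metis zero_less_divide_iff zero_less_numeral)
    define d where "d = d' / 2"
    have d: "d > 0" "d < d'" using d' by (auto simp: d_def)
    have "\<forall>\<^sub>F L in F. dist (f L (x - d)) (g (x - d)) < \<epsilon> / 3" "\<forall>\<^sub>F L in F. dist (f L (x + d)) (g (x + d)) < \<epsilon> / 3"
      using tendstoD[OF lim, of "\<epsilon> / 3"] \<epsilon> by auto
    then have "\<forall>\<^sub>F L in F. \<forall>y\<in>ball x d. dist (f L y) (g y) < \<epsilon>"
      using mono
    proof eventually_elim
      case (elim L)
      show ?case
      proof
        fix y assume "y \<in> ball x d"
        then have y: "x - d \<le> y" "y \<le> x + d" "\<bar>y - x\<bar> < d'" using d by (auto simp: dist_real_def)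
        have "f L (x - d) \<le> f L y" "f L y \<le> f L (x + d)" using y elim(3) by (auto dest: monoD)
        moreover have "\<bar>g (x - d) - g x\<bar> < \<epsilon> / 3" "\<bar>g (x + d) - g x\<bar> < \<epsilon> / 3" "\<bar>g y - g x\<bar> < \<epsilon> / 3"
          by (rule d'(2), use d y in simp)+
        moreover have "\<epsilon> / 3 + \<epsilon> / 3 + \<epsilon> / 3 = \<epsilon>" by simp
        ultimately show "dist (f L y) (g y) < \<epsilon>" using elim(1,2) unfolding dist_real_def by linarith
      qed
    qed
    then show ?thesis using d by blast
  qed
  define P where "P x d \<longleftrightarrow> (\<forall>\<^sub>F L in F. \<forall>y\<in>ball x d. dist (f L y) (g y) < \<epsilon>)" for x d
  have "\<exists>d>0. P x d" for x using loc by (simp only: P_def)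
  then obtain d where d: "\<And>x. d x > 0" "\<And>x. P x (d x)" by metis
  have "K \<subseteq> (\<Union>x\<in>K. ball x (d x))" using d(1) by (auto intro!: bexI)
  then obtain A where A: "A \<subseteq> K" "finite A" "K \<subseteq> (\<Union>x\<in>A. ball x (d x))"
    by (rule compactE_image[OF K, rotated]) auto
  have "\<forall>\<^sub>F L in F. \<forall>x\<in>A. \<forall>y\<in>ball x (d x). dist (f L y) (g y) < \<epsilon>"
    using A(2) d(2) unfolding P_def by (intro eventually_ball_finite) auto
  then show "\<forall>\<^sub>F L in F. \<forall>y\<in>K. dist (f L y) (g y) < \<epsilon>"
    by eventually_elim (use A(3) in blast)
qed

lemma (in rect_counts) scaled_log_mgf_mono: "mono (scaled_log_mgf M Z a L)"
proof (rule monoI)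
  fix x y :: real assume xy: "x \<le> y"
  have "0 < (\<integral>\<omega>. exp (x * real (N \<omega>)) \<partial>M)"
    by (rule expectation_greater) (use exp_count_integrable in auto)
  moreover have "(\<integral>\<omega>. exp (x * real (N \<omega>)) \<partial>M) \<le> (\<integral>\<omega>. exp (y * real (N \<omega>)) \<partial>M)"
    using xy by (intro integral_mono exp_count_integrable) (simp add: mult_right_mono)
  ultimately have "ln (\<integral>\<omega>. exp (x * real (N \<omega>)) \<partial>M) \<le> ln (\<integral>\<omega>. exp (y * real (N \<omega>)) \<partial>M)"
    by simp
  then show "scaled_log_mgf M Z a L x \<le> scaled_log_mgf M Z a L y"
    unfolding scaled_log_mgf_def using L by (intro mult_left_mono) auto
qed

theorem scaled_log_mgf_locally_uniform_limit:
  assumes proc: "determinantal_process M area_H K_H Z" and a: "1 < a"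
  shows "\<exists>U. open U \<and> \<theta> \<in> U \<and> uniform_limit U (scaled_log_mgf M Z a) (scgf a) at_top"
proof (intro exI[of _ "ball \<theta> 1"] conjI)
  have "uniform_limit (cball \<theta> 1) (scaled_log_mgf M Z a) (scgf a) at_top"
  proof (rule mono_pointwise_limit_uniform)
    show "((\<lambda>L. scaled_log_mgf M Z a L x) \<longlongrightarrow> scgf a x) at_top" for x
      by (rule scaled_log_mgf_limit[OF proc a])
    show "\<forall>\<^sub>F L in at_top. mono (scaled_log_mgf M Z a L)"
      using eventually_gt_at_top[of 0]
    proof eventually_elim
      case (elim L)
      interpret rect_counts M Z a L by unfold_locales (use proc a elim in auto)
      show ?case by (rule scaled_log_mgf_mono)
    qed
    show "isCont (scgf a) x" for x by (rule DERIV_isCont[OF scgf_derivative[OF a]])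
  qed simp
  then show "uniform_limit (ball \<theta> 1) (scaled_log_mgf M Z a) (scgf a) at_top"
    by (rule uniform_limit_on_subset) auto
qed auto

theorem theorem1p1:
  fixes M :: "'w measure" and Z :: "'w \<Rightarrow> complex set" and a :: real
  assumes "determinantal_process M area_H K_H Z"
    and "1 < a"
  shows "(\<forall>L>0. \<forall>\<theta>. integrable M (\<lambda>\<omega>. exp (\<theta> * real (box_count Z a L \<omega>)))) \<and>
    (\<exists>\<Lambda> :: real \<Rightarrow> real.
      (\<forall>\<theta>. ((\<lambda>L. scaled_log_mgf M Z a L \<theta>) \<longlongrightarrow> \<Lambda> \<theta>) at_top) \<and>
      (\<forall>\<theta>. \<exists>U. open U \<and> \<theta> \<in> U \<and> uniform_limit U (scaled_log_mgf M Z a) \<Lambda> at_top) \<and>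
      (\<forall>\<theta>. set_integrable lborel {0<..}
              (\<lambda>\<xi>. ln (1 + (exp \<theta> - 1) * (exp (- 2 * \<xi>) - exp (- 2 * a * \<xi>)))) \<and>
           \<Lambda> \<theta> = 1 / (2 * pi) *
              (LINT \<xi>:{0<..}|lborel. ln (1 + (exp \<theta> - 1) * (exp (- 2 * \<xi>) - exp (- 2 * a * \<xi>))))) \<and>
      real_analytic_on \<Lambda> UNIV \<and>
      (\<exists>F :: complex \<Rightarrow> complex. \<exists>l :: real \<Rightarrow> complex \<Rightarrow> complex.
         F holomorphic_on strip_pi \<and>
         (\<forall>\<theta>::real. F (of_real \<theta>) = of_real (\<Lambda> \<theta>)) \<and>
         (\<forall>\<xi>>0. log_branch_from_0 strip_pi
              (\<lambda>\<theta>. 1 + (exp \<theta> - 1) * of_real (exp (- 2 * \<xi>) - exp (- 2 * a * \<xi>))) (l \<xi>)) \<and>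
         (\<forall>\<theta>\<in>strip_pi. set_integrable lborel {0<..} (\<lambda>\<xi>. l \<xi> \<theta>) \<and>
            F \<theta> = 1 / (2 * of_real pi) * (LINT \<xi>:{0<..}|lborel. l \<xi> \<theta>))) \<and>
      (\<Lambda> has_real_derivative 1 / (4 * pi) * (1 - 1 / a)) (at 0) \<and>
      (deriv \<Lambda> has_real_derivative (a - 1) * (a + 3) / (8 * pi * a * (a + 1))) (at 0))"
proof (intro conjI exI[of _ "scgf a"] exI[of _ "scgf_ext a"] exI[of _ "log_symbol a"] allI impI ballI)
  note proc = assms(1) and a = assms(2)
  fix \<theta> :: real
  show "integrable M (\<lambda>\<omega>. exp (\<theta> * real (box_count Z a L \<omega>)))" if "L > 0" for L
  proof -
    interpret rect_counts M Z a L by unfold_locales (use proc a that in auto)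
    show ?thesis by (rule exp_count_integrable)
  qed
  show "((\<lambda>L. scaled_log_mgf M Z a L \<theta>) \<longlongrightarrow> scgf a \<theta>) at_top"
    by (rule scaled_log_mgf_limit[OF proc a])
  show "\<exists>U. open U \<and> \<theta> \<in> U \<and> uniform_limit U (scaled_log_mgf M Z a) (scgf a) at_top"
    by (rule scaled_log_mgf_locally_uniform_limit[OF proc a])
  show "set_integrable lborel {0<..} (\<lambda>\<xi>. ln (1 + (exp \<theta> - 1) * (exp (- 2 * \<xi>) - exp (- 2 * a * \<xi>))))"
    using ln_symbol_integrable[OF a, of "exp \<theta> - 1"] by (simp add: symbol_def)
  show "scgf a \<theta> = 1 / (2 * pi) *
      (LINT \<xi>:{0<..}|lborel. ln (1 + (exp \<theta> - 1) * (exp (- 2 * \<xi>) - exp (- 2 * a * \<xi>))))"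
    by (simp add: scgf_def symbol_def)
  show "scgf_ext a (of_real \<theta>) = of_real (scgf a \<theta>)"
    by (rule scgf_ext_of_real[OF a])
next
  show "real_analytic_on (scgf a) UNIV" by (rule scgf_real_analytic[OF assms(2)])
  show "scgf_ext a holomorphic_on strip_pi" by (rule scgf_ext_holomorphic[OF assms(2)])
next
  fix \<xi> :: real assume "0 < \<xi>"
  then show "log_branch_from_0 strip_pi
      (\<lambda>\<theta>. 1 + (exp \<theta> - 1) * of_real (exp (- 2 * \<xi>) - exp (- 2 * a * \<xi>))) (log_symbol a \<xi>)"
    using log_symbol_branch[OF assms(2)] by (simp only: symbol_def)
next
  fix \<theta> :: complex assume "\<theta> \<in> strip_pi"
  then show "set_integrable lborel {0<..} (\<lambda>\<xi>. log_symbol a \<xi> \<theta>)"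
    by (rule log_symbol_integrable[OF assms(2)])
  show "scgf_ext a \<theta> = 1 / (2 * of_real pi) * (LINT \<xi>:{0<..}|lborel. log_symbol a \<xi> \<theta>)"
    by (rule scgf_ext_def)
next
  show "(scgf a has_real_derivative 1 / (4 * pi) * (1 - 1 / a)) (at 0)"
    "(deriv (scgf a) has_real_derivative (a - 1) * (a + 3) / (8 * pi * a * (a + 1))) (at 0)"
    by (rule scgf_derivatives_at_0[OF assms(2)])+
qed

end
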